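(* The Pauli representation $\pi:A_s(4)\to C(SU_2,M_4(\mathbb C))$ is faithful, i.e. injective.
   Context: A magic unitary over a $C^*$-algebra $A$ is a matrix $u\in M_n(A)$ whose entries are projections ($p=p^2=p^*$) such that on each row and on each column the entries are pairwise orthogonal and sum up to $1$. $A_s(4)$ is the universal $C^*$-algebra generated by $16$ elements $u_{ij}$ ($1\le i,j\le 4$) with the relations making $(u_{ij})$ a $4\times 4$ magic unitary matrix. Pauli matrices: $$c_1=\begin{pmatrix}1&0\\0&1\end{pmatrix},\quad c_2=\begin{pmatrix}i&0\\0&-i\end{pmatrix},\quad c_3=\begin{pmatrix}0&1\\-1&0\end{pmatrix},\quad c_4=\begin{pmatrix}0&i\\i&0\end{pmatrix}.$$ $M_2(\mathbb C)$ is viewed as a $4$-dimensional Hilbert space with scalar product $\langle a,b\rangle=\mathrm{tr}(b^*a)$, where $\mathrm{tr}$ is the normalized trace ($\mathrm{tr}(1)=1$). For every $x\in SU_2$, each row and each column of the array $(c_ixc_j)_{ij}$ is an orthonormal basis of $M_2(\mathbb C)$. Fix a Hilbert space isomorphism $M_2(\mathbb C)\simeq\mathbb C^4$ and the corresponding identification $B(M_2(\mathbb C))\simeq M_4(\mathbb C)$. The Pauli representation is the $*$-homomorphism $\pi:A_s(4)\to C(SU_2,M_4(\mathbb C))$ that maps $u_{ij}$ to the function $x\mapsto$ (the rank one orthogonal projection onto $c_ixc_j$). *)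

theory Defs
  imports "HOL-Analysis.Analysis" "HOL-Library.Poly_Mapping"
begin

class scaleC =
  fixes scaleC :: "complex \<Rightarrow> 'a \<Rightarrow> 'a" (infixr "*\<^sub>C" 75)

class star =
  fixes star :: "'a \<Rightarrow> 'a"

text \<open>
  Unital C*-algebras.  The superclasses do not force \<open>0 \<noteq> 1\<close>, so the zero algebra is an instance.
\<close>

class cstar_algebra = real_normed_algebra + monoid_mult + banach + scaleC + star +
  assumes scaleC_add_right: "c *\<^sub>C (x + y) = c *\<^sub>C x + c *\<^sub>C y"
    and scaleC_add_left: "(c + d) *\<^sub>C x = c *\<^sub>C x + d *\<^sub>C x"
    and scaleC_scaleC: "c *\<^sub>C d *\<^sub>C x = (c * d) *\<^sub>C x"
    and scaleR_scaleC: "r *\<^sub>R x = complex_of_real r *\<^sub>C x"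
    and mult_scaleC_left: "(c *\<^sub>C x) * y = c *\<^sub>C (x * y)"
    and mult_scaleC_right: "x * (c *\<^sub>C y) = c *\<^sub>C (x * y)"
    and norm_scaleC: "norm (c *\<^sub>C x) = cmod c * norm x"
    and star_add: "star (x + y) = star x + star y"
    and star_scaleC: "star (c *\<^sub>C x) = cnj c *\<^sub>C star x"
    and star_mult: "star (x * y) = star y * star x"
    and star_star: "star (star x) = x"
    and cstar_identity: "norm (star x * x) = (norm x)\<^sup>2"

definition star_hom :: "('a::cstar_algebra \<Rightarrow> 'b::cstar_algebra) \<Rightarrow> bool" where
  "star_hom \<phi> \<longleftrightarrow>
     (\<forall>x y. \<phi> (x + y) = \<phi> x + \<phi> y) \<and> (\<forall>c x. \<phi> (c *\<^sub>C x) = c *\<^sub>C \<phi> x) \<and>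
     (\<forall>x y. \<phi> (x * y) = \<phi> x * \<phi> y) \<and> \<phi> 1 = 1 \<and> (\<forall>x. \<phi> (star x) = star (\<phi> x))"

definition is_projection :: "'a::cstar_algebra \<Rightarrow> bool" where
  "is_projection p \<longleftrightarrow> p * p = p \<and> star p = p"

definition magic_unitary :: "('n::finite \<Rightarrow> 'n \<Rightarrow> 'a::cstar_algebra) \<Rightarrow> bool" where
  "magic_unitary u \<longleftrightarrow>
     (\<forall>i j. is_projection (u i j)) \<and>
     (\<forall>i j k. j \<noteq> k \<longrightarrow> u i j * u i k = 0) \<and> (\<forall>i. (\<Sum>j\<in>UNIV. u i j) = 1) \<and>
     (\<forall>i j k. j \<noteq> k \<longrightarrow> u j i * u k i = 0) \<and> (\<forall>j. (\<Sum>i\<in>UNIV. u i j) = 1)"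

lemma scaleC_one [simp]: "1 *\<^sub>C x = (x::'a::cstar_algebra)"
  using scaleR_scaleC[of 1 x] by simp

lemma scaleC_zero_left [simp]: "0 *\<^sub>C x = (0::'a::cstar_algebra)"
  using scaleR_scaleC[of 0 x] by simp

lemma scaleC_zero_right [simp]: "c *\<^sub>C 0 = (0::'a::cstar_algebra)"
  using scaleC_add_right[of c 0 "0::'a"] by simp

lemma scaleC_minus_one: "(-1) *\<^sub>C x = - (x::'a::cstar_algebra)"
  using scaleR_scaleC[of "-1" x] by simp

lemma star_zero [simp]: "star (0::'a::cstar_algebra) = 0"
  using star_add[of 0 "0::'a"] by simp

lemma star_one [simp]: "star (1::'a::cstar_algebra) = 1"
  by (metis mult_1 mult_1_right star_mult star_star)

lemma star_minus: "star (- x) = - star (x::'a::cstar_algebra)"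
  by (metis complex_cnj_minus complex_cnj_one scaleC_minus_one star_scaleC)

lemma star_power: "star (x ^ n) = (star (x::'a::cstar_algebra)) ^ n"
  by (induction n) (simp_all add: star_mult power_commutes)

lemma norm_star [simp]: "norm (star x) = norm (x::'a::cstar_algebra)"
proof -
  have le: "norm y \<le> norm (star y)" for y :: 'a
  proof (cases "norm y = 0")
    case False
    have "norm y * norm y = norm (star y * y)"
      by (simp add: cstar_identity power2_eq_square)
    also have "\<dots> \<le> norm (star y) * norm y" by (rule norm_mult_ineq)
    finally show ?thesis using False by simp
  qed simp
  show ?thesis using le[of x] le[of "star x"] by (simp add: star_star)
qed

lemma norm_one_le: "norm (1::'a::cstar_algebra) \<le> 1"
proof -
  have "(norm (1::'a))\<^sup>2 = norm (1::'a)"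
    using cstar_identity[of "1::'a"] by simp
  then show ?thesis by (cases "norm (1::'a) = 0") (auto simp: power2_eq_square)
qed

lemma bounded_linear_star: "bounded_linear (star :: 'a::cstar_algebra \<Rightarrow> 'a)"
  by (rule bounded_linear_intro[of _ 1]) (simp_all add: star_add scaleR_scaleC star_scaleC)

lemma bounded_linear_scaleC: "bounded_linear (\<lambda>x::'a::cstar_algebra. c *\<^sub>C x)"
  by (rule bounded_linear_intro[of _ "cmod c"])
    (simp_all add: scaleR_scaleC scaleC_add_right scaleC_scaleC norm_scaleC mult.commute)

lemma norm_power_le: "norm (x ^ n) \<le> norm (x::'a::cstar_algebra) ^ n"
proof (induction n)
  case (Suc n)
  have "norm (x ^ Suc n) \<le> norm x * norm (x ^ n)" by (simp add: norm_mult_ineq)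
  also have "\<dots> \<le> norm x * norm x ^ n" using Suc by (simp add: mult_left_mono)
  finally show ?case by simp
qed (simp add: norm_one_le)

lemma cstar_sqrt_one_plus:
  fixes a :: "'a::cstar_algebra"
  assumes a: "norm a < 1" and sa: "star a = a"
  obtains y where "y * y = 1 + a" "star y = y" "\<And>h. h * a = a * h \<Longrightarrow> h * y = y * h"
proof -
  define b where "b n = ((1/2::real) gchoose n) *\<^sub>R a ^ n" for n
  have sn: "summable (\<lambda>n. norm (b n))"
  proof -
    obtain r where r: "norm a < r" "r < 1" using a dense by blast
    have r0: "r > 0" using r norm_ge_zero[of a] by linarith
    have "summable (\<lambda>n. ((1/2::real) gchoose n) * r ^ n)"
      using gen_binomial_real[of r "1/2"] r r0 by (auto simp: sums_iff)
    then have "summable (\<lambda>n. norm (((1/2::real) gchoose n) * norm a ^ n))"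
      by (rule powser_insidea) (use r r0 in auto)
    then show ?thesis
      by (rule summable_comparison_test')
        (simp add: b_def norm_mult abs_mult norm_power_le mult_left_mono)
  qed
  define y where "y = suminf b"
  have bs: "b sums y" unfolding y_def using sn by (simp add: summable_norm_cancel summable_sums)
  have coeff: "(\<Sum>i\<le>k. b i * b (k - i)) = ((1::real) gchoose k) *\<^sub>R a ^ k" for k
  proof -
    have "(\<Sum>i\<le>k. b i * b (k - i)) = (\<Sum>i\<le>k. (((1/2::real) gchoose i) * ((1/2) gchoose (k - i))) *\<^sub>R a ^ k)"
      by (intro sum.cong) (auto simp: b_def power_add[symmetric])
    also have "\<dots> = (\<Sum>i\<le>k. ((1/2::real) gchoose i) * ((1/2) gchoose (k - i))) *\<^sub>R a ^ k"
      by (simp add: scaleR_sum_left)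
    also have "(\<Sum>i\<le>k. ((1/2::real) gchoose i) * ((1/2) gchoose (k - i))) = (1::real) gchoose k"
      using gbinomial_Vandermonde[of "1/2::real" "1/2" k] by (simp add: atMost_atLeast0)
    finally show ?thesis .
  qed
  have "(\<lambda>k. ((1::real) gchoose k) *\<^sub>R a ^ k) sums (y * y)"
    using Cauchy_product_sums[OF sn sn] by (simp add: coeff y_def)
  moreover have "(\<lambda>k. ((1::real) gchoose k) *\<^sub>R a ^ k) sums (\<Sum>k\<in>{0,1}. ((1::real) gchoose k) *\<^sub>R a ^ k)"
  proof (rule sums_finite)
    fix k :: nat assume "k \<notin> {0,1}"
    then have "(1::nat) < k" by auto
    then have "of_nat (1::nat) gchoose k = (0::real)" by (simp only: binomial_gbinomial[symmetric]) simp
    then show "((1::real) gchoose k) *\<^sub>R a ^ k = 0" by simp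
  qed simp
  ultimately have "y * y = (\<Sum>k\<in>{0,1}. ((1::real) gchoose k) *\<^sub>R a ^ k)" by (rule sums_unique2)
  then have 1: "y * y = 1 + a" by simp
  have "(\<lambda>n. star (b n)) sums star y" by (rule bounded_linear.sums[OF bounded_linear_star bs])
  moreover have "(\<lambda>n. star (b n)) = b"
    by (simp add: b_def fun_eq_iff scaleR_scaleC star_scaleC star_power sa)
  ultimately have 2: "star y = y" using bs sums_unique2 by metis
  have 3: "h * y = y * h" if "h * a = a * h" for h
  proof -
    have pw: "h * a ^ n = a ^ n * h" for n
      by (induction n) (simp_all, metis mult.assoc that)
    have "(\<lambda>n. h * b n) sums (h * y)"
      by (rule bounded_linear.sums[OF bounded_linear_mult_right bs])
    moreover have "(\<lambda>n. b n * h) sums (y * h)"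
      by (rule bounded_linear.sums[OF bounded_linear_mult_left bs])
    ultimately show ?thesis by (simp add: b_def pw sums_unique2)
  qed
  show thesis using that[OF 1 2 3] .
qed

lemma star_hom_zero: "star_hom \<phi> \<Longrightarrow> \<phi> 0 = 0"
  unfolding star_hom_def by (metis scaleC_zero_left)

lemma star_hom_add: "star_hom \<phi> \<Longrightarrow> \<phi> (x + y) = \<phi> x + \<phi> y"
  by (simp add: star_hom_def)

lemma star_hom_minus: "star_hom \<phi> \<Longrightarrow> \<phi> (x - y) = \<phi> x - \<phi> y"
  unfolding star_hom_def by (metis add_diff_cancel diff_add_cancel)

lemma star_hom_sum: "star_hom \<phi> \<Longrightarrow> \<phi> (sum f A) = (\<Sum>x\<in>A. \<phi> (f x))"
  by (induction A rule: infinite_finite_induct) (simp_all add: star_hom_zero star_hom_add)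

lemma star_hom_contractive:
  fixes \<phi> :: "'a::cstar_algebra \<Rightarrow> 'b::cstar_algebra"
  assumes hom: "star_hom \<phi>"
  shows "norm (\<phi> x) \<le> norm x"
proof -
  have add: "\<phi> (x + y) = \<phi> x + \<phi> y" and sc: "\<phi> (c *\<^sub>C x) = c *\<^sub>C \<phi> x"
    and mul: "\<phi> (x * y) = \<phi> x * \<phi> y" and one: "\<phi> 1 = 1"
    and st: "\<phi> (star x) = star (\<phi> x)" for x y c
    using hom by (auto simp: star_hom_def)
  have unit: "norm (\<phi> h) \<le> 1" if h: "norm h < 1" "star h = h" for h
  proof -
    have "norm (- (h * h)) < 1"
      using norm_mult_ineq[of h h] h(1) mult_strict_mono'[of "norm h" 1 "norm h" 1] by simp
    moreover have "star (- (h * h)) = - (h * h)" by (simp add: star_minus star_mult h)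
    moreover have "h * (- (h * h)) = (- (h * h)) * h" by (simp add: mult.assoc)
    ultimately obtain y where y: "y * y = 1 + - (h * h)" "star y = y" "h * y = y * h"
      using cstar_sqrt_one_plus[of "- (h * h)"] by blast
    define H Y where "H = \<phi> h" and "Y = \<phi> y"
    have HY: "H * Y = Y * H" "star H = H" "star Y = Y"
      by (simp_all add: H_def Y_def mul[symmetric] st[symmetric] y h)
    have "H * H + Y * Y = \<phi> (h * h + y * y)" by (simp add: H_def Y_def add mul)
    also have "\<dots> = 1" using y(1) one by simp
    finally have HY1: "H * H + Y * Y = 1" .
    have nU: "norm (H + c *\<^sub>C Y) \<le> 1" if c: "cnj c = - c" "c * c = -1" for c
    proof -
      have "star (H + c *\<^sub>C Y) * (H + c *\<^sub>C Y) = (H + (- c) *\<^sub>C Y) * (H + c *\<^sub>C Y)"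
        by (simp add: star_add star_scaleC HY c)
      also have "\<dots> = (H * H + c *\<^sub>C (H * Y)) + ((- c) *\<^sub>C (Y * H) + ((- c) * c) *\<^sub>C (Y * Y))"
        by (simp only: distrib_left distrib_right mult_scaleC_left mult_scaleC_right scaleC_add_right
            scaleC_scaleC mult.commute[of c] add.assoc) (simp add: add_ac)
      also have "\<dots> = H * H + (c *\<^sub>C (H * Y) + (- c) *\<^sub>C (Y * H)) + ((- c) * c) *\<^sub>C (Y * Y)"
        by (simp only: add.assoc)
      also have "c *\<^sub>C (H * Y) + (- c) *\<^sub>C (Y * H) = 0"
        by (simp add: HY scaleC_add_left[symmetric])
      also have "((- c) * c) *\<^sub>C (Y * Y) = Y * Y" using c by simp
      finally have "star (H + c *\<^sub>C Y) * (H + c *\<^sub>C Y) = 1" using HY1 by simp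
      then have "(norm (H + c *\<^sub>C Y))\<^sup>2 \<le> 1"
        by (simp only: cstar_identity[symmetric] norm_one_le)
      then show ?thesis by (simp add: power2_le_iff_abs_le abs_square_le_1)
    qed
    have "2 *\<^sub>R H = (H + \<i> *\<^sub>C Y) + (H + (- \<i>) *\<^sub>C Y)"
      using scaleC_add_left[of "\<i>" "- \<i>" Y] by (simp add: scaleR_2 algebra_simps)
    moreover have "norm (H + \<i> *\<^sub>C Y) + norm (H + (- \<i>) *\<^sub>C Y) \<le> 1 + 1"
      by (intro add_mono nU) simp_all
    ultimately have "norm (2 *\<^sub>R H) \<le> 1 + 1"
      by (simp only: norm_triangle_le)
    then show ?thesis by (simp add: H_def)
  qed
  have selfadj: "norm (\<phi> h) \<le> norm h" if h: "star h = h" for h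
  proof (rule field_le_epsilon)
    fix e :: real assume e: "e > 0"
    define t where "t = norm h + e"
    have t: "t > 0" using e by (simp add: t_def add_nonneg_pos)
    have "norm (inverse t *\<^sub>R h) < 1" using t e by (simp add: t_def field_simps)
    moreover have "star (inverse t *\<^sub>R h) = inverse t *\<^sub>R h" by (simp add: scaleR_scaleC star_scaleC h)
    ultimately have "norm (\<phi> (inverse t *\<^sub>R h)) \<le> 1" by (rule unit)
    then have "norm (inverse t *\<^sub>R \<phi> h) \<le> 1" by (simp add: scaleR_scaleC sc)
    then show "norm (\<phi> h) \<le> norm h + e" using t by (simp add: t_def field_simps)
  qed
  have "(norm (\<phi> x))\<^sup>2 = norm (\<phi> (star x * x))" by (simp add: mul st cstar_identity)
  also have "\<dots> \<le> (norm x)\<^sup>2" using selfadj[of "star x * x"] by (simp add: star_mult star_star cstar_identity)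
  finally show ?thesis by (simp add: abs_le_square_iff[symmetric])
qed

datatype 'a free_monoid = Free_Monoid (letters: "'a list")

instantiation free_monoid :: (type) monoid_add
begin
definition "0 = Free_Monoid []"
definition "v + w = Free_Monoid (letters v @ letters w)"
instance
  by standard (simp_all add: zero_free_monoid_def plus_free_monoid_def)
end

text \<open>
  The free unital complex *-algebra on self-adjoint letters \<open>u\<^sub>i\<^sub>j\<close>: complex combinations of words with
  concatenation as product.  The relations \<open>star u\<^sub>i\<^sub>j = u\<^sub>i\<^sub>j\<close> of a magic unitary are built into
  the involution, which reverses words and conjugates coefficients; the others are \<open>magic_relators\<close>.
\<close>

type_synonym 'n free_algebra = "('n \<times> 'n) free_monoid \<Rightarrow>\<^sub>0 complex"

definition free_gen :: "'n \<Rightarrow> 'n \<Rightarrow> 'n free_algebra" where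
  "free_gen i j = Poly_Mapping.single (Free_Monoid [(i, j)]) 1"

definition free_scale :: "complex \<Rightarrow> 'n free_algebra \<Rightarrow> 'n free_algebra" where
  "free_scale c a = Poly_Mapping.map ((*) c) a"

lift_definition free_star :: "'n free_algebra \<Rightarrow> 'n free_algebra" is
  "\<lambda>f w. cnj (f (Free_Monoid (rev (letters w))))"
proof -
  fix f :: "('n \<times> 'n) free_monoid \<Rightarrow> complex"
  assume fin: "finite {w. f w \<noteq> 0}"
  have "{w. cnj (f (Free_Monoid (rev (letters w)))) \<noteq> 0}
      \<subseteq> (\<lambda>w. Free_Monoid (rev (letters w))) ` {w. f w \<noteq> 0}"
    by (auto intro!: image_eqI[where x = "Free_Monoid (rev (letters _))"] simp: free_monoid.expand)
  then show "finite {w. cnj (f (Free_Monoid (rev (letters w)))) \<noteq> 0}"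
    using fin finite_surj by blast
qed

definition magic_relators :: "'n::finite free_algebra set" where
  "magic_relators =
     {free_gen i j * free_gen i j - free_gen i j | i j. True} \<union>
     {free_gen i j * free_gen i k | i j k. j \<noteq> k} \<union> {(\<Sum>j\<in>UNIV. free_gen i j) - 1 | i. True} \<union>
     {free_gen j i * free_gen k i | i j k. j \<noteq> k} \<union> {(\<Sum>i\<in>UNIV. free_gen i j) - 1 | j. True}"

text \<open>
  A *-homomorphism from the free algebra to a C*-algebra pulls the norm back to a C*-seminorm, and every
  C*-seminorm arises in this way from its Hausdorff completion.  Hence the largest C*-seminorm vanishing on the
  relators is the norm of the universal C*-algebra, without quantifying over C*-algebras of all types.
\<close>

definition cstar_seminorm :: "('n free_algebra \<Rightarrow> real) \<Rightarrow> bool" where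
  "cstar_seminorm N \<longleftrightarrow>
     (\<forall>a. 0 \<le> N a) \<and> (\<forall>c a. N (free_scale c a) = cmod c * N a) \<and>
     (\<forall>a b. N (a + b) \<le> N a + N b) \<and> (\<forall>a b. N (a * b) \<le> N a * N b) \<and>
     (\<forall>a. N (free_star a * a) = (N a)\<^sup>2)"

definition magic_seminorms :: "('n::finite free_algebra \<Rightarrow> real) set" where
  "magic_seminorms = {N. cstar_seminorm N \<and> (\<forall>r\<in>magic_relators. N r = 0)}"

definition universal_seminorm :: "'n::finite free_algebra \<Rightarrow> real" where
  "universal_seminorm a = (SUP N\<in>magic_seminorms. N a)"

lemma free_algebra_induct [case_names zero single add]:
  fixes a :: "'n free_algebra"
  assumes "P 0" "\<And>w c. P (Poly_Mapping.single w c)" "\<And>a b. P a \<Longrightarrow> P b \<Longrightarrow> P (a + b)"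
  shows "P a"
proof (induction a rule: Poly_Mapping.update_induct)
  case (update f w c)
  have "Poly_Mapping.update w c f = Poly_Mapping.single w c + f"
    by (rule poly_mapping_eqI)
      (use update(1) in \<open>auto simp: lookup_update lookup_add lookup_single when_def in_keys_iff\<close>)
  then show ?case using assms update by simp
qed (rule assms)

lemma free_scale_conv: "free_scale c a = Poly_Mapping.single 0 c * a"
  by (simp add: free_scale_def mult_map_scale_conv_mult)

lemma free_scale_single [simp]: "free_scale c (Poly_Mapping.single w d) = Poly_Mapping.single w (c * d)"
  by (simp add: free_scale_conv mult_single)

lemma free_scale_add: "free_scale c (a + b) = free_scale c a + free_scale c b"
  by (simp add: free_scale_conv distrib_left)

lemma free_scale_add_left: "free_scale (c + d) a = free_scale c a + free_scale d a"
  by (simp add: free_scale_conv single_add distrib_right)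

lemma free_scale_scale: "free_scale c (free_scale d a) = free_scale (c * d) a"
  by (simp add: free_scale_conv mult.assoc[symmetric] mult_single)

lemma free_scale_mult_left: "free_scale c a * b = free_scale c (a * b)"
  by (simp add: free_scale_conv mult.assoc)

lemma free_scale_one [simp]: "free_scale 1 a = a"
  by (simp add: free_scale_conv)

lemma free_scale_minus: "free_scale c (a - b) = free_scale c a - free_scale c b"
  by (simp add: free_scale_conv right_diff_distrib)

lemma free_scale_minus_one: "free_scale (-1) a = - a"
  by (simp add: free_scale_conv single_uminus)

lemma free_scale_mult_right: "a * free_scale c b = free_scale c (a * b)"
proof -
  have "a * Poly_Mapping.single 0 c = Poly_Mapping.single 0 c * a" for a :: "'a free_algebra"
    by (induction a rule: free_algebra_induct) (simp_all add: mult_single distrib_left distrib_right mult.commute)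
  then show ?thesis by (simp add: free_scale_conv mult.assoc[symmetric])
qed

lemma free_star_single [simp]:
  "free_star (Poly_Mapping.single w c) = Poly_Mapping.single (Free_Monoid (rev (letters w))) (cnj c)"
  by (rule poly_mapping_eqI)
    (auto simp: free_star.rep_eq lookup_single when_def free_monoid.expand)

lemma free_star_add: "free_star (a + b) = free_star a + free_star b"
  by (rule poly_mapping_eqI) (simp add: free_star.rep_eq lookup_add)

lemma free_star_zero [simp]: "free_star 0 = 0"
  by (rule poly_mapping_eqI) (simp add: free_star.rep_eq)

lemma free_star_star [simp]: "free_star (free_star a) = a"
  by (rule poly_mapping_eqI) (simp add: free_star.rep_eq)

lemma free_star_scale: "free_star (free_scale c a) = free_scale (cnj c) (free_star a)"
  by (induction a rule: free_algebra_induct)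
    (simp_all add: free_scale_add free_star_add, simp add: free_scale_conv)

lemma free_star_minus: "free_star (a - b) = free_star a - free_star b"
  by (rule poly_mapping_eqI) (simp add: free_star.rep_eq lookup_minus)

lemma free_star_mult: "free_star (a * b) = free_star b * free_star a"
proof (induction a rule: free_algebra_induct)
  case (single w c)
  show ?case
    by (induction b rule: free_algebra_induct)
      (simp_all add: mult_single plus_free_monoid_def mult.commute free_star_add distrib_left distrib_right)
qed (simp_all add: free_star_add distrib_left distrib_right)

lemma free_star_gen [simp]: "free_star (free_gen i j) = free_gen i j"
  by (simp add: free_gen_def)

lemma free_single_Cons:
  "Poly_Mapping.single (Free_Monoid ((i, j) # w)) c = free_gen i j * Poly_Mapping.single (Free_Monoid w) c"
  by (simp add: free_gen_def mult_single plus_free_monoid_def)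

lemma free_single_Nil: "Poly_Mapping.single (Free_Monoid []) c = free_scale c 1"
  by (simp add: free_scale_conv zero_free_monoid_def)

lemma seminorm_bound:
  fixes a :: "'n::finite free_algebra"
  assumes N: "N \<in> magic_seminorms"
  shows "N a \<le> (\<Sum>w\<in>Poly_Mapping.keys a. cmod (Poly_Mapping.lookup a w))"
proof -
  have nn: "0 \<le> N x" and sc: "N (free_scale c x) = cmod c * N x" and tri: "N (x + y) \<le> N x + N y"
    and mul: "N (x * y) \<le> N x * N y" and cs: "N (free_star x * x) = (N x)\<^sup>2"
    and rel: "r \<in> magic_relators \<Longrightarrow> N r = 0" for x y c r
    using N by (auto simp: magic_seminorms_def cstar_seminorm_def)
  have idem: "t \<le> 1" if "t * t \<le> t" "0 \<le> t" for t :: real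
    using that by (metis le_cases mult_le_cancel_left_pos mult_1_right order_le_less zero_le_one)
  have N1: "N 1 \<le> 1"
  proof (rule idem)
    have "free_star (1::'n free_algebra) = 1"
      by (simp add: zero_free_monoid_def flip: single_one)
    then show "N 1 * N 1 \<le> N 1" using cs[of 1] by (auto simp: power2_eq_square)
  qed (rule nn)
  have Ng: "N (free_gen i j) \<le> 1" for i j
  proof (rule idem)
    have "N (free_gen i j * free_gen i j - free_gen i j) = 0"
      by (rule rel) (auto simp: magic_relators_def)
    moreover have "N (free_gen i j * free_gen i j)
        \<le> N (free_gen i j * free_gen i j - free_gen i j) + N (free_gen i j)"
      using tri[of "free_gen i j * free_gen i j - free_gen i j" "free_gen i j"] by simp
    ultimately show "N (free_gen i j) * N (free_gen i j) \<le> N (free_gen i j)"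
      using cs[of "free_gen i j"] by (simp add: power2_eq_square)
  qed (rule nn)
  have Ns: "N (Poly_Mapping.single (Free_Monoid w) c) \<le> cmod c" for w c
  proof (induction w)
    case Nil
    show ?case using N1 by (simp add: free_single_Nil sc mult_left_le)
  next
    case (Cons p w)
    obtain i j where p: "p = (i, j)" by (cases p)
    have "N (Poly_Mapping.single (Free_Monoid (p # w)) c)
        \<le> N (free_gen i j) * N (Poly_Mapping.single (Free_Monoid w) c)"
      by (simp add: p free_single_Cons mul)
    also have "\<dots> \<le> 1 * cmod c" by (intro mult_mono Ng Cons nn) simp
    finally show ?case by simp
  qed
  have N0: "N 0 = 0" using sc[of 0 0] by (simp add: free_scale_conv)
  have "N (\<Sum>w\<in>S. Poly_Mapping.single w (Poly_Mapping.lookup a w)) \<le> (\<Sum>w\<in>S. cmod (Poly_Mapping.lookup a w))"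
    if "finite S" for S
    using that
  proof (induction S rule: finite_induct)
    case (insert w S)
    have "N (Poly_Mapping.single w (Poly_Mapping.lookup a w)) \<le> cmod (Poly_Mapping.lookup a w)"
      using Ns[of "letters w"] by simp
    then show ?case using insert tri by (simp) (meson add_mono order_trans)
  qed (simp add: N0)
  moreover have "(\<Sum>w\<in>Poly_Mapping.keys a. Poly_Mapping.single w (Poly_Mapping.lookup a w)) = a"
    by (rule poly_mapping_eqI) (simp add: lookup_sum lookup_single when_def in_keys_iff)
  ultimately show ?thesis by (metis finite_keys)
qed

lemma zero_magic_seminorm: "(\<lambda>_. 0) \<in> magic_seminorms"
  by (simp add: magic_seminorms_def cstar_seminorm_def)

lemma bdd_above_seminorm: "bdd_above ((\<lambda>N. N a) ` (magic_seminorms :: ('n::finite free_algebra \<Rightarrow> real) set))"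
  using seminorm_bound by (auto simp: bdd_above_def)

lemma universal_seminorm_upper: "N \<in> magic_seminorms \<Longrightarrow> N a \<le> universal_seminorm a"
  unfolding universal_seminorm_def by (rule cSUP_upper[OF _ bdd_above_seminorm])

lemma universal_seminorm_least: "(\<And>N. N \<in> magic_seminorms \<Longrightarrow> N a \<le> t) \<Longrightarrow> universal_seminorm a \<le> t"
  unfolding universal_seminorm_def using zero_magic_seminorm by (intro cSUP_least) auto

lemma universal_seminorm_magic: "(universal_seminorm :: 'n::finite free_algebra \<Rightarrow> real) \<in> magic_seminorms"
proof -
  let ?U = "universal_seminorm :: 'n free_algebra \<Rightarrow> real"
  have nn: "0 \<le> ?U a" for a using universal_seminorm_upper[OF zero_magic_seminorm] .
  note D = magic_seminorms_def cstar_seminorm_def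
  have sc_le: "?U (free_scale c a) \<le> cmod c * ?U a" for c a
    by (rule universal_seminorm_least) (auto simp: D intro!: mult_left_mono universal_seminorm_upper)
  have sc: "?U (free_scale c a) = cmod c * ?U a" for c a
  proof (cases "c = 0")
    case True
    then show ?thesis using sc_le[of c a] nn[of "free_scale c a"] by simp
  next
    case False
    have "?U a = ?U (free_scale (inverse c) (free_scale c a))" using False by (simp add: free_scale_scale)
    also have "\<dots> \<le> inverse (cmod c) * ?U (free_scale c a)"
      using sc_le[of "inverse c" "free_scale c a"] by (simp add: norm_inverse)
    finally have "cmod c * ?U a \<le> ?U (free_scale c a)" using False by (simp add: field_simps)
    then show ?thesis using sc_le[of c a] by simp
  qed
  have tri: "?U (a + b) \<le> ?U a + ?U b" for a b
  proof (rule universal_seminorm_least)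
    fix N :: "'n free_algebra \<Rightarrow> real" assume N: "N \<in> magic_seminorms"
    then have "N (a + b) \<le> N a + N b" by (simp add: D)
    then show "N (a + b) \<le> ?U a + ?U b" using universal_seminorm_upper[OF N, of a] universal_seminorm_upper[OF N, of b] by linarith
  qed
  have mul: "?U (a * b) \<le> ?U a * ?U b" for a b
  proof (rule universal_seminorm_least)
    fix N :: "'n free_algebra \<Rightarrow> real" assume N: "N \<in> magic_seminorms"
    then have "N (a * b) \<le> N a * N b" by (simp add: D)
    also have "\<dots> \<le> ?U a * ?U b"
      using N by (intro mult_mono universal_seminorm_upper[OF N] nn) (simp add: D)
    finally show "N (a * b) \<le> ?U a * ?U b" .
  qed
  have cs: "?U (free_star a * a) = (?U a)\<^sup>2" for a
  proof (rule antisym)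
    show "?U (free_star a * a) \<le> (?U a)\<^sup>2"
    proof (rule universal_seminorm_least)
      fix N :: "'n free_algebra \<Rightarrow> real" assume N: "N \<in> magic_seminorms"
      then show "N (free_star a * a) \<le> (?U a)\<^sup>2"
        using universal_seminorm_upper[OF N, of a] by (simp add: D power_mono)
    qed
    have "?U a \<le> sqrt (?U (free_star a * a))"
    proof (rule universal_seminorm_least)
      fix N :: "'n free_algebra \<Rightarrow> real" assume N: "N \<in> magic_seminorms"
      then have "(N a)\<^sup>2 \<le> ?U (free_star a * a)"
        using universal_seminorm_upper[OF N, of "free_star a * a"] by (simp add: D)
      then show "N a \<le> sqrt (?U (free_star a * a))" by (rule real_le_rsqrt)
    qed
    then show "(?U a)\<^sup>2 \<le> ?U (free_star a * a)"
      using nn by (metis power_mono real_sqrt_pow2)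
  qed
  have rel: "?U r = 0" if "r \<in> magic_relators" for r
    using universal_seminorm_least[of r 0] nn[of r] that by (force simp: D intro: antisym)
  show ?thesis by (simp add: D nn sc tri mul cs rel)
qed

lemmas universal_seminorm_props =
  universal_seminorm_magic[unfolded magic_seminorms_def cstar_seminorm_def, simplified]

abbreviation "unorm \<equiv> universal_seminorm"

lemma unorm_nonneg [simp]: "0 \<le> unorm a"
  and unorm_scale: "unorm (free_scale c a) = cmod c * unorm a"
  and unorm_add: "unorm (a + b) \<le> unorm a + unorm b"
  and unorm_mult: "unorm (a * b) \<le> unorm a * unorm b"
  and unorm_cstar: "unorm (free_star a * a) = (unorm a)\<^sup>2"
  and unorm_relator: "r \<in> magic_relators \<Longrightarrow> unorm r = 0"
  using universal_seminorm_props by blast+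

lemma unorm_zero [simp]: "unorm 0 = 0"
  using unorm_scale[of 0 0] by (simp add: free_scale_conv)

lemma unorm_minus [simp]: "unorm (- a) = unorm a"
  using unorm_scale[of "-1" a] by (simp add: free_scale_minus_one)

lemma unorm_minus_commute: "unorm (a - b) = unorm (b - a)"
  using unorm_minus[of "a - b"] by simp

lemma unorm_diff_le: "unorm a - unorm b \<le> unorm (a - b)"
  using unorm_add[of "a - b" b] by simp

lemma unorm_abs_diff: "\<bar>unorm a - unorm b\<bar> \<le> unorm (a - b)"
  using unorm_diff_le[of a b] unorm_diff_le[of b a] unorm_minus_commute[of a b] by linarith

lemma unorm_star [simp]: "unorm (free_star a) = unorm a"
proof -
  have le: "unorm b \<le> unorm (free_star b)" for b :: "'a free_algebra"
  proof (cases "unorm b = 0")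
    case False
    have "unorm b * unorm b \<le> unorm (free_star b) * unorm b"
      using unorm_mult[of "free_star b" b] by (simp add: unorm_cstar power2_eq_square)
    then show ?thesis using False by (simp add: less_le)
  qed simp
  show ?thesis using le[of a] le[of "free_star a"] by simp
qed

text \<open>
  \<open>'n A_s\<close> is the Hausdorff completion of the free algebra in the universal seminorm: Cauchy sequences
  modulo null sequences.  In particular \<open>4 A_s\<close> is the algebra \<open>A\<^sub>s(4)\<close>.  Its universal property
  is the theorem \<open>A_s_universal\<close> below.
\<close>

definition unorm_Cauchy :: "(nat \<Rightarrow> 'n::finite free_algebra) \<Rightarrow> bool" where
  "unorm_Cauchy X \<longleftrightarrow> (\<forall>e>0. \<exists>M. \<forall>m\<ge>M. \<forall>n\<ge>M. unorm (X m - X n) < e)"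

definition completion_rel :: "(nat \<Rightarrow> 'n::finite free_algebra) \<Rightarrow> (nat \<Rightarrow> 'n free_algebra) \<Rightarrow> bool" where
  "completion_rel X Y \<longleftrightarrow>
     unorm_Cauchy X \<and> unorm_Cauchy Y \<and> (\<lambda>n. unorm (X n - Y n)) \<longlonglongrightarrow> 0"

lemma unorm_tendsto_0_le:
  assumes "g \<longlonglongrightarrow> (0::real)" "\<And>n. unorm (f n) \<le> g n"
  shows "(\<lambda>n. unorm (f n)) \<longlonglongrightarrow> 0"
  using assms by (intro tendsto_sandwich[OF _ _ tendsto_const assms(1)]) auto

lemma unorm_Cauchy_const [simp]: "unorm_Cauchy (\<lambda>_. a)"
  by (simp add: unorm_Cauchy_def)

lemma unorm_Cauchy_dominated:
  assumes X: "unorm_Cauchy X" and le: "\<And>m n. unorm (Y m - Y n) \<le> unorm (X m - X n)"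
  shows "unorm_Cauchy Y"
  using X unfolding unorm_Cauchy_def by (meson le le_less_trans)

lemma unorm_Cauchy_add:
  assumes X: "unorm_Cauchy X" and Y: "unorm_Cauchy Y"
  shows "unorm_Cauchy (\<lambda>n. X n + Y n)"
  unfolding unorm_Cauchy_def
proof (intro allI impI)
  fix e :: real assume "e > 0"
  then obtain M M' where M: "\<And>m n. m \<ge> M \<Longrightarrow> n \<ge> M \<Longrightarrow> unorm (X m - X n) < e / 2"
      "\<And>m n. m \<ge> M' \<Longrightarrow> n \<ge> M' \<Longrightarrow> unorm (Y m - Y n) < e / 2"
    using X Y unfolding unorm_Cauchy_def by (meson half_gt_zero)
  have "unorm (X m + Y m - (X n + Y n)) < e" if "m \<ge> max M M'" "n \<ge> max M M'" for m n
  proof -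
    have "unorm (X m + Y m - (X n + Y n)) \<le> unorm (X m - X n) + unorm (Y m - Y n)"
      using unorm_add[of "X m - X n" "Y m - Y n"] by (simp add: algebra_simps)
    then show ?thesis using M(1)[of m n] M(2)[of m n] that by auto
  qed
  then show "\<exists>M. \<forall>m\<ge>M. \<forall>n\<ge>M. unorm (X m + Y m - (X n + Y n)) < e" by blast
qed

lemma unorm_Cauchy_scale:
  assumes X: "unorm_Cauchy X"
  shows "unorm_Cauchy (\<lambda>n. free_scale c (X n))"
  unfolding unorm_Cauchy_def
proof (intro allI impI)
  fix e :: real assume e: "e > 0"
  have c: "cmod c + 1 > 0" by (simp add: add_nonneg_pos)
  obtain M where M: "\<And>m n. m \<ge> M \<Longrightarrow> n \<ge> M \<Longrightarrow> unorm (X m - X n) < e / (cmod c + 1)"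
    using X e c unfolding unorm_Cauchy_def by (meson divide_pos_pos)
  have "unorm (free_scale c (X m) - free_scale c (X n)) < e" if "m \<ge> M" "n \<ge> M" for m n
  proof -
    have "unorm (free_scale c (X m) - free_scale c (X n)) = cmod c * unorm (X m - X n)"
      by (simp add: unorm_scale flip: free_scale_minus)
    also have "\<dots> \<le> (cmod c + 1) * unorm (X m - X n)" by (simp add: mult_right_mono)
    also have "\<dots> < e" using M[OF that] c by (simp add: field_simps)
    finally show ?thesis .
  qed
  then show "\<exists>M. \<forall>m\<ge>M. \<forall>n\<ge>M. unorm (free_scale c (X m) - free_scale c (X n)) < e" by blast
qed

lemma unorm_Cauchy_star: "unorm_Cauchy X \<Longrightarrow> unorm_Cauchy (\<lambda>n. free_star (X n))"
  by (erule unorm_Cauchy_dominated) (simp flip: free_star_minus)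

lemma unorm_Cauchy_convergent:
  assumes X: "unorm_Cauchy X"
  shows "convergent (\<lambda>n. unorm (X n))"
proof (rule Cauchy_convergent, rule CauchyI)
  fix e :: real assume "e > 0"
  then obtain M where "\<And>m n. m \<ge> M \<Longrightarrow> n \<ge> M \<Longrightarrow> unorm (X m - X n) < e"
    using X unfolding unorm_Cauchy_def by meson
  then show "\<exists>M. \<forall>m\<ge>M. \<forall>n\<ge>M. norm (unorm (X m) - unorm (X n)) < e"
    using unorm_abs_diff le_less_trans unfolding real_norm_def by blast
qed

lemma unorm_Cauchy_bounded:
  assumes "unorm_Cauchy X"
  obtains B where "B > 0" "\<And>n. unorm (X n) \<le> B"
proof -
  have "Bseq (\<lambda>n. unorm (X n))" using unorm_Cauchy_convergent[OF assms] by (rule convergent_imp_Bseq)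
  then obtain B where "B > 0" "\<And>n. norm (unorm (X n)) \<le> B" by (rule BseqE) blast
  then show thesis by (intro that[of B]) auto
qed

lemma unorm_mult_diff:
  "unorm (a * b - c * d) \<le> unorm a * unorm (b - d) + unorm (a - c) * unorm d"
proof -
  have "a * b - c * d = a * (b - d) + (a - c) * d" by (simp add: algebra_simps)
  then have "unorm (a * b - c * d) \<le> unorm (a * (b - d)) + unorm ((a - c) * d)"
    by (metis unorm_add)
  then show ?thesis using unorm_mult[of a "b - d"] unorm_mult[of "a - c" d] by linarith
qed

lemma unorm_Cauchy_mult:
  assumes X: "unorm_Cauchy X" and Y: "unorm_Cauchy Y"
  shows "unorm_Cauchy (\<lambda>n. X n * Y n)"
  unfolding unorm_Cauchy_def
proof (intro allI impI)
  fix e :: real assume e: "e > 0"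
  obtain B where B: "B > 0" "\<And>n. unorm (X n) \<le> B" using unorm_Cauchy_bounded[OF X] by blast
  obtain C where C: "C > 0" "\<And>n. unorm (Y n) \<le> C" using unorm_Cauchy_bounded[OF Y] by blast
  have pos: "e / (2 * C) > 0" "e / (2 * B) > 0" using e B C by auto
  obtain M M' where M: "\<And>m n. m \<ge> M \<Longrightarrow> n \<ge> M \<Longrightarrow> unorm (X m - X n) < e / (2 * C)"
      "\<And>m n. m \<ge> M' \<Longrightarrow> n \<ge> M' \<Longrightarrow> unorm (Y m - Y n) < e / (2 * B)"
    using X Y pos unfolding unorm_Cauchy_def by meson
  have "unorm (X m * Y m - X n * Y n) < e" if mn: "m \<ge> max M M'" "n \<ge> max M M'" for m n
  proof -
    have "unorm (X m * Y m - X n * Y n) \<le> unorm (X m) * unorm (Y m - Y n) + unorm (X m - X n) * unorm (Y n)"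
      by (rule unorm_mult_diff)
    also have "\<dots> \<le> B * unorm (Y m - Y n) + unorm (X m - X n) * C"
      using B(2) C(2) by (intro add_mono mult_right_mono mult_left_mono) auto
    also have "\<dots> < B * (e / (2 * B)) + (e / (2 * C)) * C"
      using M(1)[of m n] M(2)[of m n] mn B(1) C(1) by (intro add_strict_mono mult_strict_left_mono mult_strict_right_mono) auto
    also have "\<dots> = e" using B(1) C(1) by simp
    finally show ?thesis .
  qed
  then show "\<exists>M. \<forall>m\<ge>M. \<forall>n\<ge>M. unorm (X m * Y m - X n * Y n) < e" by blast
qed

lemma completion_rel_refl [simp]: "completion_rel X X \<longleftrightarrow> unorm_Cauchy X"
  by (auto simp: completion_rel_def)

lemma completion_rel_part_equivp: "part_equivp completion_rel"
proof (rule part_equivpI)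
  show "\<exists>X. completion_rel X X" using unorm_Cauchy_const[of 0] completion_rel_refl by blast
  show "symp completion_rel"
    by (rule sympI) (auto simp: completion_rel_def unorm_minus_commute)
  show "transp completion_rel"
  proof (rule transpI)
    fix X Y Z assume XYZ: "completion_rel X Y" "completion_rel Y Z"
    have "(\<lambda>n. unorm (X n - Y n) + unorm (Y n - Z n)) \<longlonglongrightarrow> 0 + 0"
      using XYZ by (intro tendsto_add) (auto simp: completion_rel_def)
    moreover have "unorm (X n - Z n) \<le> unorm (X n - Y n) + unorm (Y n - Z n)" for n
      using unorm_add[of "X n - Y n" "Y n - Z n"] by simp
    ultimately have "(\<lambda>n. unorm (X n - Z n)) \<longlonglongrightarrow> 0" by (intro unorm_tendsto_0_le) auto
    then show "completion_rel X Z" using XYZ by (auto simp: completion_rel_def)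
  qed
qed

lemma completion_relI: "unorm_Cauchy X \<Longrightarrow> (\<And>n. X n = Y n) \<Longrightarrow> completion_rel X Y"
  by (subgoal_tac "X = Y") auto

quotient_type (overloaded) 'n A_s = "nat \<Rightarrow> 'n::finite free_algebra" / partial: completion_rel
  by (rule completion_rel_part_equivp)

lift_definition universal_magic :: "'n::finite \<Rightarrow> 'n \<Rightarrow> 'n A_s" is "\<lambda>i j _. free_gen i j"
  by simp

lemma lim_unorm_cong:
  assumes "completion_rel X Y"
  shows "lim (\<lambda>n. unorm (X n)) = lim (\<lambda>n. unorm (Y n))"
proof -
  have "(\<lambda>n. unorm (X n)) \<longlonglongrightarrow> lim (\<lambda>n. unorm (X n))"
    using assms unorm_Cauchy_convergent convergent_LIMSEQ_iff by (auto simp: completion_rel_def)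
  moreover have "(\<lambda>n. unorm (X n) - unorm (Y n)) \<longlonglongrightarrow> 0"
    by (rule Lim_null_comparison[of _ "\<lambda>n. unorm (X n - Y n)"])
      (use assms in \<open>auto simp: completion_rel_def unorm_abs_diff\<close>)
  ultimately have "(\<lambda>n. unorm (X n) - (unorm (X n) - unorm (Y n))) \<longlonglongrightarrow> lim (\<lambda>n. unorm (X n)) - 0"
    by (intro tendsto_diff)
  then show ?thesis by (simp add: limI)
qed

instantiation A_s :: (finite) "{real_normed_algebra, monoid_mult, scaleC, star}"
begin

lift_definition zero_A_s :: "'a A_s" is "\<lambda>_. 0" by simp

lift_definition one_A_s :: "'a A_s" is "\<lambda>_. 1" by simp

lift_definition plus_A_s :: "'a A_s \<Rightarrow> 'a A_s \<Rightarrow> 'a A_s" is "\<lambda>X Y n. X n + Y n"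
proof -
  fix X X' Y Y' :: "nat \<Rightarrow> 'a free_algebra"
  assume rel: "completion_rel X X'" "completion_rel Y Y'"
  have "(\<lambda>n. unorm (X n - X' n) + unorm (Y n - Y' n)) \<longlonglongrightarrow> 0 + 0"
    using rel by (intro tendsto_add) (auto simp: completion_rel_def)
  moreover have "unorm (X n + Y n - (X' n + Y' n)) \<le> unorm (X n - X' n) + unorm (Y n - Y' n)" for n
    using unorm_add[of "X n - X' n" "Y n - Y' n"] by (simp add: algebra_simps)
  ultimately have "(\<lambda>n. unorm (X n + Y n - (X' n + Y' n))) \<longlonglongrightarrow> 0" by (intro unorm_tendsto_0_le) auto
  then show "completion_rel (\<lambda>n. X n + Y n) (\<lambda>n. X' n + Y' n)"
    using rel by (auto simp: completion_rel_def unorm_Cauchy_add)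
qed

lift_definition scaleC_A_s :: "complex \<Rightarrow> 'a A_s \<Rightarrow> 'a A_s" is "\<lambda>c X n. free_scale c (X n)"
proof -
  fix c and X X' :: "nat \<Rightarrow> 'a free_algebra"
  assume rel: "completion_rel X X'"
  then have "(\<lambda>n. cmod c * unorm (X n - X' n)) \<longlonglongrightarrow> cmod c * 0"
    by (intro tendsto_mult tendsto_const) (auto simp: completion_rel_def)
  then have "(\<lambda>n. unorm (free_scale c (X n) - free_scale c (X' n))) \<longlonglongrightarrow> 0"
    by (simp add: unorm_scale flip: free_scale_minus)
  then show "completion_rel (\<lambda>n. free_scale c (X n)) (\<lambda>n. free_scale c (X' n))"
    using rel by (auto simp: completion_rel_def unorm_Cauchy_scale)
qed

definition scaleR_A_s :: "real \<Rightarrow> 'a A_s \<Rightarrow> 'a A_s" where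
  "scaleR_A_s r x = complex_of_real r *\<^sub>C x"

definition uminus_A_s :: "'a A_s \<Rightarrow> 'a A_s" where
  "uminus_A_s x = (-1) *\<^sub>C x"

definition minus_A_s :: "'a A_s \<Rightarrow> 'a A_s \<Rightarrow> 'a A_s" where
  "minus_A_s x y = x + - y"

lift_definition times_A_s :: "'a A_s \<Rightarrow> 'a A_s \<Rightarrow> 'a A_s" is "\<lambda>X Y n. X n * Y n"
proof -
  fix X X' Y Y' :: "nat \<Rightarrow> 'a free_algebra"
  assume rel: "completion_rel X X'" "completion_rel Y Y'"
  then have C: "unorm_Cauchy X" "unorm_Cauchy Y'" by (auto simp: completion_rel_def)
  obtain B where B: "\<And>n. unorm (X n) \<le> B" using unorm_Cauchy_bounded[OF C(1)] by metis
  obtain D where D: "\<And>n. unorm (Y' n) \<le> D" using unorm_Cauchy_bounded[OF C(2)] by metis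
  have "(\<lambda>n. B * unorm (Y n - Y' n) + unorm (X n - X' n) * D) \<longlonglongrightarrow> B * 0 + 0 * D"
    using rel by (intro tendsto_add tendsto_mult tendsto_const) (auto simp: completion_rel_def)
  moreover have "unorm (X n * Y n - X' n * Y' n) \<le> B * unorm (Y n - Y' n) + unorm (X n - X' n) * D" for n
    by (rule order_trans[OF unorm_mult_diff], intro add_mono mult_right_mono mult_left_mono B D) auto
  ultimately have "(\<lambda>n. unorm (X n * Y n - X' n * Y' n)) \<longlonglongrightarrow> 0"
    by (intro unorm_tendsto_0_le) auto
  then show "completion_rel (\<lambda>n. X n * Y n) (\<lambda>n. X' n * Y' n)"
    using rel by (auto simp: completion_rel_def unorm_Cauchy_mult)
qed

lift_definition star_A_s :: "'a A_s \<Rightarrow> 'a A_s" is "\<lambda>X n. free_star (X n)"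
  by (auto simp: completion_rel_def unorm_Cauchy_star simp flip: free_star_minus)

lift_definition norm_A_s :: "'a A_s \<Rightarrow> real" is "\<lambda>X. lim (\<lambda>n. unorm (X n))"
  by (rule lim_unorm_cong)

definition sgn_A_s :: "'a A_s \<Rightarrow> 'a A_s" where "sgn_A_s x = inverse (norm x) *\<^sub>R x"

definition dist_A_s :: "'a A_s \<Rightarrow> 'a A_s \<Rightarrow> real" where "dist_A_s x y = norm (x - y)"

definition uniformity_A_s :: "('a A_s \<times> 'a A_s) filter" where
  "uniformity_A_s = (INF e\<in>{0<..}. principal {(x, y). dist x y < e})"

definition open_A_s :: "'a A_s set \<Rightarrow> bool" where
  "open_A_s U \<longleftrightarrow> (\<forall>x\<in>U. eventually (\<lambda>(x', y). x' = x \<longrightarrow> y \<in> U) uniformity)"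

lemma norm_A_s_tendsto:
  assumes "unorm_Cauchy X"
  shows "(\<lambda>n. unorm (X n)) \<longlonglongrightarrow> norm (abs_A_s X)"
  using assms unorm_Cauchy_convergent[OF assms] by (simp add: norm_A_s.abs_eq convergent_LIMSEQ_iff)

lemma A_s_cases: obtains X where "x = abs_A_s X" "unorm_Cauchy X"
proof -
  have "completion_rel (rep_A_s x) (rep_A_s x)" by (rule Quotient_rep_reflp[OF Quotient_A_s])
  moreover have "x = abs_A_s (rep_A_s x)" by (simp add: Quotient_abs_rep[OF Quotient_A_s])
  ultimately show thesis using that by simp
qed

lemma abs_A_s_eq_iff: "unorm_Cauchy X \<Longrightarrow> unorm_Cauchy Y \<Longrightarrow>
    abs_A_s X = abs_A_s Y \<longleftrightarrow> (\<lambda>n. unorm (X n - Y n)) \<longlonglongrightarrow> 0"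
  using Quotient_rel[OF Quotient_A_s, of X Y] by (auto simp: completion_rel_def)

lemma unorm_Cauchy_minus: "unorm_Cauchy X \<Longrightarrow> unorm_Cauchy (\<lambda>n. - X n)"
  using unorm_Cauchy_scale[of X "-1"] by (simp add: free_scale_minus_one)

lemma unorm_Cauchy_diff: "unorm_Cauchy X \<Longrightarrow> unorm_Cauchy Y \<Longrightarrow> unorm_Cauchy (\<lambda>n. X n - Y n)"
  using unorm_Cauchy_add[OF _ unorm_Cauchy_minus] by fastforce

lemma abs_A_s_diff: "unorm_Cauchy X \<Longrightarrow> unorm_Cauchy Y \<Longrightarrow>
    abs_A_s X - abs_A_s Y = abs_A_s (\<lambda>n. X n - Y n)"
  by (simp add: minus_A_s_def uminus_A_s_def scaleC_A_s.abs_eq plus_A_s.abs_eq unorm_Cauchy_minus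
      free_scale_minus_one)

lemma A_s_algebra:
  fixes x y z :: "'a A_s"
  shows A_s_add_assoc: "x + y + z = x + (y + z)" and A_s_add_commute: "x + y = y + x"
    and A_s_add_zero: "0 + x = x" and A_s_add_uminus: "- x + x = 0"
    and A_s_mult_assoc: "x * y * z = x * (y * z)"
    and A_s_one_left: "1 * x = x" and A_s_one_right: "x * 1 = x"
    and A_s_distrib_right: "(x + y) * z = x * z + y * z"
    and A_s_distrib_left: "x * (y + z) = x * y + x * z"
    and A_s_scale_add: "c *\<^sub>C (x + y) = c *\<^sub>C x + c *\<^sub>C y"
    and A_s_scale_add_left: "(c + d) *\<^sub>C x = c *\<^sub>C x + d *\<^sub>C x"
    and A_s_scale_scale: "c *\<^sub>C d *\<^sub>C x = (c * d) *\<^sub>C x" and A_s_scale_one: "1 *\<^sub>C x = x"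
    and A_s_scale_mult_left: "(c *\<^sub>C x) * y = c *\<^sub>C (x * y)"
    and A_s_scale_mult_right: "x * (c *\<^sub>C y) = c *\<^sub>C (x * y)"
    and A_s_star_add: "star (x + y) = star x + star y"
    and A_s_star_scale: "star (c *\<^sub>C x) = cnj c *\<^sub>C star x"
    and A_s_star_mult: "star (x * y) = star y * star x" and A_s_star_star: "star (star x) = x"
proof -
  obtain X where X [simp]: "x = abs_A_s X" "unorm_Cauchy X" by (rule A_s_cases)
  obtain Y where Y [simp]: "y = abs_A_s Y" "unorm_Cauchy Y" by (rule A_s_cases)
  obtain Z where Z [simp]: "z = abs_A_s Z" "unorm_Cauchy Z" by (rule A_s_cases)
  note [simp] = plus_A_s.abs_eq times_A_s.abs_eq scaleC_A_s.abs_eq star_A_s.abs_eq uminus_A_s_def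
    zero_A_s_def one_A_s_def unorm_Cauchy_add unorm_Cauchy_mult unorm_Cauchy_scale unorm_Cauchy_star
  show "x + y + z = x + (y + z)" "x + y = y + x" "0 + x = x" "x * y * z = x * (y * z)"
       "1 * x = x" "x * 1 = x"
    by (simp_all add: add.assoc mult.assoc) (simp add: add.commute)
  show "- x + x = 0" by (simp add: free_scale_minus_one unorm_Cauchy_minus)
  show "(x + y) * z = x * z + y * z" "x * (y + z) = x * y + x * z"
    by (simp_all add: distrib_left distrib_right)
  show "c *\<^sub>C (x + y) = c *\<^sub>C x + c *\<^sub>C y" "(c + d) *\<^sub>C x = c *\<^sub>C x + d *\<^sub>C x"
       "c *\<^sub>C d *\<^sub>C x = (c * d) *\<^sub>C x" "1 *\<^sub>C x = x"
    by (simp_all add: free_scale_add free_scale_add_left free_scale_scale)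
  show "(c *\<^sub>C x) * y = c *\<^sub>C (x * y)" "x * (c *\<^sub>C y) = c *\<^sub>C (x * y)"
    by (simp_all add: free_scale_mult_left free_scale_mult_right)
  show "star (x + y) = star x + star y" "star (c *\<^sub>C x) = cnj c *\<^sub>C star x"
       "star (x * y) = star y * star x" "star (star x) = x"
    by (simp_all add: free_star_add free_star_scale free_star_mult)
qed

lemma A_s_norm:
  fixes x y :: "'a A_s"
  shows A_s_norm_zero: "norm x = 0 \<longleftrightarrow> x = 0" and A_s_norm_add: "norm (x + y) \<le> norm x + norm y"
    and A_s_norm_mult: "norm (x * y) \<le> norm x * norm y"
    and A_s_norm_scale: "norm (c *\<^sub>C x) = cmod c * norm x"
    and A_s_cstar: "norm (star x * x) = (norm x)\<^sup>2"
proof -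
  obtain X where X [simp]: "x = abs_A_s X" "unorm_Cauchy X" by (rule A_s_cases)
  obtain Y where Y [simp]: "y = abs_A_s Y" "unorm_Cauchy Y" by (rule A_s_cases)
  note [simp] = plus_A_s.abs_eq times_A_s.abs_eq scaleC_A_s.abs_eq star_A_s.abs_eq
    unorm_Cauchy_add unorm_Cauchy_mult unorm_Cauchy_scale unorm_Cauchy_star
  have tX: "(\<lambda>n. unorm (X n)) \<longlonglongrightarrow> norm x" and tY: "(\<lambda>n. unorm (Y n)) \<longlonglongrightarrow> norm y"
    using norm_A_s_tendsto[OF X(2)] norm_A_s_tendsto[OF Y(2)] by simp_all
  have "norm x = 0 \<longleftrightarrow> (\<lambda>n. unorm (X n - 0)) \<longlonglongrightarrow> 0"
    using tX LIMSEQ_unique by force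
  also have "\<dots> \<longleftrightarrow> x = 0"
    using abs_A_s_eq_iff[of X "\<lambda>_. 0"] by (simp add: zero_A_s_def)
  finally show "norm x = 0 \<longleftrightarrow> x = 0" .
  have "(\<lambda>n. unorm (X n + Y n)) \<longlonglongrightarrow> norm (x + y)"
    using norm_A_s_tendsto[of "\<lambda>n. X n + Y n"] by simp
  then show "norm (x + y) \<le> norm x + norm y"
    by (rule LIMSEQ_le[OF _ tendsto_add[OF tX tY]]) (auto simp: unorm_add)
  have "(\<lambda>n. unorm (X n * Y n)) \<longlonglongrightarrow> norm (x * y)"
    using norm_A_s_tendsto[of "\<lambda>n. X n * Y n"] by simp
  then show "norm (x * y) \<le> norm x * norm y"
    by (rule LIMSEQ_le[OF _ tendsto_mult[OF tX tY]]) (auto simp: unorm_mult)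
  have "(\<lambda>n. unorm (free_scale c (X n))) \<longlonglongrightarrow> norm (c *\<^sub>C x)"
    using norm_A_s_tendsto[of "\<lambda>n. free_scale c (X n)"] by simp
  moreover have "(\<lambda>n. unorm (free_scale c (X n))) \<longlonglongrightarrow> cmod c * norm x"
    unfolding unorm_scale by (intro tendsto_mult tendsto_const tX)
  ultimately show "norm (c *\<^sub>C x) = cmod c * norm x" by (rule LIMSEQ_unique)
  have "(\<lambda>n. unorm (free_star (X n) * X n)) \<longlonglongrightarrow> norm (star x * x)"
    using norm_A_s_tendsto[of "\<lambda>n. free_star (X n) * X n"] by simp
  moreover have "(\<lambda>n. unorm (free_star (X n) * X n)) \<longlonglongrightarrow> (norm x)\<^sup>2"
    unfolding unorm_cstar by (intro tendsto_power tX)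
  ultimately show "norm (star x * x) = (norm x)\<^sup>2" by (rule LIMSEQ_unique)
qed

lemma A_s_dense:
  assumes "e > 0"
  obtains a where "norm (x - abs_A_s (\<lambda>_. a)) < e"
proof -
  obtain X where X: "x = abs_A_s X" "unorm_Cauchy X" by (rule A_s_cases)
  obtain M where M: "\<And>m n. m \<ge> M \<Longrightarrow> n \<ge> M \<Longrightarrow> unorm (X m - X n) < e / 2"
    using X(2) assms unfolding unorm_Cauchy_def by (meson half_gt_zero)
  have "(\<lambda>n. unorm (X n - X M)) \<longlonglongrightarrow> norm (x - abs_A_s (\<lambda>_. X M))"
    using norm_A_s_tendsto[OF unorm_Cauchy_diff[OF X(2), of "\<lambda>_. X M"]] X by (simp add: abs_A_s_diff)
  then have "norm (x - abs_A_s (\<lambda>_. X M)) \<le> e / 2"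
    by (rule LIMSEQ_le_const2) (use M in \<open>auto intro!: exI[of _ M] less_imp_le\<close>)
  also have "e / 2 < e" using assms by simp
  finally show thesis by (rule that)
qed

lemma A_s_norm_const: "norm (abs_A_s (\<lambda>_. a)) = unorm a"
  using norm_A_s_tendsto[of "\<lambda>_. a"] by (simp add: LIMSEQ_const_iff)

lemma A_s_Cauchy_tendsto:
  assumes X: "unorm_Cauchy X"
  shows "(\<lambda>n. norm (abs_A_s (\<lambda>_. X n) - abs_A_s X)) \<longlonglongrightarrow> 0"
proof (rule LIMSEQ_I)
  fix e :: real assume e: "e > 0"
  obtain M where M: "\<And>m n. m \<ge> M \<Longrightarrow> n \<ge> M \<Longrightarrow> unorm (X m - X n) < e / 2"
    using X e unfolding unorm_Cauchy_def by (meson half_gt_zero)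
  have "norm (abs_A_s (\<lambda>_. X m) - abs_A_s X) \<le> e / 2" if "m \<ge> M" for m
  proof -
    have "(\<lambda>n. unorm (X m - X n)) \<longlonglongrightarrow> norm (abs_A_s (\<lambda>_. X m) - abs_A_s X)"
      using norm_A_s_tendsto[OF unorm_Cauchy_diff[OF _ X, of "\<lambda>_. X m"]] X by (simp add: abs_A_s_diff)
    then show ?thesis
      by (rule LIMSEQ_le_const2) (use M that in \<open>auto intro!: exI[of _ M] less_imp_le\<close>)
  qed
  moreover have "norm z \<ge> 0" for z :: "'a A_s"
  proof -
    obtain Z where "z = abs_A_s Z" "unorm_Cauchy Z" by (rule A_s_cases)
    then show ?thesis using norm_A_s_tendsto[of Z] by (auto intro: LIMSEQ_le_const)
  qed
  ultimately show "\<exists>M. \<forall>m\<ge>M. norm (norm (abs_A_s (\<lambda>_. X m) - abs_A_s X) - 0) < e"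
    using e by (intro exI[of _ M]) fastforce
qed

instance
proof
  fix x y z :: "'a A_s" and r s :: real and c d :: complex
  show "x + y + z = x + (y + z)" "x + y = y + x" "0 + x = x" "- x + x = 0" "x - y = x + - y"
    by (rule A_s_algebra minus_A_s_def)+
  show "x * y * z = x * (y * z)" "1 * x = x" "x * 1 = x" "(x + y) * z = x * z + y * z"
    "x * (y + z) = x * y + x * z"
    by (simp_all add: A_s_algebra(5-9))
  show "r *\<^sub>R (x + y) = r *\<^sub>R x + r *\<^sub>R y" "(r + s) *\<^sub>R x = r *\<^sub>R x + s *\<^sub>R x"
    "r *\<^sub>R s *\<^sub>R x = (r * s) *\<^sub>R x" "1 *\<^sub>R x = x"
    "r *\<^sub>R x * y = r *\<^sub>R (x * y)" "x * r *\<^sub>R y = r *\<^sub>R (x * y)"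
    by (simp_all add: scaleR_A_s_def A_s_algebra(10-15))
  show "dist x y = norm (x - y)" "sgn x = inverse (norm x) *\<^sub>R x"
    by (simp_all add: dist_A_s_def sgn_A_s_def)
  show "uniformity = (INF e\<in>{0<..}. principal {(x :: 'a A_s, y). dist x y < e})"
    by (rule uniformity_A_s_def)
  show "open U \<longleftrightarrow> (\<forall>x\<in>U. eventually (\<lambda>(x', y). x' = x \<longrightarrow> y \<in> U) uniformity)" for U :: "'a A_s set"
    by (rule open_A_s_def)
  show "norm x = 0 \<longleftrightarrow> x = 0" "norm (x + y) \<le> norm x + norm y" "norm (r *\<^sub>R x) = \<bar>r\<bar> * norm x"
    "norm (x * y) \<le> norm x * norm y"
    by (simp_all add: A_s_norm scaleR_A_s_def)
qed

end

instance A_s :: (finite) cstar_algebra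
proof
  fix x y :: "'a A_s" and r :: real and c d :: complex
  show "c *\<^sub>C (x + y) = c *\<^sub>C x + c *\<^sub>C y" "(c + d) *\<^sub>C x = c *\<^sub>C x + d *\<^sub>C x"
    "c *\<^sub>C d *\<^sub>C x = (c * d) *\<^sub>C x" "r *\<^sub>R x = complex_of_real r *\<^sub>C x"
    "(c *\<^sub>C x) * y = c *\<^sub>C (x * y)" "x * (c *\<^sub>C y) = c *\<^sub>C (x * y)"
    "star (x + y) = star x + star y" "star (c *\<^sub>C x) = cnj c *\<^sub>C star x"
    "star (x * y) = star y * star x" "star (star x) = x"
    by (simp_all add: A_s_algebra(10-19) scaleR_A_s_def)
  show "norm (c *\<^sub>C x) = cmod c * norm x" "norm (star x * x) = (norm x)\<^sup>2"
    by (simp_all add: A_s_norm)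
next
  fix S :: "nat \<Rightarrow> 'a A_s" assume S: "Cauchy S"
  have "\<exists>a. norm (S n - abs_A_s (\<lambda>_. a)) < inverse (real (Suc n))" for n
    using A_s_dense[of "inverse (real (Suc n))" "S n"] by auto
  then obtain X where X: "\<And>n. norm (S n - abs_A_s (\<lambda>_. X n)) < inverse (real (Suc n))" by metis
  have diff: "(\<lambda>n. S n - abs_A_s (\<lambda>_. X n)) \<longlonglongrightarrow> 0"
    by (rule Lim_null_comparison[OF _ LIMSEQ_inverse_real_of_nat]) (use X in \<open>auto intro!: always_eventually less_imp_le\<close>)
  have "Cauchy (\<lambda>n. abs_A_s (\<lambda>_. X n))"
  proof (rule CauchyI)
    fix e :: real assume "e > 0"
    then have e3: "e / 3 > 0" by simp
    obtain M where M: "\<And>m n. m \<ge> M \<Longrightarrow> n \<ge> M \<Longrightarrow> norm (S m - S n) < e / 3"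
      using S e3 unfolding Cauchy_iff by meson
    obtain M' where M': "\<And>n. n \<ge> M' \<Longrightarrow> norm (S n - abs_A_s (\<lambda>_. X n)) < e / 3"
      using LIMSEQ_D[OF diff e3] by auto
    have "norm (abs_A_s (\<lambda>_. X m) - abs_A_s (\<lambda>_. X n)) < e" if mn: "m \<ge> max M M'" "n \<ge> max M M'" for m n
    proof -
      have "abs_A_s (\<lambda>_. X m) - abs_A_s (\<lambda>_. X n) =
          (S m - S n) - (S m - abs_A_s (\<lambda>_. X m)) + (S n - abs_A_s (\<lambda>_. X n))" by simp
      also have "norm \<dots> \<le> norm (S m - S n) + norm (S m - abs_A_s (\<lambda>_. X m)) + norm (S n - abs_A_s (\<lambda>_. X n))"
        by (meson add_right_mono norm_triangle_ineq norm_triangle_ineq4 order_trans)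
      finally show ?thesis using M[of m n] M'[of m] M'[of n] mn by auto
    qed
    then show "\<exists>M. \<forall>m\<ge>M. \<forall>n\<ge>M. norm (abs_A_s (\<lambda>_. X m) - abs_A_s (\<lambda>_. X n)) < e" by blast
  qed
  then have CX: "unorm_Cauchy X"
    unfolding unorm_Cauchy_def Cauchy_iff by (simp add: abs_A_s_diff A_s_norm_const)
  have "(\<lambda>n. abs_A_s (\<lambda>_. X n)) \<longlonglongrightarrow> abs_A_s X"
    using A_s_Cauchy_tendsto[OF CX] by (simp add: LIM_zero_iff tendsto_norm_zero_iff)
  from tendsto_add[OF diff this] show "convergent S" by (auto simp: convergent_def)
qed

definition free_eval :: "('n \<Rightarrow> 'n \<Rightarrow> 'a::cstar_algebra) \<Rightarrow> 'n free_algebra \<Rightarrow> 'a" where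
  "free_eval v a =
     (\<Sum>w\<in>Poly_Mapping.keys a. Poly_Mapping.lookup a w *\<^sub>C prod_list (map (\<lambda>(i, j). v i j) (letters w)))"

lemma free_eval_superset:
  assumes "finite S" "Poly_Mapping.keys a \<subseteq> S"
  shows "free_eval v a =
     (\<Sum>w\<in>S. Poly_Mapping.lookup a w *\<^sub>C prod_list (map (\<lambda>(i, j). v i j) (letters w)))"
  unfolding free_eval_def using assms by (intro sum.mono_neutral_left) (auto simp: in_keys_iff)

lemma free_eval_add: "free_eval v (a + b) = free_eval v a + free_eval v b"
proof -
  let ?S = "Poly_Mapping.keys a \<union> Poly_Mapping.keys b"
  have "finite ?S" "Poly_Mapping.keys (a + b) \<subseteq> ?S" by (simp_all add: Poly_Mapping.keys_add)
  then show ?thesis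
    by (simp add: free_eval_superset[of ?S] lookup_add scaleC_add_left sum.distrib)
qed

lemma free_eval_zero [simp]: "free_eval v 0 = 0"
  by (simp add: free_eval_def)

lemma free_eval_single [simp]: "free_eval v (Poly_Mapping.single w c) =
    c *\<^sub>C prod_list (map (\<lambda>(i, j). v i j) (letters w))"
  by (simp add: free_eval_superset[of "{w}"])

lemma free_eval_scale: "free_eval v (free_scale c a) = c *\<^sub>C free_eval v a"
  by (induction a rule: free_algebra_induct)
    (simp_all add: free_scale_add free_eval_add scaleC_add_right scaleC_scaleC, simp add: free_scale_conv)

lemma free_eval_diff: "free_eval v (a - b) = free_eval v a - free_eval v b"
  using free_eval_add[of v "a - b" b] by simp

lemma free_eval_mult: "free_eval v (a * b) = free_eval v a * free_eval v b"
proof (induction a rule: free_algebra_induct)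
  case (single w c)
  show ?case
    by (induction b rule: free_algebra_induct)
      (simp_all add: mult_single plus_free_monoid_def mult_scaleC_left mult_scaleC_right scaleC_scaleC
        mult.commute free_eval_add distrib_left)
qed (simp_all add: free_eval_add distrib_right)

lemma free_eval_one [simp]: "free_eval v 1 = 1"
  by (simp add: zero_free_monoid_def flip: single_one)

lemma free_eval_gen [simp]: "free_eval v (free_gen i j) = v i j"
  by (simp add: free_gen_def)

lemma free_eval_sum: "free_eval v (sum f A) = (\<Sum>x\<in>A. free_eval v (f x))"
  by (induction A rule: infinite_finite_induct) (auto simp: free_eval_add)

lemma free_eval_star:
  assumes "\<And>i j. star (v i j) = v i j"
  shows "free_eval v (free_star a) = star (free_eval v a)"
proof -
  have "star (prod_list (map (\<lambda>(i, j). v i j) w)) = prod_list (map (\<lambda>(i, j). v i j) (rev w))" for w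
    by (induction w) (auto simp: star_mult assms)
  then show ?thesis
    by (induction a rule: free_algebra_induct)
      (simp_all add: free_star_add free_eval_add star_add star_scaleC)
qed

lemma free_eval_norm_le:
  fixes v :: "'n::finite \<Rightarrow> 'n \<Rightarrow> 'a::cstar_algebra"
  assumes v: "magic_unitary v"
  shows "norm (free_eval v a) \<le> unorm a"
proof (rule universal_seminorm_upper)
  have sa: "star (v i j) = v i j" for i j
    using v by (auto simp: magic_unitary_def is_projection_def)
  have "cstar_seminorm (\<lambda>a. norm (free_eval v a))"
    by (auto simp: cstar_seminorm_def free_eval_scale norm_scaleC free_eval_add norm_triangle_ineq
        free_eval_mult norm_mult_ineq free_eval_star[OF sa] cstar_identity)
  moreover have "free_eval v r = 0" if "r \<in> magic_relators" for r
    using that v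
    by (auto simp: magic_relators_def magic_unitary_def is_projection_def free_eval_diff
        free_eval_mult free_eval_sum)
  ultimately show "(\<lambda>a. norm (free_eval v a)) \<in> magic_seminorms"
    by (simp add: magic_seminorms_def)
qed

definition free_embed :: "'n::finite free_algebra \<Rightarrow> 'n A_s" where
  "free_embed a = abs_A_s (\<lambda>_. a)"

lemma free_embed_add: "free_embed (a + b) = free_embed a + free_embed b"
  and free_embed_mult: "free_embed (a * b) = free_embed a * free_embed b"
  and free_embed_scale: "free_embed (free_scale c a) = c *\<^sub>C free_embed a"
  and free_embed_star: "free_embed (free_star a) = star (free_embed a)"
  and free_embed_diff: "free_embed (a - b) = free_embed a - free_embed b"
  and free_embed_zero: "free_embed 0 = 0"
  and free_embed_one: "free_embed 1 = 1"
  and free_embed_gen: "free_embed (free_gen i j) = universal_magic i j"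
  by (simp_all add: free_embed_def plus_A_s.abs_eq times_A_s.abs_eq scaleC_A_s.abs_eq star_A_s.abs_eq
      abs_A_s_diff zero_A_s_def one_A_s_def universal_magic_def)

lemma norm_free_embed: "norm (free_embed a) = unorm a"
  by (simp add: free_embed_def A_s_norm_const)

lemma free_embed_sum: "free_embed (sum f A) = (\<Sum>x\<in>A. free_embed (f x))"
  by (induction A rule: infinite_finite_induct) (auto simp: free_embed_add free_embed_zero)

lemma free_embed_tendsto: "unorm_Cauchy X \<Longrightarrow> (\<lambda>n. free_embed (X n)) \<longlonglongrightarrow> abs_A_s X"
  using A_s_Cauchy_tendsto[of X] by (simp add: free_embed_def LIM_zero_iff tendsto_norm_zero_iff)

lemma free_embed_eq_eval: "free_embed a = free_eval universal_magic a"
proof (induction a rule: free_algebra_induct)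
  case (single w c)
  have "free_embed (Poly_Mapping.single (Free_Monoid l) c) =
      c *\<^sub>C prod_list (map (\<lambda>(i, j). universal_magic i j) l)" for l
  proof (induction l)
    case (Cons p l)
    then show ?case
      by (cases p) (simp add: free_single_Cons free_embed_mult free_embed_gen mult_scaleC_right)
  qed (simp add: free_single_Nil free_embed_scale free_embed_one)
  from this[of "letters w"] show ?case by simp
qed (simp_all add: free_embed_zero free_embed_add free_eval_add)

theorem magic_unitary_universal: "magic_unitary universal_magic"
proof -
  have rel: "free_embed r = 0" if "r \<in> magic_relators" for r :: "'a free_algebra"
    using unorm_relator[OF that] norm_free_embed[of r] by simp
  note rels = magic_relators_def[where 'n = 'a]
  note emb = free_embed_diff free_embed_mult free_embed_gen free_embed_sum free_embed_one
  have "free_embed (free_gen i j * free_gen i j - free_gen i j :: 'a free_algebra) = 0" for i j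
    by (rule rel) (auto simp: rels)
  moreover have "free_embed (free_gen i j * free_gen i k :: 'a free_algebra) = 0" if "j \<noteq> k" for i j k
    using that by (intro rel) (auto simp: rels)
  moreover have "free_embed (free_gen j i * free_gen k i :: 'a free_algebra) = 0" if "j \<noteq> k" for i j k
    using that by (intro rel) (auto simp: rels)
  moreover have "free_embed ((\<Sum>j\<in>UNIV. free_gen i j) - 1 :: 'a free_algebra) = 0" for i
    by (rule rel) (auto simp: rels)
  moreover have "free_embed ((\<Sum>i\<in>UNIV. free_gen i j) - 1 :: 'a free_algebra) = 0" for j
    by (rule rel) (auto simp: rels)
  moreover have "star (universal_magic i j) = (universal_magic i j :: 'a A_s)" for i j
    by (simp flip: free_embed_gen free_embed_star)
  ultimately show ?thesis by (simp add: magic_unitary_def is_projection_def emb)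
qed

lemma star_hom_free_embed:
  assumes "star_hom \<phi>"
  shows "\<phi> (free_embed a) = free_eval (\<lambda>i j. \<phi> (universal_magic i j)) a"
proof -
  have pr: "\<phi> (prod_list xs) = prod_list (map \<phi> xs)" for xs
    using assms by (induction xs) (auto simp: star_hom_def)
  have "(\<phi> \<circ> (\<lambda>(i, j). universal_magic i j)) = (\<lambda>(i, j). \<phi> (universal_magic i j))" by auto
  then show ?thesis
    unfolding free_embed_eq_eval free_eval_def using assms
    by (simp add: star_hom_sum pr) (simp add: star_hom_def pr)
qed

theorem A_s_universal:
  fixes v :: "'n::finite \<Rightarrow> 'n \<Rightarrow> 'a::cstar_algebra"
  assumes v: "magic_unitary v"
  shows "\<exists>!\<phi>. star_hom \<phi> \<and> (\<forall>i j. \<phi> (universal_magic i j) = v i j)"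
proof (rule ex_ex1I)
  have sa: "star (v i j) = v i j" for i j
    using v by (auto simp: magic_unitary_def is_projection_def)
  note le = free_eval_norm_le[OF v]
  have conv: "convergent (\<lambda>n. free_eval v (X n))" if X: "unorm_Cauchy X" for X
  proof (rule Cauchy_convergent, unfold Cauchy_iff, intro allI impI)
    fix e :: real assume "e > 0"
    then obtain M where M: "\<And>m n. m \<ge> M \<Longrightarrow> n \<ge> M \<Longrightarrow> unorm (X m - X n) < e"
      using X unfolding unorm_Cauchy_def by meson
    show "\<exists>M. \<forall>m\<ge>M. \<forall>n\<ge>M. norm (free_eval v (X m) - free_eval v (X n)) < e"
      using M le by (metis free_eval_diff le_less_trans)
  qed
  define \<phi> where "\<phi> x = lim (\<lambda>n. free_eval v (rep_A_s x n))" for x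
  have lim: "(\<lambda>n. free_eval v (X n)) \<longlonglongrightarrow> \<phi> (abs_A_s X)" if X: "unorm_Cauchy X" for X
  proof -
    let ?Y = "rep_A_s (abs_A_s X)"
    have rel: "completion_rel ?Y X"
      using X by (metis Quotient_A_s Quotient_rep_abs completion_rel_refl)
    then have "(\<lambda>n. free_eval v (?Y n)) \<longlonglongrightarrow> \<phi> (abs_A_s X)"
      unfolding \<phi>_def using conv by (simp add: completion_rel_def flip: convergent_LIMSEQ_iff)
    moreover have "(\<lambda>n. free_eval v (X n) - free_eval v (?Y n)) \<longlonglongrightarrow> 0"
      by (rule Lim_null_comparison[of _ "\<lambda>n. unorm (?Y n - X n)"])
        (use rel le in \<open>auto simp: completion_rel_def unorm_minus_commute simp flip: free_eval_diff\<close>)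
    ultimately show ?thesis using tendsto_add by fastforce
  qed
  have emb: "\<phi> (free_embed a) = free_eval v a" for a
    using lim[of "\<lambda>_. a"] by (simp add: free_embed_def LIMSEQ_const_iff)
  have "star_hom \<phi>"
    unfolding star_hom_def
  proof (intro conjI allI)
    fix x y :: "'n A_s" and c
    obtain X where X [simp]: "x = abs_A_s X" "unorm_Cauchy X" by (rule A_s_cases)
    obtain Y where Y [simp]: "y = abs_A_s Y" "unorm_Cauchy Y" by (rule A_s_cases)
    note tX = lim[OF X(2)] and tY = lim[OF Y(2)]
    show "\<phi> (x + y) = \<phi> x + \<phi> y"
      using lim[OF unorm_Cauchy_add[OF X(2) Y(2)]] tendsto_add[OF tX tY]
      by (simp add: plus_A_s.abs_eq free_eval_add LIMSEQ_unique)
    show "\<phi> (x * y) = \<phi> x * \<phi> y"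
      using lim[OF unorm_Cauchy_mult[OF X(2) Y(2)]] tendsto_mult[OF tX tY]
      by (simp add: times_A_s.abs_eq free_eval_mult LIMSEQ_unique)
    show "\<phi> (c *\<^sub>C x) = c *\<^sub>C \<phi> x"
      using lim[OF unorm_Cauchy_scale[OF X(2)], of c] bounded_linear.tendsto[OF bounded_linear_scaleC tX, of c]
      by (simp add: scaleC_A_s.abs_eq free_eval_scale LIMSEQ_unique)
    show "\<phi> (star x) = star (\<phi> x)"
      using lim[OF unorm_Cauchy_star[OF X(2)]] bounded_linear.tendsto[OF bounded_linear_star tX]
      by (simp add: star_A_s.abs_eq free_eval_star[OF sa] LIMSEQ_unique)
    show "\<phi> 1 = 1" using emb[of 1] by (simp add: free_embed_one)
  qed
  moreover have "\<phi> (universal_magic i j) = v i j" for i j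
    using emb[of "free_gen i j"] by (simp add: free_embed_gen)
  ultimately show "\<exists>\<phi>. star_hom \<phi> \<and> (\<forall>i j. \<phi> (universal_magic i j) = v i j)" by blast
next
  fix \<phi> \<psi> :: "'n A_s \<Rightarrow> 'a"
  assume \<phi>: "star_hom \<phi> \<and> (\<forall>i j. \<phi> (universal_magic i j) = v i j)"
    and \<psi>: "star_hom \<psi> \<and> (\<forall>i j. \<psi> (universal_magic i j) = v i j)"
  show "\<phi> = \<psi>"
  proof
    fix x :: "'n A_s"
    obtain X where X: "x = abs_A_s X" "unorm_Cauchy X" by (rule A_s_cases)
    have tend: "(\<lambda>n. free_eval v (X n)) \<longlonglongrightarrow> \<theta> x"
      if \<theta>: "star_hom \<theta>" "\<forall>i j. \<theta> (universal_magic i j) = v i j" for \<theta> :: "'n A_s \<Rightarrow> 'a"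
    proof -
      have "(\<lambda>n. \<theta> (free_embed (X n)) - \<theta> x) \<longlonglongrightarrow> 0"
      proof (rule Lim_null_comparison)
        show "\<forall>\<^sub>F n in sequentially. norm (\<theta> (free_embed (X n)) - \<theta> x) \<le> norm (free_embed (X n) - x)"
          using star_hom_contractive[OF \<theta>(1)] by (simp flip: star_hom_minus[OF \<theta>(1)])
        show "(\<lambda>n. norm (free_embed (X n) - x)) \<longlonglongrightarrow> 0"
          using free_embed_tendsto[OF X(2)] by (simp add: X(1) LIM_zero tendsto_norm_zero)
      qed
      then show ?thesis using \<theta> by (simp add: star_hom_free_embed LIM_zero_iff)
    qed
    show "\<phi> x = \<psi> x" using tend[of \<phi>] tend[of \<psi>] \<phi> \<psi> LIMSEQ_unique by blast
  qed
qed

text \<open>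
  Well defined for magic unitaries \<open>v\<close> by \<open>A_s_universal\<close>.
\<close>

definition A_s_hom :: "('n::finite \<Rightarrow> 'n \<Rightarrow> 'a::cstar_algebra) \<Rightarrow> 'n A_s \<Rightarrow> 'a" where
  "A_s_hom v = (THE \<phi>. star_hom \<phi> \<and> (\<forall>i j. \<phi> (universal_magic i j) = v i j))"

lemma is_projection_norm_le: "is_projection p \<Longrightarrow> norm (p::'a::cstar_algebra) \<le> 1"
proof -
  assume p: "is_projection p"
  then have "norm p * norm p = norm p"
    using cstar_identity[of p] by (simp add: is_projection_def power2_eq_square)
  then show ?thesis by (cases "norm p = 0") auto
qed

definition conj_transpose :: "complex^'n^'m \<Rightarrow> complex^'m^'n" where
  "conj_transpose A = (\<chi> i j. cnj (A $ j $ i))"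

definition matrix_scale :: "complex \<Rightarrow> complex^'n^'m \<Rightarrow> complex^'n^'m" where
  "matrix_scale c A = (\<chi> i j. c * A $ i $ j)"

text \<open>
  A separate type, because product and norm of \<open>complex^'n^'n\<close> are componentwise and Euclidean; here
  they are the matrix product and the operator norm.
\<close>

typedef 'n cmat = "UNIV :: (complex^'n^'n) set"
  morphisms cmat_entries Cmat ..

setup_lifting type_definition_cmat

instantiation cmat :: (finite) "{real_normed_algebra, monoid_mult, scaleC, star}"
begin

lift_definition zero_cmat :: "'a cmat" is 0 .
lift_definition one_cmat :: "'a cmat" is "mat 1" .
lift_definition plus_cmat :: "'a cmat \<Rightarrow> 'a cmat \<Rightarrow> 'a cmat" is "(+)" .
lift_definition minus_cmat :: "'a cmat \<Rightarrow> 'a cmat \<Rightarrow> 'a cmat" is "(-)" .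
lift_definition uminus_cmat :: "'a cmat \<Rightarrow> 'a cmat" is uminus .
lift_definition times_cmat :: "'a cmat \<Rightarrow> 'a cmat \<Rightarrow> 'a cmat" is "(**)" .
lift_definition scaleR_cmat :: "real \<Rightarrow> 'a cmat \<Rightarrow> 'a cmat" is scaleR .
lift_definition scaleC_cmat :: "complex \<Rightarrow> 'a cmat \<Rightarrow> 'a cmat" is matrix_scale .
lift_definition star_cmat :: "'a cmat \<Rightarrow> 'a cmat" is conj_transpose .
lift_definition norm_cmat :: "'a cmat \<Rightarrow> real" is "\<lambda>A. onorm ((*v) A)" .

definition sgn_cmat :: "'a cmat \<Rightarrow> 'a cmat" where "sgn_cmat x = inverse (norm x) *\<^sub>R x"

definition dist_cmat :: "'a cmat \<Rightarrow> 'a cmat \<Rightarrow> real" where "dist_cmat x y = norm (x - y)"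

definition uniformity_cmat :: "('a cmat \<times> 'a cmat) filter" where
  "uniformity_cmat = (INF e\<in>{0<..}. principal {(x, y). dist x y < e})"

definition open_cmat :: "'a cmat set \<Rightarrow> bool" where
  "open_cmat U \<longleftrightarrow> (\<forall>x\<in>U. eventually (\<lambda>(x', y). x' = x \<longrightarrow> y \<in> U) uniformity)"

instance
proof
  fix x y z :: "'a cmat" and r s :: real
  show "x + y + z = x + (y + z)" "x + y = y + x" "0 + x = x" "- x + x = 0" "x - y = x + - y"
    "r *\<^sub>R (x + y) = r *\<^sub>R x + r *\<^sub>R y" "(r + s) *\<^sub>R x = r *\<^sub>R x + s *\<^sub>R x"
    "r *\<^sub>R s *\<^sub>R x = (r * s) *\<^sub>R x" "1 *\<^sub>R x = x"
    by (transfer; simp add: add.assoc add.commute scaleR_add_right scaleR_add_left)+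
  show "x * y * z = x * (y * z)" by transfer (simp add: matrix_mul_assoc)
  show "1 * x = x" "x * 1 = x" by (transfer; simp)+
  show "(x + y) * z = x * z + y * z" "x * (y + z) = x * y + x * z"
    "r *\<^sub>R x * y = r *\<^sub>R (x * y)" "x * r *\<^sub>R y = r *\<^sub>R (x * y)"
    by (transfer; simp add: matrix_matrix_mult_def vec_eq_iff distrib_left distrib_right sum.distrib
        scaleR_sum_right)+
  show "dist x y = norm (x - y)" "sgn x = inverse (norm x) *\<^sub>R x"
    by (simp_all add: dist_cmat_def sgn_cmat_def)
  show "uniformity = (INF e\<in>{0<..}. principal {(x :: 'a cmat, y). dist x y < e})"
    by (rule uniformity_cmat_def)
  show "open U \<longleftrightarrow> (\<forall>x\<in>U. eventually (\<lambda>(x', y). x' = x \<longrightarrow> y \<in> U) uniformity)" for U :: "'a cmat set"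
    by (rule open_cmat_def)
  show "norm x = 0 \<longleftrightarrow> x = 0"
  proof transfer
    fix A :: "complex^'a^'a"
    have "onorm ((*v) A) = 0 \<longleftrightarrow> (\<forall>v. A *v v = 0)" by (rule onorm_eq_0) simp
    also have "\<dots> \<longleftrightarrow> A = 0" by (metis matrix_eq matrix_vector_mult_0)
    finally show "onorm ((*v) A) = 0 \<longleftrightarrow> A = 0" .
  qed
  show "norm (x + y) \<le> norm x + norm y"
  proof transfer
    fix A B :: "complex^'a^'a"
    show "onorm ((*v) (A + B)) \<le> onorm ((*v) A) + onorm ((*v) B)"
      using onorm_triangle[of "(*v) A" "(*v) B"] by (simp add: matrix_vector_mult_add_rdistrib[abs_def])
  qed
  show "norm (r *\<^sub>R x) = \<bar>r\<bar> * norm x"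
  proof transfer
    fix r and A :: "complex^'a^'a"
    have "(*v) (r *\<^sub>R A) = (\<lambda>v. r *\<^sub>R (A *v v))"
      by (simp add: fun_eq_iff vec_eq_iff matrix_vector_mult_def scaleR_sum_right)
    then show "onorm ((*v) (r *\<^sub>R A)) = \<bar>r\<bar> * onorm ((*v) A)" by (simp add: onorm_scaleR)
  qed
  show "norm (x * y) \<le> norm x * norm y"
  proof transfer
    fix A B :: "complex^'a^'a"
    show "onorm ((*v) (A ** B)) \<le> onorm ((*v) A) * onorm ((*v) B)"
      using onorm_compose[of "(*v) A" "(*v) B"] by (simp add: o_def matrix_vector_mul_assoc)
  qed
qed

end

lemma inner_conj_transpose:
  fixes A :: "complex^'n^'m"
  shows "(A *v x) \<bullet> y = x \<bullet> (conj_transpose A *v y)"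
proof -
  have i: "a \<bullet> b = Re (cnj a * b)" for a b :: complex by (simp add: inner_complex_def)
  have "(A *v x) \<bullet> y = Re (\<Sum>i\<in>UNIV. cnj ((A *v x) $ i) * y $ i)"
    by (simp only: inner_vec_def i Re_sum)
  also have "(\<Sum>i\<in>UNIV. cnj ((A *v x) $ i) * y $ i) =
      (\<Sum>i\<in>UNIV. \<Sum>j\<in>UNIV. cnj (A $ i $ j) * cnj (x $ j) * y $ i)"
    by (simp add: matrix_vector_mult_def sum_distrib_right)
  also have "(\<Sum>i\<in>UNIV. \<Sum>j\<in>UNIV. cnj (A $ i $ j) * cnj (x $ j) * y $ i) =
      (\<Sum>j\<in>UNIV. \<Sum>i\<in>UNIV. cnj (A $ i $ j) * cnj (x $ j) * y $ i)" by (rule sum.swap)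
  also have "\<dots> = (\<Sum>j\<in>UNIV. cnj (x $ j) * (conj_transpose A *v y) $ j)"
    by (simp add: matrix_vector_mult_def conj_transpose_def sum_distrib_left mult_ac)
  also have "Re \<dots> = x \<bullet> (conj_transpose A *v y)"
    by (simp only: inner_vec_def i Re_sum)
  finally show ?thesis .
qed

lemma conj_transpose_conj_transpose [simp]: "conj_transpose (conj_transpose A) = A"
  by (simp add: conj_transpose_def vec_eq_iff)

lemma conj_transpose_mult: "conj_transpose (A ** B) = conj_transpose B ** conj_transpose A"
  by (simp add: conj_transpose_def vec_eq_iff matrix_matrix_mult_def mult.commute)

lemma onorm_cstar:
  fixes A :: "complex^'n^'n"
  shows "onorm ((*v) (conj_transpose A ** A)) = (onorm ((*v) A))\<^sup>2"
proof -
  let ?N = "\<lambda>A::complex^'n^'n. onorm ((*v) A)"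
  have nn: "0 \<le> ?N B" for B by (simp add: onorm_pos_le)
  have comp: "?N (B ** C) \<le> ?N B * ?N C" for B C
    using onorm_compose[of "(*v) B" "(*v) C"] by (simp add: o_def matrix_vector_mul_assoc)
  have sq: "(?N B)\<^sup>2 \<le> ?N (conj_transpose B ** B)" for B
  proof -
    have "norm (B *v x) \<le> sqrt (?N (conj_transpose B ** B)) * norm x" for x
    proof -
      have "(norm (B *v x))\<^sup>2 = x \<bullet> ((conj_transpose B ** B) *v x)"
        by (simp add: power2_norm_eq_inner inner_conj_transpose matrix_vector_mul_assoc)
      also have "\<dots> \<le> norm x * norm ((conj_transpose B ** B) *v x)" by (rule norm_cauchy_schwarz)
      also have "\<dots> \<le> norm x * (?N (conj_transpose B ** B) * norm x)"
        by (intro mult_left_mono onorm) simp_all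
      also have "\<dots> = (sqrt (?N (conj_transpose B ** B)) * norm x)\<^sup>2"
        by (simp add: power_mult_distrib nn) (simp add: power2_eq_square)
      finally show ?thesis by (rule power2_le_imp_le) (simp add: nn)
    qed
    then have "?N B \<le> sqrt (?N (conj_transpose B ** B))" by (rule onorm_le)
    then show ?thesis using nn by (metis power_mono real_sqrt_pow2)
  qed
  have star: "?N B \<le> ?N (conj_transpose B)" for B
  proof (cases "?N B = 0")
    case False
    have "?N B * ?N B \<le> ?N (conj_transpose B) * ?N B"
      using sq[of B] comp[of "conj_transpose B" B] by (simp add: power2_eq_square)
    then show ?thesis using False nn[of B] by simp
  qed (simp add: nn)
  have "?N (conj_transpose A) \<le> ?N A" using star[of "conj_transpose A"] by simp
  then have "?N (conj_transpose A ** A) \<le> ?N A * ?N A"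
    using comp[of "conj_transpose A" A] nn[of A] by (meson mult_right_mono order_trans)
  then show ?thesis using sq[of A] by (simp add: power2_eq_square)
qed

lemma cmat_entry_le_norm: "cmod (cmat_entries A $ i $ j) \<le> norm A"
proof -
  have "(cmat_entries A *v axis j 1) $ i = (\<Sum>k\<in>UNIV. cmat_entries A $ i $ k * (if k = j then 1 else 0))"
    by (simp add: matrix_vector_mult_def axis_def)
  also have "\<dots> = (\<Sum>k\<in>UNIV. if k = j then cmat_entries A $ i $ k else 0)"
    by (rule sum.cong) auto
  finally have "(cmat_entries A *v axis j 1) $ i = cmat_entries A $ i $ j" by simp
  then have "cmod (cmat_entries A $ i $ j) = cmod ((cmat_entries A *v axis j 1) $ i)" by simp
  also have "\<dots> \<le> norm (cmat_entries A *v axis j 1)" by (rule Finite_Cartesian_Product.norm_nth_le)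
  also have "\<dots> \<le> norm A * norm (axis j (1::complex))"
    unfolding norm_cmat.rep_eq by (rule onorm) simp
  also have "norm (axis j (1::complex)) = 1" by (rule norm_eq_1[THEN iffD2]) (simp add: inner_axis_axis)
  finally show ?thesis by simp
qed

lemma cmat_norm_le_entries: "norm A \<le> (\<Sum>i\<in>UNIV. \<Sum>j\<in>UNIV. cmod (cmat_entries A $ i $ j))"
  unfolding norm_cmat.rep_eq
proof (rule onorm_le)
  fix x :: "complex^'a"
  let ?A = "cmat_entries A"
  have "norm (?A *v x) \<le> (\<Sum>i\<in>UNIV. cmod ((?A *v x) $ i))"
    unfolding norm_vec_def by (rule L2_set_le_sum) simp
  also have "\<dots> \<le> (\<Sum>i\<in>UNIV. \<Sum>j\<in>UNIV. cmod (?A $ i $ j) * norm x)"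
  proof (rule sum_mono)
    fix i
    have "cmod ((?A *v x) $ i) \<le> (\<Sum>j\<in>UNIV. cmod (?A $ i $ j * x $ j))"
      unfolding matrix_vector_mult_def by (simp add: norm_sum)
    also have "\<dots> \<le> (\<Sum>j\<in>UNIV. cmod (?A $ i $ j) * norm x)"
      by (intro sum_mono) (simp add: norm_mult mult_left_mono Finite_Cartesian_Product.norm_nth_le)
    finally show "cmod ((?A *v x) $ i) \<le> (\<Sum>j\<in>UNIV. cmod (?A $ i $ j) * norm x)" .
  qed
  finally show "norm (?A *v x) \<le> (\<Sum>i\<in>UNIV. \<Sum>j\<in>UNIV. cmod (?A $ i $ j)) * norm x"
    by (simp add: sum_distrib_right)
qed

lemma tendsto_cmat_entries:
  assumes "\<And>i j. ((\<lambda>t. cmat_entries (f t) $ i $ j) \<longlongrightarrow> cmat_entries A $ i $ j) F"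
  shows "(f \<longlongrightarrow> A) F"
proof -
  have "((\<lambda>t. \<Sum>i\<in>UNIV. \<Sum>j\<in>UNIV. cmod (cmat_entries (f t) $ i $ j - cmat_entries A $ i $ j))
      \<longlongrightarrow> 0) F"
    by (intro tendsto_null_sum tendsto_norm_zero LIM_zero assms)
  moreover have "norm (f t - A) \<le> (\<Sum>i\<in>UNIV. \<Sum>j\<in>UNIV. cmod (cmat_entries (f t) $ i $ j - cmat_entries A $ i $ j))" for t
    using cmat_norm_le_entries[of "f t - A"] by (simp add: minus_cmat.rep_eq)
  ultimately have "((\<lambda>t. f t - A) \<longlongrightarrow> 0) F"
    by (rule Lim_null_comparison[OF always_eventually[OF allI], rotated])
  then show ?thesis by (rule LIM_zero_cancel)
qed

instance cmat :: (finite) cstar_algebra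
proof
  fix x y :: "'a cmat" and r :: real and c d :: complex
  note D = vec_eq_iff matrix_matrix_mult_def matrix_scale_def conj_transpose_def
  show "c *\<^sub>C (x + y) = c *\<^sub>C x + c *\<^sub>C y" "(c + d) *\<^sub>C x = c *\<^sub>C x + d *\<^sub>C x"
    "c *\<^sub>C d *\<^sub>C x = (c * d) *\<^sub>C x" "r *\<^sub>R x = complex_of_real r *\<^sub>C x"
    "(c *\<^sub>C x) * y = c *\<^sub>C (x * y)" "x * (c *\<^sub>C y) = c *\<^sub>C (x * y)"
    "star (x + y) = star x + star y" "star (c *\<^sub>C x) = cnj c *\<^sub>C star x"
    by (transfer; simp add: D distrib_left distrib_right sum_distrib_left
        scaleR_conv_of_real[where 'a = complex] mult.assoc mult.left_commute)+
  show "star (x * y) = star y * star x" by transfer (rule conj_transpose_mult)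
  show "star (star x) = x" by transfer simp
  show "norm (star x * x) = (norm x)\<^sup>2" by transfer (rule onorm_cstar)
  show "norm (c *\<^sub>C x) = cmod c * norm x"
  proof transfer
    fix c and A :: "complex^'a^'a"
    have le: "onorm ((*v) (matrix_scale c A)) \<le> cmod c * onorm ((*v) A)" for c and A :: "complex^'a^'a"
    proof (rule onorm_le)
      fix v
      have "norm (matrix_scale c A *v v) = norm (\<chi> i. c * (A *v v) $ i)"
        by (simp add: matrix_vector_mult_def matrix_scale_def sum_distrib_left mult.assoc)
      also have "\<dots> = cmod c * norm (A *v v)"
        by (simp add: norm_vec_def norm_mult L2_set_right_distrib)
      also have "\<dots> \<le> cmod c * onorm ((*v) A) * norm v"
        by (simp add: mult.assoc mult_left_mono onorm)
      finally show "norm (matrix_scale c A *v v) \<le> cmod c * onorm ((*v) A) * norm v" .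
    qed
    show "onorm ((*v) (matrix_scale c A)) = cmod c * onorm ((*v) A)"
    proof (cases "c = 0")
      case True
      then show ?thesis using le[of c A] onorm_pos_le[of "(*v) (matrix_scale c A)"] by simp
    next
      case False
      have "matrix_scale (inverse c) (matrix_scale c A) = A"
        using False by (simp add: matrix_scale_def vec_eq_iff)
      then have "onorm ((*v) A) \<le> inverse (cmod c) * onorm ((*v) (matrix_scale c A))"
        using le[of "inverse c" "matrix_scale c A"] by (simp add: norm_inverse)
      then have "cmod c * onorm ((*v) A) \<le> onorm ((*v) (matrix_scale c A))"
        using False by (simp add: field_simps)
      then show ?thesis using le[of c A] by simp
    qed
  qed
next
  fix X :: "nat \<Rightarrow> 'a cmat" assume X: "Cauchy X"
  have "convergent (\<lambda>n. cmat_entries (X n) $ i $ j)" for i j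
  proof (rule Cauchy_convergent, rule CauchyI)
    fix e :: real assume "e > 0"
    then obtain M where M: "\<And>m n. m \<ge> M \<Longrightarrow> n \<ge> M \<Longrightarrow> norm (X m - X n) < e"
      using X unfolding Cauchy_iff by meson
    have "cmod (cmat_entries (X m) $ i $ j - cmat_entries (X n) $ i $ j) \<le> norm (X m - X n)" for m n
      using cmat_entry_le_norm[of "X m - X n" i j] by (simp add: minus_cmat.rep_eq)
    then show "\<exists>M. \<forall>m\<ge>M. \<forall>n\<ge>M. norm (cmat_entries (X m) $ i $ j - cmat_entries (X n) $ i $ j) < e"
      using M le_less_trans by blast
  qed
  then obtain L where "\<And>i j. (\<lambda>n. cmat_entries (X n) $ i $ j) \<longlonglongrightarrow> L i j"
    unfolding convergent_def by metis
  then have "X \<longlonglongrightarrow> Cmat (\<chi> i j. L i j)"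
    by (intro tendsto_cmat_entries) (simp add: Cmat_inverse)
  then show "convergent X" by (auto simp: convergent_def)
qed

unbundle bcontfun.lifting

instantiation bcontfun :: (metric_space, cstar_algebra) "{real_normed_algebra, monoid_mult, scaleC, star}"
begin

lemma bcontfun_bound:
  fixes f :: "'a \<Rightarrow> 'b"
  assumes "f \<in> bcontfun"
  obtains B where "B \<ge> 0" "\<And>x. norm (f x) \<le> B"
proof -
  obtain B where B: "\<And>x. norm (f x) \<le> B"
    using assms by (auto simp: bcontfun_def bounded_iff)
  then have "B \<ge> 0" by (meson norm_ge_zero order_trans)
  then show thesis using B by (rule that)
qed

lift_definition one_bcontfun :: "'a \<Rightarrow>\<^sub>C 'b" is "\<lambda>_. 1" by (rule const_bcontfun)

lift_definition times_bcontfun :: "('a \<Rightarrow>\<^sub>C 'b) \<Rightarrow> ('a \<Rightarrow>\<^sub>C 'b) \<Rightarrow> ('a \<Rightarrow>\<^sub>C 'b)" is "\<lambda>f g x. f x * g x"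
proof -
  fix f g :: "'a \<Rightarrow> 'b" assume f: "f \<in> bcontfun" and g: "g \<in> bcontfun"
  obtain B where B: "B \<ge> 0" "\<And>x. norm (f x) \<le> B" using bcontfun_bound[OF f] by blast
  obtain C where C: "C \<ge> 0" "\<And>x. norm (g x) \<le> C" using bcontfun_bound[OF g] by blast
  have "norm (f x * g x) \<le> B * C" for x
    by (rule order_trans[OF norm_mult_ineq]) (intro mult_mono B C norm_ge_zero)
  then show "(\<lambda>x. f x * g x) \<in> bcontfun"
    using f g by (intro bcontfun_normI) (auto simp: bcontfun_def intro!: continuous_intros)
qed

lift_definition scaleC_bcontfun :: "complex \<Rightarrow> ('a \<Rightarrow>\<^sub>C 'b) \<Rightarrow> ('a \<Rightarrow>\<^sub>C 'b)" is "\<lambda>c f x. c *\<^sub>C f x"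
proof -
  fix c and f :: "'a \<Rightarrow> 'b" assume f: "f \<in> bcontfun"
  obtain B where B: "B \<ge> 0" "\<And>x. norm (f x) \<le> B" using bcontfun_bound[OF f] by blast
  show "(\<lambda>x. c *\<^sub>C f x) \<in> bcontfun"
    using f B by (intro bcontfun_normI[of _ "cmod c * B"])
      (auto simp: bcontfun_def norm_scaleC mult_left_mono
        intro!: bounded_linear.continuous_on[OF bounded_linear_scaleC])
qed

lift_definition star_bcontfun :: "('a \<Rightarrow>\<^sub>C 'b) \<Rightarrow> ('a \<Rightarrow>\<^sub>C 'b)" is "\<lambda>f x. star (f x)"
proof -
  fix f :: "'a \<Rightarrow> 'b" assume f: "f \<in> bcontfun"
  obtain B where B: "B \<ge> 0" "\<And>x. norm (f x) \<le> B" using bcontfun_bound[OF f] by blast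
  show "(\<lambda>x. star (f x)) \<in> bcontfun"
    using f B by (intro bcontfun_normI[of _ B])
      (auto simp: bcontfun_def intro!: bounded_linear.continuous_on[OF bounded_linear_star])
qed

instance
proof
  fix f g h :: "'a \<Rightarrow>\<^sub>C 'b" and r :: real
  show "f * g * h = f * (g * h)" "1 * f = f" "f * 1 = f" "(f + g) * h = f * h + g * h"
    "f * (g + h) = f * g + f * h" "r *\<^sub>R f * g = r *\<^sub>R (f * g)" "f * r *\<^sub>R g = r *\<^sub>R (f * g)"
    by (rule bcontfun_eqI; simp add: times_bcontfun.rep_eq one_bcontfun.rep_eq mult.assoc distrib_left
        distrib_right)+
  show "norm (f * g) \<le> norm f * norm g"
  proof (rule norm_bound)
    fix x
    have "norm (f x * g x) \<le> norm (f x) * norm (g x)" by (rule norm_mult_ineq)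
    also have "\<dots> \<le> norm f * norm g" by (intro mult_mono norm_bounded) simp_all
    finally show "norm (apply_bcontfun (f * g) x) \<le> norm f * norm g"
      by (simp add: times_bcontfun.rep_eq)
  qed
qed

end

instance bcontfun :: (metric_space, cstar_algebra) cstar_algebra
proof
  fix f g :: "'a \<Rightarrow>\<^sub>C 'b" and r :: real and c d :: complex
  show "c *\<^sub>C (f + g) = c *\<^sub>C f + c *\<^sub>C g" "(c + d) *\<^sub>C f = c *\<^sub>C f + d *\<^sub>C f"
    "c *\<^sub>C d *\<^sub>C f = (c * d) *\<^sub>C f" "r *\<^sub>R f = complex_of_real r *\<^sub>C f"
    "(c *\<^sub>C f) * g = c *\<^sub>C (f * g)" "f * (c *\<^sub>C g) = c *\<^sub>C (f * g)"
    "star (f + g) = star f + star g" "star (c *\<^sub>C f) = cnj c *\<^sub>C star f"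
    "star (f * g) = star g * star f" "star (star f) = f"
    by (rule bcontfun_eqI; simp add: times_bcontfun.rep_eq scaleC_bcontfun.rep_eq star_bcontfun.rep_eq
        scaleC_add_right scaleC_add_left scaleC_scaleC scaleR_scaleC mult_scaleC_left
        mult_scaleC_right star_add star_scaleC star_mult star_star)+
  have sc_le: "norm (c *\<^sub>C f) \<le> cmod c * norm f" for c and f :: "'a \<Rightarrow>\<^sub>C 'b"
    by (rule norm_bound) (simp add: scaleC_bcontfun.rep_eq norm_scaleC mult_left_mono norm_bounded)
  show "norm (c *\<^sub>C f) = cmod c * norm f"
  proof (cases "c = 0")
    case True
    then show ?thesis using sc_le[of c f] by simp
  next
    case False
    have "inverse c *\<^sub>C c *\<^sub>C f = f"
      using False by (intro bcontfun_eqI) (simp add: scaleC_bcontfun.rep_eq scaleC_scaleC)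
    then have "norm f \<le> inverse (cmod c) * norm (c *\<^sub>C f)"
      using sc_le[of "inverse c" "c *\<^sub>C f"] by (simp add: norm_inverse)
    then have "cmod c * norm f \<le> norm (c *\<^sub>C f)" using False by (simp add: field_simps)
    then show ?thesis using sc_le[of c f] by simp
  qed
  show "norm (star f * f) = (norm f)\<^sup>2"
  proof (rule antisym)
    show "norm (star f * f) \<le> (norm f)\<^sup>2"
      by (rule norm_bound)
        (simp add: times_bcontfun.rep_eq star_bcontfun.rep_eq cstar_identity power_mono norm_bounded)
    have "norm f \<le> sqrt (norm (star f * f))"
    proof (rule norm_bound)
      fix x
      have "(norm (f x))\<^sup>2 \<le> norm (star f * f)"
        using norm_bounded[of "star f * f" x]
        by (simp add: times_bcontfun.rep_eq star_bcontfun.rep_eq cstar_identity)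
      then show "norm (f x) \<le> sqrt (norm (star f * f))" by (rule real_le_rsqrt)
    qed
    then show "(norm f)\<^sup>2 \<le> norm (star f * f)"
      by (metis norm_ge_zero power_mono real_sqrt_pow2)
  qed
qed

typedef SU2 = "{x :: complex^2^2. conj_transpose x ** x = mat 1 \<and> det x = 1}"
  morphisms SU2_matrix Abs_SU2
  by (rule exI[of _ "mat 1"]) (simp add: conj_transpose_def mat_def matrix_matrix_mult_def det_2 vec_eq_iff forall_2 sum_2)

instantiation SU2 :: metric_space
begin

definition dist_SU2 :: "SU2 \<Rightarrow> SU2 \<Rightarrow> real" where
  "dist_SU2 x y = dist (SU2_matrix x) (SU2_matrix y)"

definition uniformity_SU2 :: "(SU2 \<times> SU2) filter" where
  "uniformity_SU2 = (INF e\<in>{0<..}. principal {(x, y). dist x y < e})"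

definition open_SU2 :: "SU2 set \<Rightarrow> bool" where
  "open_SU2 U \<longleftrightarrow> (\<forall>x\<in>U. eventually (\<lambda>(x', y). x' = x \<longrightarrow> y \<in> U) uniformity)"

instance
proof
  fix x y z :: SU2
  show "uniformity = (INF e\<in>{0<..}. principal {(x :: SU2, y). dist x y < e})"
    by (rule uniformity_SU2_def)
  show "open U \<longleftrightarrow> (\<forall>x\<in>U. eventually (\<lambda>(x', y). x' = x \<longrightarrow> y \<in> U) uniformity)" for U :: "SU2 set"
    by (rule open_SU2_def)
  show "dist x y = 0 \<longleftrightarrow> x = y" by (simp add: dist_SU2_def SU2_matrix_inject)
  show "dist x y \<le> dist x z + dist y z" by (simp add: dist_SU2_def dist_triangle2)
qed

end

lemma SU2_unitary: "conj_transpose (SU2_matrix x) ** SU2_matrix x = mat 1"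
  using SU2_matrix[of x] by simp

lemma continuous_SU2_matrix: "continuous_on S SU2_matrix"
  unfolding continuous_on_iff dist_SU2_def[symmetric] by blast

lemma compact_SU2: "compact (UNIV :: SU2 set)"
proof -
  let ?S = "{x :: complex^2^2. conj_transpose x ** x = mat 1 \<and> det x = 1}"
  have "bounded ?S"
    unfolding bounded_iff
  proof (intro exI ballI)
    fix x assume x: "x \<in> ?S"
    have "star (Cmat x) * Cmat x = 1"
      using x by (simp add: cmat_entries_inject[symmetric] times_cmat.rep_eq star_cmat.rep_eq
          one_cmat.rep_eq Cmat_inverse)
    then have "(norm (Cmat x))\<^sup>2 \<le> 1" using cstar_identity[of "Cmat x"] norm_one_le[where 'a = "2 cmat"] by simp
    then have "norm (Cmat x) \<le> 1" by (simp add: abs_square_le_1)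
    then have e: "cmod (x $ i $ j) \<le> 1" for i j
      using cmat_entry_le_norm[of "Cmat x" i j] by (simp add: Cmat_inverse)
    have "norm x \<le> (\<Sum>i\<in>UNIV. norm (x $ i))" unfolding norm_vec_def by (rule L2_set_le_sum) simp
    also have "\<dots> \<le> (\<Sum>i\<in>UNIV. \<Sum>j\<in>UNIV. cmod (x $ i $ j))"
      by (intro sum_mono) (unfold norm_vec_def, rule L2_set_le_sum, simp)
    also have "\<dots> \<le> (\<Sum>i\<in>(UNIV :: 2 set). \<Sum>j\<in>(UNIV :: 2 set). 1)" by (intro sum_mono e)
    finally show "norm x \<le> 4" by simp
  qed
  moreover have "closed ?S"
    unfolding det_2 vec_eq_iff matrix_matrix_mult_def conj_transpose_def sum_2 forall_2
    by (simp add: mat_def) (intro closed_Collect_conj closed_Collect_eq continuous_intros)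
  ultimately have "compact ?S" by (simp add: compact_eq_bounded_closed)
  moreover have "continuous_on ?S Abs_SU2"
    unfolding continuous_on_iff by (auto simp: dist_SU2_def Abs_SU2_inverse)
  ultimately have "compact (Abs_SU2 ` ?S)" by (intro compact_continuous_image)
  moreover have "Abs_SU2 ` ?S = UNIV"
    using type_definition.Abs_image[OF type_definition_SU2] .
  ultimately show ?thesis by simp
qed

text \<open>
  In the index type \<open>4\<close> the numeral 4 equals 0; the last branch is the index 4.
\<close>

definition pauli :: "4 \<Rightarrow> complex^2^2" where
  "pauli i =
     (if i = 1 then vector [vector [1, 0], vector [0, 1]]
      else if i = 2 then vector [vector [\<i>, 0], vector [0, -\<i>]]
      else if i = 3 then vector [vector [0, 1], vector [-1, 0]]
      else vector [vector [0, \<i>], vector [\<i>, 0]])"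

text \<open>
  The division by 2 normalizes the trace.
\<close>

definition tr_inner :: "complex^2^2 \<Rightarrow> complex^2^2 \<Rightarrow> complex" where
  "tr_inner a b = trace (conj_transpose b ** a) / 2"

definition hilbert_iso :: "(complex^2^2 \<Rightarrow> complex^4) \<Rightarrow> bool" where
  "hilbert_iso U \<longleftrightarrow>
     (\<forall>a b. U (a + b) = U a + U b) \<and> (\<forall>c a. U (matrix_scale c a) = c *s U a) \<and> bij U \<and>
     (\<forall>a b. (\<Sum>k\<in>UNIV. U a $ k * cnj (U b $ k)) = tr_inner a b)"

text \<open>
  The orthogonal projection of the Hilbert space of 2 by 2 matrices onto the line spanned by \<open>\<xi>\<close>, for
  \<open>\<xi> \<noteq> 0\<close>.
\<close>

definition rank_one_projection :: "complex^2^2 \<Rightarrow> complex^2^2 \<Rightarrow> complex^2^2" where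
  "rank_one_projection \<xi> \<eta> = matrix_scale (tr_inner \<eta> \<xi> / tr_inner \<xi> \<xi>) \<xi>"

text \<open>
  The identification of the operators on the 2 by 2 matrices with the 4 by 4 matrices that is induced by \<open>U\<close>.
\<close>

definition transported_matrix ::
    "(complex^2^2 \<Rightarrow> complex^4) \<Rightarrow> (complex^2^2 \<Rightarrow> complex^2^2) \<Rightarrow> 4 cmat" where
  "transported_matrix U T = Cmat (matrix (U \<circ> T \<circ> inv U))"

text \<open>
  As \<open>SU2\<close> is compact (\<open>compact_SU2\<close>), the type of bounded continuous functions on it consists of
  all continuous functions.  The function below is continuous by \<open>pauli_magic_bcontfun\<close>, so that
  \<open>Bcontfun\<close> is applied inside its domain.
\<close>

definition pauli_magic :: "(complex^2^2 \<Rightarrow> complex^4) \<Rightarrow> 4 \<Rightarrow> 4 \<Rightarrow> SU2 \<Rightarrow>\<^sub>C 4 cmat" where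
  "pauli_magic U i j =
     Bcontfun (\<lambda>x. transported_matrix U (rank_one_projection (pauli i ** SU2_matrix x ** pauli j)))"

definition pauli_representation :: "(complex^2^2 \<Rightarrow> complex^4) \<Rightarrow> 4 A_s \<Rightarrow> SU2 \<Rightarrow>\<^sub>C 4 cmat" where
  "pauli_representation U = A_s_hom (pauli_magic U)"

lemma pauli_tr_inner: "tr_inner (pauli j) (pauli k) = (if j = k then 1 else 0)"
proof -
  have "\<forall>j k. tr_inner (pauli j) (pauli k) = (if j = k then 1 else 0)"
    by (simp add: forall_4 pauli_def tr_inner_def trace_def conj_transpose_def matrix_matrix_mult_def sum_2)
  then show ?thesis by blast
qed

lemma pauli_unitary: "conj_transpose (pauli i) ** pauli i = mat 1"
proof -
  have "\<forall>i. conj_transpose (pauli i) ** pauli i = mat 1"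
    by (simp add: forall_4 pauli_def conj_transpose_def matrix_matrix_mult_def sum_2 vec_eq_iff forall_2 mat_def)
  then show ?thesis by blast
qed

lemma tr_inner_unitary_left:
  assumes "conj_transpose w ** w = mat 1"
  shows "tr_inner (w ** a) (w ** b) = tr_inner a b"
proof -
  have "conj_transpose (w ** b) ** (w ** a) = conj_transpose b ** ((conj_transpose w ** w) ** a)"
    by (simp only: conj_transpose_mult matrix_mul_assoc)
  then show ?thesis by (simp add: tr_inner_def assms)
qed

lemma tr_inner_unitary_right:
  assumes "conj_transpose w ** w = mat 1"
  shows "tr_inner (a ** w) (b ** w) = tr_inner a b"
proof -
  have w: "w ** conj_transpose w = mat 1" using assms matrix_left_right_inverse by blast
  have "trace (conj_transpose (b ** w) ** (a ** w)) = trace (conj_transpose w ** (conj_transpose b ** a ** w))"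
    by (simp only: conj_transpose_mult matrix_mul_assoc)
  also have "\<dots> = trace ((conj_transpose b ** a ** w) ** conj_transpose w)" by (rule trace_mul_sym)
  also have "\<dots> = trace (conj_transpose b ** a ** (w ** conj_transpose w))" by (simp only: matrix_mul_assoc)
  finally show ?thesis by (simp add: tr_inner_def w)
qed

lemma pauli_orthonormal_row:
  "tr_inner (pauli i ** SU2_matrix x ** pauli j) (pauli i ** SU2_matrix x ** pauli k) = (if j = k then 1 else 0)"
  by (simp add: tr_inner_unitary_left SU2_unitary pauli_unitary pauli_tr_inner flip: matrix_mul_assoc)

lemma pauli_orthonormal_column:
  "tr_inner (pauli j ** SU2_matrix x ** pauli i) (pauli k ** SU2_matrix x ** pauli i) = (if j = k then 1 else 0)"
  by (simp add: tr_inner_unitary_right SU2_unitary pauli_unitary pauli_tr_inner)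

lemma hilbert_iso_exists: "\<exists>U. hilbert_iso U"
proof -
  define s where "s = complex_of_real (1 / sqrt 2)"
  have s2: "s * s = 1 / 2" "cnj s = s" "s \<noteq> 0" unfolding s_def by (simp_all flip: of_real_mult)
  define U :: "complex^2^2 \<Rightarrow> complex^4" where
    "U a = (\<chi> k. s * (if k = 1 then a $ 1 $ 1 else if k = 2 then a $ 1 $ 2 else if k = 3 then a $ 2 $ 1 else a $ 2 $ 2))" for a
  define V :: "complex^4 \<Rightarrow> complex^2^2" where
    "V v = vector [vector [v $ 1 / s, v $ 2 / s], vector [v $ 3 / s, v $ 4 / s]]" for v
  have "bij U"
    by (rule o_bij[of V]) (auto simp: fun_eq_iff U_def V_def vec_eq_iff forall_2 forall_4 s2)
  moreover have "(\<Sum>k\<in>UNIV. U a $ k * cnj (U b $ k)) = tr_inner a b" for a b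
  proof -
    have m: "(s * z) * cnj (s * w) = z * cnj w / 2" for z w
      using s2 by (simp add: algebra_simps)
    show ?thesis
      unfolding U_def vec_lambda_beta m
      by (simp add: sum_4 tr_inner_def trace_def conj_transpose_def matrix_matrix_mult_def sum_2 field_simps)
  qed
  moreover have "U (a + b) = U a + U b" "U (matrix_scale c a) = c *s U a" for a b c
    by (simp_all add: U_def vec_eq_iff matrix_scale_def distrib_left)
  ultimately show ?thesis unfolding hilbert_iso_def by blast
qed

context
  fixes U :: "complex^2^2 \<Rightarrow> complex^4"
  assumes U: "hilbert_iso U"
begin

lemma transported_projection_entry:
  assumes "tr_inner \<xi> \<xi> = 1"
  shows "cmat_entries (transported_matrix U (rank_one_projection \<xi>)) $ k $ l = U \<xi> $ k * cnj (U \<xi> $ l)"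
proof -
  have bij: "bij U" and inn: "tr_inner a b = (\<Sum>k\<in>UNIV. U a $ k * cnj (U b $ k))"
    and sc: "U (matrix_scale c a) = c *s U a" for a b c
    using U by (auto simp: hilbert_iso_def)
  have "U (inv U v) = v" for v using bij by (simp add: bij_is_surj surj_f_inv_f)
  then have "tr_inner (inv U (axis l 1)) \<xi> = (\<Sum>k\<in>UNIV. axis l 1 $ k * cnj (U \<xi> $ k))"
    by (simp add: inn)
  also have "\<dots> = (\<Sum>k\<in>UNIV. if k = l then cnj (U \<xi> $ k) else 0)"
    by (intro sum.cong) (auto simp: axis_def)
  finally have "tr_inner (inv U (axis l 1)) \<xi> = cnj (U \<xi> $ l)" by simp
  then show ?thesis
    by (simp add: transported_matrix_def Cmat_inverse matrix_def rank_one_projection_def assms sc)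
qed

lemma pauli_magic_entry:
  "cmat_entries (transported_matrix U (rank_one_projection (pauli i ** SU2_matrix x ** pauli j))) $ k $ l =
     U (pauli i ** SU2_matrix x ** pauli j) $ k * cnj (U (pauli i ** SU2_matrix x ** pauli j) $ l)"
  by (rule transported_projection_entry) (simp add: pauli_orthonormal_row)

lemma transported_projection_mult:
  assumes "tr_inner \<xi> \<xi> = 1" "tr_inner \<eta> \<eta> = 1"
  shows "cmat_entries (transported_matrix U (rank_one_projection \<xi>) * transported_matrix U (rank_one_projection \<eta>)) $ k $ l
    = U \<xi> $ k * tr_inner \<eta> \<xi> * cnj (U \<eta> $ l)"
proof -
  have inn: "tr_inner a b = (\<Sum>k\<in>UNIV. U a $ k * cnj (U b $ k))" for a b
    using U by (auto simp: hilbert_iso_def)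
  have "cmat_entries (transported_matrix U (rank_one_projection \<xi>) * transported_matrix U (rank_one_projection \<eta>)) $ k $ l
    = (\<Sum>m\<in>UNIV. (U \<xi> $ k * cnj (U \<xi> $ m)) * (U \<eta> $ m * cnj (U \<eta> $ l)))"
    by (simp add: times_cmat.rep_eq matrix_matrix_mult_def transported_projection_entry assms)
  also have "\<dots> = U \<xi> $ k * (\<Sum>m\<in>UNIV. U \<eta> $ m * cnj (U \<xi> $ m)) * cnj (U \<eta> $ l)"
    by (simp add: sum_distrib_left sum_distrib_right mult_ac)
  finally show ?thesis by (simp only: inn)
qed

lemma transported_projection_is_projection:
  assumes "tr_inner \<xi> \<xi> = 1"
  shows "is_projection (transported_matrix U (rank_one_projection \<xi>))"
  unfolding is_projection_def cmat_entries_inject[symmetric] vec_eq_iff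
  by (simp add: transported_projection_mult transported_projection_entry assms star_cmat.rep_eq conj_transpose_def)

lemma transported_projection_orthogonal:
  assumes "tr_inner \<xi> \<xi> = 1" "tr_inner \<eta> \<eta> = 1" "tr_inner \<eta> \<xi> = 0"
  shows "transported_matrix U (rank_one_projection \<xi>) * transported_matrix U (rank_one_projection \<eta>) = 0"
  unfolding cmat_entries_inject[symmetric] vec_eq_iff
  by (simp add: transported_projection_mult assms zero_cmat.rep_eq)

lemma cmat_entries_sum: "cmat_entries (sum f A) = (\<Sum>x\<in>A. cmat_entries (f x))"
  by (induction A rule: infinite_finite_induct) (auto simp: zero_cmat.rep_eq plus_cmat.rep_eq)

lemma transported_projection_sum:
  fixes \<xi> :: "4 \<Rightarrow> complex^2^2"
  assumes on: "\<And>j k. tr_inner (\<xi> j) (\<xi> k) = (if j = k then 1 else 0)"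
  shows "(\<Sum>j\<in>UNIV. transported_matrix U (rank_one_projection (\<xi> j))) = 1"
proof -
  have inn: "tr_inner a b = (\<Sum>k\<in>UNIV. U a $ k * cnj (U b $ k))" for a b
    using U by (auto simp: hilbert_iso_def)
  define W :: "complex^4^4" where "W = (\<chi> k j. U (\<xi> j) $ k)"
  have "conj_transpose W ** W = mat 1"
    using on by (simp add: vec_eq_iff matrix_matrix_mult_def conj_transpose_def W_def mat_def inn mult.commute)
  then have "W ** conj_transpose W = mat 1" using matrix_left_right_inverse by blast
  then have "(\<Sum>j\<in>UNIV. U (\<xi> j) $ k * cnj (U (\<xi> j) $ l)) = (mat 1 :: complex^4^4) $ k $ l" for k l
    by (simp add: vec_eq_iff matrix_matrix_mult_def conj_transpose_def W_def)
  then show ?thesis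
    unfolding cmat_entries_inject[symmetric] vec_eq_iff
    by (simp add: cmat_entries_sum transported_projection_entry on one_cmat.rep_eq)
qed

lemma pauli_magic_bcontfun:
  "(\<lambda>x. transported_matrix U (rank_one_projection (pauli i ** SU2_matrix x ** pauli j))) \<in> bcontfun"
proof (rule bcontfun_normI)
  show "norm (transported_matrix U (rank_one_projection (pauli i ** SU2_matrix x ** pauli j))) \<le> 1" for x
    by (intro is_projection_norm_le transported_projection_is_projection) (simp add: pauli_orthonormal_row)
  have "linear U"
  proof (rule linearI)
    show "U (a + b) = U a + U b" for a b using U by (simp add: hilbert_iso_def)
    show "U (r *\<^sub>R a) = r *\<^sub>R U a" for r a
    proof -
      have "r *\<^sub>R a = matrix_scale (complex_of_real r) a"
        by (simp add: vec_eq_iff matrix_scale_def scaleR_conv_of_real[where 'a = complex])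
      then have "U (r *\<^sub>R a) = complex_of_real r *s U a" using U by (simp add: hilbert_iso_def)
      then show ?thesis by (simp add: vec_eq_iff scaleR_conv_of_real[where 'a = complex])
    qed
  qed
  then have "bounded_linear U" by (rule linear_conv_bounded_linear[THEN iffD1])
  moreover have "continuous_on UNIV (\<lambda>x. pauli i ** SU2_matrix x ** pauli j)"
    unfolding matrix_matrix_mult_def
    by (intro continuous_on_vec_lambda continuous_intros continuous_on_component continuous_SU2_matrix)
  ultimately have "continuous_on UNIV (\<lambda>x. U (pauli i ** SU2_matrix x ** pauli j))"
    by (rule bounded_linear.continuous_on)
  then have c: "continuous_on UNIV (\<lambda>x. U (pauli i ** SU2_matrix x ** pauli j) $ k)" for k
    by (intro continuous_on_component)
  show "continuous_on UNIV (\<lambda>x. transported_matrix U (rank_one_projection (pauli i ** SU2_matrix x ** pauli j)))"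
    unfolding continuous_on_def
  proof (intro ballI tendsto_cmat_entries)
    fix x k l
    show "((\<lambda>t. cmat_entries (transported_matrix U (rank_one_projection (pauli i ** SU2_matrix t ** pauli j))) $ k $ l)
        \<longlongrightarrow> cmat_entries (transported_matrix U (rank_one_projection (pauli i ** SU2_matrix x ** pauli j))) $ k $ l) (at x within UNIV)"
      unfolding pauli_magic_entry using c unfolding continuous_on_def by (intro tendsto_mult tendsto_cnj) auto
  qed
qed

lemma pauli_magic_apply:
  "apply_bcontfun (pauli_magic U i j) x = transported_matrix U (rank_one_projection (pauli i ** SU2_matrix x ** pauli j))"
  by (simp add: pauli_magic_def Bcontfun_inverse pauli_magic_bcontfun)

lemma apply_bcontfun_sum: "apply_bcontfun (sum f A) x = (\<Sum>a\<in>A. apply_bcontfun (f a) x)"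
  by (induction A rule: infinite_finite_induct) auto

theorem magic_unitary_pauli: "magic_unitary (pauli_magic U)"
  unfolding magic_unitary_def is_projection_def
proof (intro conjI allI impI)
  fix i j k :: 4
  note [simp] = pauli_magic_apply times_bcontfun.rep_eq star_bcontfun.rep_eq one_bcontfun.rep_eq apply_bcontfun_sum
  have p: "is_projection (transported_matrix U (rank_one_projection (pauli i ** SU2_matrix x ** pauli j)))" for x
    by (rule transported_projection_is_projection) (simp add: pauli_orthonormal_row)
  show "pauli_magic U i j * pauli_magic U i j = pauli_magic U i j" "star (pauli_magic U i j) = pauli_magic U i j"
    using p by (auto intro!: bcontfun_eqI simp: is_projection_def)
  show "(\<Sum>j\<in>UNIV. pauli_magic U i j) = 1"
    by (rule bcontfun_eqI) (simp add: transported_projection_sum pauli_orthonormal_row)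
  show "(\<Sum>i\<in>UNIV. pauli_magic U i j) = 1"
    by (rule bcontfun_eqI) (simp add: transported_projection_sum pauli_orthonormal_column)
  assume "j \<noteq> k"
  then show "pauli_magic U i j * pauli_magic U i k = 0" "pauli_magic U j i * pauli_magic U k i = 0"
    by (auto intro!: bcontfun_eqI transported_projection_orthogonal
        simp: pauli_orthonormal_row pauli_orthonormal_column)
qed

theorem pauli_representation_hom: "star_hom (pauli_representation U)"
  and pauli_representation_generator: "pauli_representation U (universal_magic i j) = pauli_magic U i j"
  unfolding pauli_representation_def A_s_hom_def
  using theI'[OF A_s_universal[OF magic_unitary_pauli]] by auto

end

end

theory Submission
  imports Defs
begin

text \<open>
  Diagonalise the action of the Klein four-group on both indices of the magic unitary \<open>u\<close>.  The Fourier
  coefficients \<open>a\<^sub>g\<close> commute up to the signs of a bicharacter, and \<open>a\<^sub>g y = \<theta>\<^sub>g(y) a\<^sub>g\<close> for the automorphisms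
  \<open>\<theta>\<^sub>g\<close> that translate the indices.  Twisting left multiplication by \<open>a\<^sub>g\<close> with a suitable automorphism gives
  commuting operators \<open>X\<^sub>g\<close> on \<open>A\<^sub>s(4)\<close>, whose squares are left multiplications by central elements.

  Let \<open>\<pi>(y) = 0\<close> with \<open>y \<noteq> 0\<close>.  A homogeneous component of \<open>y\<close> is nonzero and is also killed by \<open>\<pi>\<close>; if \<open>c\<close>
  is that component, then \<open>z = c\<^sup>* c\<close> is self-adjoint, nonzero and fixed by all \<open>\<theta>\<^sub>g\<close>, so that it commutes with
  all \<open>X\<^sub>g\<close>.  Hence there are joint approximate eigenvectors \<open>w\<^sub>n\<close> for \<open>z\<close>, with a nonzero eigenvalue, and for all
  \<open>X\<^sub>g\<close>, with real eigenvalues \<open>\<mu>\<^sub>g\<close>.  The relations of a magic unitary turn \<open>\<mu>\<close> into the coefficients, in the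
  basis of operators \<open>\<eta> \<mapsto> c\<^sub>k \<eta> c\<^sub>l\<close>, of the projection onto a point \<open>x\<close> of \<open>SU2\<close>.  A polynomial \<open>q\<close> in the generators
  then acts on \<open>w\<^sub>n\<close> through the coefficients of \<open>\<pi>(q)(x)\<close>, which are small when \<open>q\<close> is close to \<open>z\<close>: a contradiction.
\<close>

section \<open>Approximate eigenvectors in C*-algebras\<close>

lemma scaleC_diff_right: "c *\<^sub>C (x - y) = c *\<^sub>C x - c *\<^sub>C (y::'a::cstar_algebra)"
  using scaleC_add_right[of c "x - y" y] by simp

lemma scaleC_sum_right: "c *\<^sub>C sum f S = (\<Sum>x\<in>S. c *\<^sub>C (f x::'a::cstar_algebra))"
  by (induction S rule: infinite_finite_induct) (simp_all add: scaleC_add_right)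

lemma scaleC_minus_left: "(- c) *\<^sub>C x = - (c *\<^sub>C (x::'a::cstar_algebra))"
  by (metis mult_minus1 scaleC_minus_one scaleC_scaleC)

lemma star_diff: "star (x - y) = star x - star (y::'a::cstar_algebra)"
  using star_add[of "x - y" y] by simp

lemma star_scaleR: "star (r *\<^sub>R x) = r *\<^sub>R star (x::'a::cstar_algebra)"
  by (simp add: scaleR_scaleC star_scaleC)

lemma star_sum: "star (sum f S) = (\<Sum>x\<in>S. star (f x::'a::cstar_algebra))"
  by (induction S rule: infinite_finite_induct) (simp_all add: star_add)

section \<open>Localising isometries and self-adjoint elements near a point of the spectrum\<close>

lemma norm_isometry_le_one:
  assumes "star v * v = (1::'a::cstar_algebra)"
  shows "norm v \<le> 1"
proof -
  have "(norm v)\<^sup>2 \<le> 1\<^sup>2" using cstar_identity[of v] norm_one_le[where 'a='a] assms by simp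
  then show ?thesis using power2_le_imp_le[of "norm v" 1] by simp
qed

text \<open>Both \<open>v * w\<close> and \<open>l *\<^sub>C w\<close> have the same square
  \<open>star w * w\<close>, so the squares of their half sum and half difference add up to
  \<open>star w * w\<close> already in the algebra. The C*-identity and the triangle inequality turn
  this into norms.\<close>

lemma parallelogram_unitary:
  fixes v w :: "'a::cstar_algebra"
  assumes v: "star v * v = 1" and l: "cmod l = 1"
  shows "(norm w)\<^sup>2 \<le> (norm ((1/2) *\<^sub>R (v * w + l *\<^sub>C w)))\<^sup>2 + (norm ((1/2) *\<^sub>R (v * w - l *\<^sub>C w)))\<^sup>2"
proof -
  let ?p = "(1/2) *\<^sub>R (v * w + l *\<^sub>C w)" and ?m = "(1/2) *\<^sub>R (v * w - l *\<^sub>C w)"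
  have vw: "star (v * w) * (v * w) = star w * w" by (metis mult.assoc mult_1_left star_mult v)
  have "l * cnj l = 1" using l by (metis complex_norm_square of_real_1 power_one)
  then have lw: "star (l *\<^sub>C w) * (l *\<^sub>C w) = star w * w"
    by (simp add: star_scaleC mult_scaleC_left mult_scaleC_right scaleC_scaleC)
  have "star ((1/2) *\<^sub>R (x + y)) * ((1/2) *\<^sub>R (x + y)) + star ((1/2) *\<^sub>R (x - y)) * ((1/2) *\<^sub>R (x - y))
      = (1/2) *\<^sub>R (star x * x + star y * y)" for x y :: 'a
    by (simp add: star_scaleR star_add star_diff algebra_simps flip: scaleR_add_left)
  from this[of "v * w" "l *\<^sub>C w"] have "star ?p * ?p + star ?m * ?m = (1/2) *\<^sub>R (star w * w + star w * w)"
    unfolding vw lw .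
  also have "\<dots> = star w * w" by (simp flip: scaleR_2)
  finally have "(norm w)\<^sup>2 = norm (star ?p * ?p + star ?m * ?m)" by (simp add: cstar_identity)
  also have "\<dots> \<le> norm (star ?p * ?p) + norm (star ?m * ?m)" by (rule norm_triangle_ineq)
  finally show ?thesis by (simp only: cstar_identity)
qed

text \<open>
  Induction over the squarings of \<open>v\<close>: factoring \<open>v\<^sup>2 - l\<^sup>2\<close> halves the error, while by the parallelogram
  identity one of the two factors shrinks \<open>w\<close> at most by \<open>sqrt 2\<close>.
\<close>

lemma unitary_localization:
  fixes v w :: "'a::cstar_algebra"
  assumes "star v * v = 1"
  shows "\<exists>l p. cmod l = 1 \<and> norm p \<le> 1 \<and> (\<forall>h. h * v = v * h \<longrightarrow> h * p = p * h) \<and>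
      norm w \<le> sqrt 2 ^ m * norm (p * w) \<and> norm (v * p - l *\<^sub>C p) \<le> 2 / 2 ^ m"
  using assms
proof (induction m arbitrary: v)
  case 0
  have "norm (v - 1) \<le> 1 + 1"
    by (rule order_trans[OF norm_triangle_ineq4]) (intro add_mono norm_isometry_le_one 0 norm_one_le)
  then show ?case by (intro exI[of _ 1]) (auto simp: norm_one_le)
next
  case (Suc m)
  have "star (v * v) * (v * v) = star v * (star v * v) * v" by (simp add: star_mult mult.assoc)
  then have "star (v * v) * (v * v) = 1" by (simp add: Suc.prems)
  from Suc.IH[OF this] obtain L q where q: "cmod L = 1" "norm q \<le> 1"
    "\<And>h. h * (v * v) = v * v * h \<Longrightarrow> h * q = q * h"
    "norm w \<le> sqrt 2 ^ m * norm (q * w)" "norm (v * v * q - L *\<^sub>C q) \<le> 2 / 2 ^ m"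
    by blast
  define l where "l = csqrt L"
  have l2: "l * l = L" and l: "cmod l = 1"
    using q(1) by (simp_all add: l_def norm_csqrt flip: power2_eq_square)
  have nv: "norm v \<le> 1" by (rule norm_isometry_le_one[OF Suc.prems])
  define P where "P e = (1/2) *\<^sub>R (v * q + e *\<^sub>C q)" for e
  have key: "(e = - l \<or> e = l) \<and> norm w \<le> sqrt 2 ^ Suc m * norm (P e * w) \<Longrightarrow>
     \<exists>l p. cmod l = 1 \<and> norm p \<le> 1 \<and> (\<forall>h. h * v = v * h \<longrightarrow> h * p = p * h) \<and>
      norm w \<le> sqrt 2 ^ Suc m * norm (p * w) \<and> norm (v * p - l *\<^sub>C p) \<le> 2 / 2 ^ Suc m" for e
  proof (intro exI conjI allI impI)
    assume e: "(e = - l \<or> e = l) \<and> norm w \<le> sqrt 2 ^ Suc m * norm (P e * w)"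
    then have e1: "cmod e = 1" "e * e = L" using l l2 by auto
    show "cmod e = 1" using e1 by simp
    have "norm (v * q + e *\<^sub>C q) \<le> norm v * norm q + norm q"
      by (rule order_trans[OF norm_triangle_ineq]) (simp add: norm_scaleC e1 norm_mult_ineq)
    also have "\<dots> \<le> 1 * 1 + 1" by (intro add_mono mult_mono nv q) auto
    finally show "norm (P e) \<le> 1" by (simp add: P_def)
    show "norm w \<le> sqrt 2 ^ Suc m * norm (P e * w)" using e by blast
    have "v * P e - e *\<^sub>C P e = (1/2) *\<^sub>R (v * v * q - (e * e) *\<^sub>C q)"
      by (simp add: P_def algebra_simps scaleC_add_right scaleC_scaleC mult_scaleC_right scaleC_minus_left
          scaleR_scaleC scaleC_diff_right)
    then show "norm (v * P e - e *\<^sub>C P e) \<le> 2 / 2 ^ Suc m" unfolding e1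
      using q(5) by simp
    fix h assume h: "h * v = v * h"
    have "h * (v * v) = v * v * h" by (metis h mult.assoc)
    then have "h * q = q * h" by (rule q)
    then show "h * P e = P e * h"
      by (simp add: P_def distrib_left distrib_right mult_scaleC_left mult_scaleC_right)
        (metis h mult.assoc)
  qed
  have sum_le: "(norm (q * w))\<^sup>2 \<le> (norm (P l * w))\<^sup>2 + (norm (P (- l) * w))\<^sup>2"
    using parallelogram_unitary[OF Suc.prems l, of "q * w"]
    by (simp add: P_def distrib_right left_diff_distrib mult_scaleC_left mult.assoc scaleC_minus_left)
  then obtain e where e: "e = - l \<or> e = l" "(norm (q * w))\<^sup>2 \<le> 2 * (norm (P e * w))\<^sup>2"
  proof (cases "(norm (P l * w))\<^sup>2 \<le> (norm (P (- l) * w))\<^sup>2")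
    case True
    have "(norm (q * w))\<^sup>2 \<le> 2 * (norm (P (- l) * w))\<^sup>2" using sum_le True by linarith
    then show thesis by (intro that[of "- l"]) simp_all
  next
    case False
    have "(norm (q * w))\<^sup>2 \<le> 2 * (norm (P l * w))\<^sup>2" using sum_le False by linarith
    then show thesis by (intro that[of l]) simp_all
  qed
  then have "sqrt ((norm (q * w))\<^sup>2) \<le> sqrt (2 * (norm (P e * w))\<^sup>2)" by (intro real_sqrt_le_mono)
  then have "norm (q * w) \<le> sqrt 2 * norm (P e * w)" by (simp add: real_sqrt_mult)
  then have "sqrt 2 ^ m * norm (q * w) \<le> sqrt 2 ^ m * (sqrt 2 * norm (P e * w))"
    by (rule mult_left_mono) simp
  then have "norm w \<le> sqrt 2 ^ Suc m * norm (P e * w)" using q(4) by (simp only: power_Suc mult_ac)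
  with e(1) show ?case by (intro key[of e]) simp
qed

text \<open>Here v = h + i sqrt(1 - h^2). The root is a power series in h^2, so it commutes with
  everything that commutes with h.\<close>

lemma selfadjoint_unitary:
  fixes h :: "'a::cstar_algebra"
  assumes h: "star h = h" "norm h < 1"
  obtains v where "star v * v = 1" "2 *\<^sub>R h = v + star v" "\<And>x. x * h = h * x \<Longrightarrow> x * v = v * x"
proof -
  have "norm (- (h * h)) < 1"
    using norm_mult_ineq[of h h] h mult_strict_mono'[of "norm h" 1 "norm h" 1] by simp
  moreover have "star (- (h * h)) = - (h * h)" by (simp add: star_minus star_mult h)
  ultimately obtain y where y: "y * y = 1 + - (h * h)" "star y = y"
      "\<And>x. x * (- (h * h)) = (- (h * h)) * x \<Longrightarrow> x * y = y * x"
    using cstar_sqrt_one_plus[of "- (h * h)"] by blast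
  have hy: "h * y = y * h" by (rule y) (simp add: mult.assoc)
  define v where "v = h + \<i> *\<^sub>C y"
  have sv: "star (h + \<i> *\<^sub>C y) = h - \<i> *\<^sub>C y" by (simp add: star_add star_scaleC h y scaleC_minus_left)
  show thesis
  proof (rule that[of v])
    show "star v * v = 1" unfolding v_def sv
      by (simp_all add: algebra_simps mult_scaleC_left mult_scaleC_right scaleC_scaleC hy y scaleC_minus_one
          scaleC_diff_right scaleC_add_right)
    show "2 *\<^sub>R h = v + star v" by (simp add: v_def sv scaleR_2)
    fix x assume x: "x * h = h * x"
    have "x * (h * h) = h * h * x" by (metis x mult.assoc)
    then have "x * y = y * x" by (intro y) simp
    then show "x * v = v * x"
      by (simp add: v_def distrib_left distrib_right x mult_scaleC_left mult_scaleC_right)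
  qed
qed

text \<open>The element p plays the role of a spectral projection of h near r. After scaling into
  the open unit ball, h is the real part of a v with \<open>star v * v = 1\<close>, and localising v
  near l localises h near a multiple of \<open>Re l\<close>. The error decays like 2^(-m), faster
  than the loss sqrt 2^(-m) in the size of \<open>p * w\<close>; all later limits rest on this
  gap.\<close>

lemma selfadjoint_localization:
  fixes h w :: "'a::cstar_algebra"
  assumes h: "star h = h"
  shows "\<exists>r p. \<bar>r\<bar> \<le> norm h + 1 \<and> norm p \<le> 1 \<and> (\<forall>x. x * h = h * x \<longrightarrow> x * p = p * x) \<and>
      norm w \<le> sqrt 2 ^ m * norm (p * w) \<and> norm (h * p - r *\<^sub>R p) \<le> 2 * (norm h + 1) / 2 ^ m"
proof -
  define K where "K = norm h + 1"
  have K: "K > 0" by (simp add: K_def add_nonneg_pos)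
  define k where "k = inverse K *\<^sub>R h"
  have hk: "h = K *\<^sub>R k" using K by (simp add: k_def)
  have "norm k < 1" using K by (simp add: k_def K_def field_simps)
  moreover have "star k = k" by (simp add: k_def star_scaleR h)
  ultimately obtain v where v: "star v * v = 1" "2 *\<^sub>R k = v + star v"
    "\<And>x. x * k = k * x \<Longrightarrow> x * v = v * x" using selfadjoint_unitary by metis
  obtain l p where p: "cmod l = 1" "norm p \<le> 1" "\<And>x. x * v = v * x \<Longrightarrow> x * p = p * x"
    "norm w \<le> sqrt 2 ^ m * norm (p * w)" "norm (v * p - l *\<^sub>C p) \<le> 2 / 2 ^ m"
    using unitary_localization[OF v(1), of w m] by blast
  \<comment> \<open>Multiplying the error E by \<open>star v\<close> shows that
    \<open>star v * p\<close> is close to \<open>cnj l *\<^sub>C p\<close>. Adding this to the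
    estimate for \<open>v * p\<close> gives the estimate for
    \<open>2 *\<^sub>R k = v + star v\<close>.\<close>
  define E where "E = v * p - l *\<^sub>C p"
  have ll: "cnj l * l = 1" using p(1) by (metis complex_norm_square mult.commute of_real_1 power_one)
  have "star v * E = p - l *\<^sub>C (star v * p)"
    using v(1) by (simp add: E_def right_diff_distrib mult_scaleC_right) (metis mult.assoc mult_1_left)
  then have "cnj l *\<^sub>C (star v * E) = cnj l *\<^sub>C p - star v * p"
    by (simp add: scaleC_diff_right scaleC_scaleC ll)
  then have eq: "2 *\<^sub>R (k * p - Re l *\<^sub>R p) = E - cnj l *\<^sub>C (star v * E)"
  proof -
    have "(2 * Re l) *\<^sub>R p = l *\<^sub>C p + cnj l *\<^sub>C p"
      by (simp add: scaleR_scaleC complex_add_cnj flip: scaleC_add_left)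
    moreover have "2 *\<^sub>R (k * p) = v * p + star v * p"
      by (metis distrib_right mult_scaleR_left v(2))
    ultimately show ?thesis
      using \<open>cnj l *\<^sub>C (star v * E) = _\<close> by (simp add: E_def scaleR_diff_right)
  qed
  have "norm (star v * E) \<le> 1 * norm E"
    by (rule order_trans[OF norm_mult_ineq mult_right_mono]) (simp_all add: norm_isometry_le_one v)
  then have "norm (E - cnj l *\<^sub>C (star v * E)) \<le> norm E + norm E"
    by (intro order_trans[OF norm_triangle_ineq4]) (simp add: norm_scaleC p)
  then have "norm (2 *\<^sub>R (k * p - Re l *\<^sub>R p)) \<le> norm E + norm E" unfolding eq .
  then have b: "norm (k * p - Re l *\<^sub>R p) \<le> 2 / 2 ^ m" using p(5) by (simp add: E_def)
  have "h * p - (K * Re l) *\<^sub>R p = K *\<^sub>R (k * p - Re l *\<^sub>R p)"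
    by (simp add: hk scaleR_diff_right)
  then have "norm (h * p - (K * Re l) *\<^sub>R p) = K * norm (k * p - Re l *\<^sub>R p)" using K by simp
  also have "\<dots> \<le> K * (2 / 2 ^ m)" using b K by (intro mult_left_mono) auto
  finally have 1: "norm (h * p - (K * Re l) *\<^sub>R p) \<le> 2 * K / 2 ^ m" by (simp add: mult.commute)
  have "\<bar>K * Re l\<bar> \<le> K" using K abs_Re_le_cmod[of l] p(1) by (simp add: abs_mult mult_left_le)
  moreover have "x * p = p * x" if "x * h = h * x" for x
    using that K by (intro p v) (simp add: k_def)
  ultimately show ?thesis using 1 p(2,4) unfolding K_def by blast
qed

text \<open>For exponents that are powers of two this is the C*-identity iterated. Any other power
  is a factor of such a one, and the cofactor has norm at most 1.\<close>

lemma norm_power_selfadjoint: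
  fixes z :: "'a::cstar_algebra"
  assumes z: "star z = z" "norm z = 1"
  shows "norm (z ^ n) = 1"
proof -
  have two: "norm (z ^ (2 ^ k)) = 1" for k
  proof (induction k)
    case (Suc k)
    have "star (z ^ 2 ^ k) * z ^ 2 ^ k = z ^ 2 ^ Suc k"
      by (simp add: star_power z mult_2 flip: power_add)
    then show ?case using cstar_identity[of "z ^ 2 ^ k"] Suc by simp
  qed (simp add: z)
  obtain k where k: "n < 2 ^ k" using less_exp by blast
  then have "z ^ 2 ^ k = z ^ n * z ^ (2 ^ k - n)" by (simp flip: power_add)
  then have "1 \<le> norm (z ^ n) * norm (z ^ (2 ^ k - n))" using two[of k] norm_mult_ineq by metis
  also have "\<dots> \<le> norm (z ^ n) * 1"
    using norm_power_le[of z "2 ^ k - n"] z by (intro mult_left_mono) simp_all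
  finally show ?thesis using norm_power_le[of z n] z by simp
qed

section \<open>Approximate eigenvectors, obtained for one operator after another\<close>

lemma sqrt_two_power_tendsto: "(\<lambda>m. C * sqrt 2 ^ m / 2 ^ m) \<longlonglongrightarrow> (0::real)"
proof -
  have "(\<lambda>m. C * (sqrt 2 / 2) ^ m) \<longlonglongrightarrow> C * 0"
    by (intro tendsto_mult tendsto_const LIMSEQ_realpow_zero) (auto simp: real_less_lsqrt sqrt2_less_2)
  then show ?thesis by (simp add: power_divide)
qed

text \<open>Localising the vector \<open>z ^ m\<close> rather than 1 keeps the eigenvalue away from
  0: near a small spectral value the power \<open>z ^ m\<close> would be too small to satisfy the
  lower bound on \<open>p * z ^ m\<close>.\<close>

lemma approx_eigenvalue_initial:
  fixes z :: "'a::cstar_algebra"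
  assumes z: "star z = z" "norm z = 1"
  shows "\<exists>w r. (\<forall>n. norm (w n) = 1) \<and> \<bar>r\<bar> \<ge> 1 / 2 \<and> (\<lambda>n::nat. z * w n - r *\<^sub>R w n) \<longlonglongrightarrow> 0"
proof -
  have "\<exists>r p. \<bar>r\<bar> \<le> 2 \<and> norm p \<le> 1 \<and> z * p = p * z \<and>
      1 \<le> sqrt 2 ^ m * norm (p * z ^ m) \<and> norm (z * p - r *\<^sub>R p) \<le> 4 / 2 ^ m" for m
    using selfadjoint_localization[OF z(1), of "z ^ m" m] norm_power_selfadjoint[OF z, of m] z
    by (auto)
  then obtain \<rho> p where p: "\<And>m. \<bar>\<rho> m\<bar> \<le> 2" "\<And>m. norm (p m) \<le> 1" "\<And>m. z * p m = p m * z"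
      "\<And>m. 1 \<le> sqrt 2 ^ m * norm (p m * z ^ m)" "\<And>m. norm (z * p m - \<rho> m *\<^sub>R p m) \<le> 4 / 2 ^ m"
    by metis
  \<comment> \<open>If the eigenvalue were below 1/2, the norm of \<open>p m * z ^ m\<close> would
    be at most 9 / 2^m, while it is at least 1 / sqrt 2^m. This fails for m at least 8, because sqrt
    2^8 = 16 exceeds 9.\<close>
  have big: "\<bar>\<rho> m\<bar> \<ge> 1 / 2" if m: "m \<ge> 8" for m
  proof (rule ccontr)
    assume "\<not> \<bar>\<rho> m\<bar> \<ge> 1 / 2"
    then have small: "\<bar>\<rho> m\<bar> \<le> 1 / 2" by simp
    have pz: "p m * z ^ j = z ^ j * p m" for j
      by (induction j) (simp_all, metis mult.assoc p(3))
    \<comment> \<open>The constant 8 / 2^m is the fixed point of the recursion t = 4 / 2^m + t / 2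
      that the induction step produces.\<close>
    have "norm (z ^ j * p m) \<le> (1 / 2) ^ j + 8 / 2 ^ m" for j
    proof (induction j)
      case 0
      show ?case using p(2)[of m] by (simp add: add_nonneg_nonneg order_trans)
    next
      case (Suc j)
      have "z ^ Suc j * p m = z ^ j * (z * p m - \<rho> m *\<^sub>R p m) + \<rho> m *\<^sub>R (z ^ j * p m)"
        by (simp add: right_diff_distrib power_Suc2 mult.assoc del: power_Suc)
      also have "norm \<dots> \<le> norm (z ^ j) * norm (z * p m - \<rho> m *\<^sub>R p m) + \<bar>\<rho> m\<bar> * norm (z ^ j * p m)"
        by (rule order_trans[OF norm_triangle_ineq]) (simp add: norm_mult_ineq)
      also have "\<dots> \<le> 1 * (4 / 2 ^ m) + (1 / 2) * ((1 / 2) ^ j + 8 / 2 ^ m)"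
        using p(5)[of m] small Suc norm_power_selfadjoint[OF z, of j]
        by (intro add_mono mult_mono) auto
      also have "\<dots> = (1 / 2) ^ Suc j + 8 / 2 ^ m" by (simp add: field_simps)
      finally show ?case .
    qed
    from this[of m] have "norm (p m * z ^ m) \<le> 9 / 2 ^ m"
      by (simp add: pz power_one_over field_simps)
    then have "1 \<le> sqrt 2 ^ m * (9 / 2 ^ m)"
      using p(4)[of m] by (meson mult_left_mono order_trans real_sqrt_ge_zero zero_le_numeral zero_le_power)
    also have "\<dots> = 9 / sqrt 2 ^ m"
    proof -
      have "(2::real) ^ m = sqrt 2 ^ m * sqrt 2 ^ m" by (simp flip: power_mult_distrib)
      then show ?thesis by simp
    qed
    finally have "sqrt 2 ^ m \<le> 9" by (simp add: field_simps)
    moreover have "sqrt 2 ^ 8 \<le> sqrt 2 ^ m" using m by (intro power_increasing) auto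
    moreover have "sqrt 2 ^ 8 = (sqrt 2 ^ 2) ^ 4" by (simp only: flip: power_mult) simp
    ultimately show False by simp
  qed
  have "bounded (range \<rho>)" using p(1) by (intro boundedI[of _ 2]) auto
  then obtain r s where rs: "strict_mono s" "(\<rho> \<circ> s) \<longlonglongrightarrow> r"
    using bounded_imp_convergent_subsequence by blast
  \<comment> \<open>Normalising costs a factor of at most sqrt 2^m, which the error 4 / 2^m
    absorbs.\<close>
  define w where "w m = sgn (p m * z ^ m)" for m
  have nz: "p m * z ^ m \<noteq> 0" for m using p(4)[of m] by auto
  have pos: "inverse (norm (p m * z ^ m)) \<le> sqrt 2 ^ m" for m
    using p(4)[of m] nz[of m] by (simp add: field_simps)
  have "norm (z * w m - \<rho> m *\<^sub>R w m) \<le> 4 * sqrt 2 ^ m / 2 ^ m" for m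
  proof -
    have "z * w m - \<rho> m *\<^sub>R w m = inverse (norm (p m * z ^ m)) *\<^sub>R ((z * p m - \<rho> m *\<^sub>R p m) * z ^ m)"
      by (simp add: w_def sgn_div_norm left_diff_distrib scaleR_diff_right mult.assoc)
    also have "norm \<dots> \<le> inverse (norm (p m * z ^ m)) * (norm (z * p m - \<rho> m *\<^sub>R p m) * norm (z ^ m))"
      by (simp add: norm_mult_ineq mult_left_mono)
    also have "\<dots> \<le> sqrt 2 ^ m * (4 / 2 ^ m * 1)"
      using pos p(5) norm_power_selfadjoint[OF z, of m] by (intro mult_mono) auto
    finally show ?thesis by (simp add: field_simps)
  qed
  then have lim: "(\<lambda>m. z * w m - \<rho> m *\<^sub>R w m) \<longlonglongrightarrow> 0"
    by (intro Lim_null_comparison[OF _ sqrt_two_power_tendsto[of 4]]) auto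
  then have 1: "(\<lambda>m. z * w (s m) - \<rho> (s m) *\<^sub>R w (s m)) \<longlonglongrightarrow> 0"
    using LIMSEQ_subseq_LIMSEQ[OF lim rs(1)] by (simp add: o_def)
  have w1: "norm (w m) = 1" for m using nz by (simp add: w_def norm_sgn)
  have "(\<lambda>m. (\<rho> (s m) - r) *\<^sub>R w (s m)) \<longlonglongrightarrow> 0"
  proof (rule tendsto_norm_zero_cancel)
    have "(\<lambda>m. \<rho> (s m) - r) \<longlonglongrightarrow> 0" using rs(2) by (simp add: o_def LIM_zero)
    then show "(\<lambda>m. norm ((\<rho> (s m) - r) *\<^sub>R w (s m))) \<longlonglongrightarrow> 0"
      unfolding norm_scaleR w1 mult_1_right by (rule tendsto_rabs_zero)
  qed
  from tendsto_add[OF 1 this] have "(\<lambda>m. z * w (s m) - r *\<^sub>R w (s m)) \<longlonglongrightarrow> 0"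
    by (simp add: scaleR_left_diff_distrib)
  moreover have "\<bar>r\<bar> \<ge> 1 / 2"
  proof (rule LIMSEQ_le_const)
    show "(\<lambda>m. \<bar>\<rho> (s m)\<bar>) \<longlonglongrightarrow> \<bar>r\<bar>" using rs(2) by (auto simp: o_def intro: tendsto_rabs)
    show "\<exists>N. \<forall>n\<ge>N. 1 / 2 \<le> \<bar>\<rho> (s n)\<bar>"
      using big seq_suble[OF rs(1)] by (intro exI[of _ 8]) (meson order_trans)
  qed
  ultimately show ?thesis using w1 by (intro exI[of _ "\<lambda>m. w (s m)"] exI[of _ r]) auto
qed

text \<open>The localising element p for h commutes with the elements already treated, so replacing
  the vectors \<open>w n\<close> by normalised \<open>p * w n\<close> preserves the old eigenvalues.
  A limit point of the approximate eigenvalues of h serves as r.\<close>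

lemma approx_eigenvalue_selfadjoint:
  fixes h :: "'a::cstar_algebra" and F :: "('a \<times> real) set"
  assumes h: "star h = h" and F: "finite F" "\<And>c \<gamma>. (c, \<gamma>) \<in> F \<Longrightarrow> c * h = h * c"
    and w: "\<And>n::nat. norm (w n) = 1" "\<And>c \<gamma>. (c, \<gamma>) \<in> F \<Longrightarrow> (\<lambda>n. c * w n - \<gamma> *\<^sub>R w n) \<longlonglongrightarrow> 0"
  shows "\<exists>w' r. (\<forall>n::nat. norm (w' n) = 1) \<and> (\<forall>(c, \<gamma>)\<in>insert (h, r) F. (\<lambda>n. c * w' n - \<gamma> *\<^sub>R w' n) \<longlonglongrightarrow> 0)"
proof -
  define K where "K = norm h + 1"
  \<comment> \<open>Normalisation may enlarge the old errors by sqrt 2^m, so the vector used at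
    stage m is taken far enough out for these errors to be below 2^(-m).\<close>
  have "\<exists>n. \<forall>(c, \<gamma>)\<in>F. norm (c * w n - \<gamma> *\<^sub>R w n) < 1 / 2 ^ m" for m
  proof -
    have "\<forall>\<^sub>F n in sequentially. \<forall>x\<in>F. norm (fst x * w n - snd x *\<^sub>R w n) < 1 / 2 ^ m"
    proof (intro eventually_ball_finite ballI F)
      fix x assume "x \<in> F"
      then have "(\<lambda>n. fst x * w n - snd x *\<^sub>R w n) \<longlonglongrightarrow> 0" using w(2)[of "fst x" "snd x"] by simp
      then show "\<forall>\<^sub>F n in sequentially. norm (fst x * w n - snd x *\<^sub>R w n) < 1 / 2 ^ m"
        by (auto simp: tendsto_iff dist_norm)
    qed
    from eventually_happens[OF this] show ?thesis by (auto simp: case_prod_beta)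
  qed
  then obtain k where k: "\<And>m c \<gamma>. (c, \<gamma>) \<in> F \<Longrightarrow> norm (c * w (k m) - \<gamma> *\<^sub>R w (k m)) < 1 / 2 ^ m"
    by (metis (no_types, lifting) case_prodD)
  have "\<exists>r p. \<bar>r\<bar> \<le> K \<and> norm p \<le> 1 \<and> (\<forall>x. x * h = h * x \<longrightarrow> x * p = p * x) \<and>
      1 \<le> sqrt 2 ^ m * norm (p * w (k m)) \<and> norm (h * p - r *\<^sub>R p) \<le> 2 * K / 2 ^ m" for m
    using selfadjoint_localization[OF h, of "w (k m)" m] w(1) unfolding K_def by metis
  then obtain \<rho> p where p: "\<And>m. \<bar>\<rho> m\<bar> \<le> K" "\<And>m. norm (p m) \<le> 1" "\<And>m x. x * h = h * x \<Longrightarrow> x * p m = p m * x"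
      "\<And>m. 1 \<le> sqrt 2 ^ m * norm (p m * w (k m))" "\<And>m. norm (h * p m - \<rho> m *\<^sub>R p m) \<le> 2 * K / 2 ^ m"
    by metis
  have "bounded (range \<rho>)" using p(1) by (intro boundedI[of _ K]) auto
  then obtain r s where rs: "strict_mono s" "(\<rho> \<circ> s) \<longlonglongrightarrow> r"
    using bounded_imp_convergent_subsequence by blast
  define w' where "w' m = sgn (p m * w (k m))" for m
  have nz: "p m * w (k m) \<noteq> 0" for m using p(4)[of m] by auto
  have pos: "inverse (norm (p m * w (k m))) \<le> sqrt 2 ^ m" for m
    using p(4)[of m] nz[of m] by (simp add: field_simps)
  have w1: "norm (w' m) = 1" for m using nz by (simp add: w'_def norm_sgn)
  have "norm (h * w' m - \<rho> m *\<^sub>R w' m) \<le> (2 * K) * sqrt 2 ^ m / 2 ^ m" for m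
  proof -
    have "h * w' m - \<rho> m *\<^sub>R w' m = inverse (norm (p m * w (k m))) *\<^sub>R ((h * p m - \<rho> m *\<^sub>R p m) * w (k m))"
      by (simp add: w'_def sgn_div_norm left_diff_distrib scaleR_diff_right mult.assoc)
    also have "norm \<dots> \<le> inverse (norm (p m * w (k m))) * (norm (h * p m - \<rho> m *\<^sub>R p m) * norm (w (k m)))"
      by (simp add: norm_mult_ineq mult_left_mono)
    also have "\<dots> \<le> sqrt 2 ^ m * (2 * K / 2 ^ m * 1)"
      using pos p(5) w(1) by (intro mult_mono) (auto simp: K_def)
    finally show ?thesis by (simp add: field_simps)
  qed
  then have lim: "(\<lambda>m. h * w' m - \<rho> m *\<^sub>R w' m) \<longlonglongrightarrow> 0"
    by (intro Lim_null_comparison[OF _ sqrt_two_power_tendsto[of "2 * K"]]) auto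
  then have 1: "(\<lambda>m. h * w' (s m) - \<rho> (s m) *\<^sub>R w' (s m)) \<longlonglongrightarrow> 0"
    using LIMSEQ_subseq_LIMSEQ[OF lim rs(1)] by (simp add: o_def)
  have "(\<lambda>m. (\<rho> (s m) - r) *\<^sub>R w' (s m)) \<longlonglongrightarrow> 0"
  proof (rule tendsto_norm_zero_cancel)
    have "(\<lambda>m. \<rho> (s m) - r) \<longlonglongrightarrow> 0" using rs(2) by (simp add: o_def LIM_zero)
    then show "(\<lambda>m. norm ((\<rho> (s m) - r) *\<^sub>R w' (s m))) \<longlonglongrightarrow> 0"
      unfolding norm_scaleR w1 mult_1_right by (rule tendsto_rabs_zero)
  qed
  from tendsto_add[OF 1 this] have 2: "(\<lambda>m. h * w' (s m) - r *\<^sub>R w' (s m)) \<longlonglongrightarrow> 0"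
    by (simp add: scaleR_left_diff_distrib)
  have 3: "(\<lambda>m. c * w' (s m) - \<gamma> *\<^sub>R w' (s m)) \<longlonglongrightarrow> 0" if c: "(c, \<gamma>) \<in> F" for c \<gamma>
  proof -
    have "norm (c * w' m - \<gamma> *\<^sub>R w' m) \<le> 1 * sqrt 2 ^ m / 2 ^ m" for m
    proof -
      have "c * p m = p m * c" using F(2)[OF c] by (rule p)
      then have "c * w' m - \<gamma> *\<^sub>R w' m = inverse (norm (p m * w (k m))) *\<^sub>R (p m * (c * w (k m) - \<gamma> *\<^sub>R w (k m)))"
        by (simp add: w'_def sgn_div_norm right_diff_distrib scaleR_diff_right flip: mult.assoc)
      also have "norm \<dots> \<le> inverse (norm (p m * w (k m))) * (norm (p m) * norm (c * w (k m) - \<gamma> *\<^sub>R w (k m)))"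
        by (simp add: norm_mult_ineq mult_left_mono)
      also have "\<dots> \<le> sqrt 2 ^ m * (1 * (1 / 2 ^ m))"
        using pos p(2) k[OF c, of m] by (intro mult_mono) auto
      finally show ?thesis by simp
    qed
    then have lim: "(\<lambda>m. c * w' m - \<gamma> *\<^sub>R w' m) \<longlonglongrightarrow> 0"
      by (intro Lim_null_comparison[OF _ sqrt_two_power_tendsto[of 1]]) auto
    show ?thesis using LIMSEQ_subseq_LIMSEQ[OF lim rs(1)] by (simp add: o_def)
  qed
  show ?thesis using w1 2 3 by (intro exI[of _ "\<lambda>m. w' (s m)"] exI[of _ r]) auto
qed

text \<open>
  If \<open>X w\<^sub>n - r w\<^sub>n\<close> does not tend to zero, a normalised subsequence of it serves for the eigenvalue \<open>- r\<close>.
\<close>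

lemma approx_eigenvalue_root:
  fixes X :: "'a::real_normed_vector \<Rightarrow> 'a" and F :: "(('a \<Rightarrow> 'a) \<times> real) set"
  assumes X: "bounded_linear X"
    and F: "\<And>f \<gamma>. (f, \<gamma>) \<in> F \<Longrightarrow> bounded_linear f" "\<And>f \<gamma> v. (f, \<gamma>) \<in> F \<Longrightarrow> f (X v) = X (f v)"
    and w: "\<And>n::nat. norm (w n) = 1" "\<And>f \<gamma>. (f, \<gamma>) \<in> F \<Longrightarrow> (\<lambda>n. f (w n) - \<gamma> *\<^sub>R w n) \<longlonglongrightarrow> 0"
      "(\<lambda>n. X (X (w n)) - (r * r) *\<^sub>R w n) \<longlonglongrightarrow> 0"
  shows "\<exists>w' l. (\<forall>n::nat. norm (w' n) = 1) \<and> (\<forall>(f, \<gamma>)\<in>insert (X, l) F. (\<lambda>n. f (w' n) - \<gamma> *\<^sub>R w' n) \<longlonglongrightarrow> 0)"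
proof (cases "(\<lambda>n. X (w n) - r *\<^sub>R w n) \<longlonglongrightarrow> 0")
  case True
  then show ?thesis using w by (intro exI[of _ w] exI[of _ r]) auto
next
  case False
  define y where "y n = X (w n) - r *\<^sub>R w n" for n
  obtain e where e: "e > 0" "\<And>N. \<exists>n\<ge>N. norm (y n) \<ge> e"
    using False by (auto simp: LIMSEQ_def y_def not_less)
  have "\<exists>s. strict_mono (s :: nat \<Rightarrow> nat) \<and> (\<forall>n. norm (y (s n)) \<ge> e)"
    using infinite_enumerate[of "{n. norm (y n) \<ge> e}"] e(2)
    by (auto simp: infinite_nat_iff_unbounded_le)
  then obtain s :: "nat \<Rightarrow> nat" where s: "strict_mono s" "\<And>n. norm (y (s n)) \<ge> e" by blast
  define w' where "w' n = sgn (y (s n))" for n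
  interpret X: bounded_linear X by fact
  have nz: "y (s n) \<noteq> 0" for n using s(2)[of n] e(1) by auto
  have w1: "norm (w' n) = 1" for n using nz by (simp add: w'_def norm_sgn)
  have conv: "(\<lambda>n. f (w' n) - \<gamma> *\<^sub>R w' n) \<longlonglongrightarrow> 0"
    if f: "bounded_linear f" and l: "(\<lambda>n. f (y n) - \<gamma> *\<^sub>R y n) \<longlonglongrightarrow> 0" for f \<gamma>
  proof (rule Lim_null_comparison)
    have "(\<lambda>n. f (y (s n)) - \<gamma> *\<^sub>R y (s n)) \<longlonglongrightarrow> 0"
      using LIMSEQ_subseq_LIMSEQ[OF l s(1)] by (simp add: o_def)
    then show "(\<lambda>n. inverse e * norm (f (y (s n)) - \<gamma> *\<^sub>R y (s n))) \<longlonglongrightarrow> 0"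
      by (intro tendsto_mult_right_zero tendsto_norm_zero)
    have "norm (f (w' n) - \<gamma> *\<^sub>R w' n) \<le> inverse e * norm (f (y (s n)) - \<gamma> *\<^sub>R y (s n))" for n
    proof -
      have "f (w' n) - \<gamma> *\<^sub>R w' n = inverse (norm (y (s n))) *\<^sub>R (f (y (s n)) - \<gamma> *\<^sub>R y (s n))"
        by (simp add: w'_def sgn_div_norm scaleR_diff_right linear_simps(5)[OF f])
      moreover have "inverse (norm (y (s n))) \<le> inverse e" using s(2)[of n] e(1) by (rule le_imp_inverse_le)
      ultimately show ?thesis by (simp add: mult_right_mono)
    qed
    then show "\<forall>\<^sub>F n in sequentially. norm (f (w' n) - \<gamma> *\<^sub>R w' n) \<le> inverse e * norm (f (y (s n)) - \<gamma> *\<^sub>R y (s n))"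
      by simp
  qed
  \<comment> \<open>This is the factorisation (X + r)(X - r) = X^2 - r^2.\<close>
  have "X (y n) - (- r) *\<^sub>R y n = X (X (w n)) - (r * r) *\<^sub>R w n" for n
    by (simp add: y_def X.diff X.scaleR scaleR_diff_right)
  then have 1: "(\<lambda>n. X (w' n) - (- r) *\<^sub>R w' n) \<longlonglongrightarrow> 0"
    using w(3) by (intro conv X) simp
  have 2: "(\<lambda>n. f (w' n) - \<gamma> *\<^sub>R w' n) \<longlonglongrightarrow> 0" if f: "(f, \<gamma>) \<in> F" for f \<gamma>
  proof (rule conv[OF F(1)[OF f]])
    have "f (y n) - \<gamma> *\<^sub>R y n = X (f (w n) - \<gamma> *\<^sub>R w n) - r *\<^sub>R (f (w n) - \<gamma> *\<^sub>R w n)" for n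
      by (simp add: y_def X.diff X.scaleR F(2)[OF f] linear_simps[OF F(1)[OF f]] algebra_simps)
    moreover have "(\<lambda>n. X (f (w n) - \<gamma> *\<^sub>R w n) - r *\<^sub>R (f (w n) - \<gamma> *\<^sub>R w n)) \<longlonglongrightarrow> X 0 - r *\<^sub>R 0"
      by (intro tendsto_diff tendsto_scaleR tendsto_const X.tendsto w(2)[OF f])
    ultimately show "(\<lambda>n. f (y n) - \<gamma> *\<^sub>R y n) \<longlonglongrightarrow> 0" by (simp add: X.zero)
  qed
  show ?thesis using w1 1 2 by (intro exI[of _ w'] exI[of _ "- r"]) auto
qed

section \<open>The Klein four-group and the Pauli signs\<close>

text \<open>
  The indices are treated as the Klein four-group formed by the Pauli matrices modulo sign, with unit 1.
  The sign in a product of two Pauli matrices is \<open>ksign\<close> (see \<open>pauli_mult\<close>), which for this choice of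
  representatives is multiplicative in both arguments; \<open>kcomm\<close> is the sign of a commutator.
\<close>

definition kmul :: "4 \<Rightarrow> 4 \<Rightarrow> 4" where
  "kmul i j = (if i = 1 then j else if j = 1 then i else if i = j then 1
     else if i \<noteq> 2 \<and> j \<noteq> 2 then 2 else if i \<noteq> 3 \<and> j \<noteq> 3 then 3 else 4)"

definition ksign :: "4 \<Rightarrow> 4 \<Rightarrow> real" where
  "ksign i j = (if i = 1 \<or> j = 1 \<or> (i = 2 \<and> j = 3) \<or> (i = 3 \<and> j = 4) \<or> (i = 4 \<and> j = 2) then 1 else - 1)"

definition kcomm :: "4 \<Rightarrow> 4 \<Rightarrow> real" where
  "kcomm i j = (if i = 1 \<or> j = 1 \<or> i = j then 1 else - 1)"

lemma kmul_assoc: "kmul (kmul i j) k = kmul i (kmul j k)"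
proof -
  have "\<forall>i j k. kmul (kmul i j) k = kmul i (kmul j k)"
    by (simp add: forall_4 kmul_def)
  then show ?thesis by blast
qed

lemma kmul_commute: "kmul i j = kmul j i"
  by (auto simp: kmul_def)

lemma kmul_self [simp]: "kmul i i = 1" and kmul_one [simp]: "kmul 1 i = i" "kmul i 1 = i"
  by (auto simp: kmul_def)

lemma kcomm_kmul: "kcomm (kmul i j) k = kcomm i k * kcomm j k"
proof -
  have "\<forall>i j k. kcomm (kmul i j) k = kcomm i k * kcomm j k"
    by (simp add: forall_4 kmul_def kcomm_def)
  then show ?thesis by blast
qed

lemma kcomm_commute: "kcomm i j = kcomm j i"
  by (auto simp: kcomm_def)

lemma kcomm_kmul_right: "kcomm k (kmul i j) = kcomm k i * kcomm k j"
  using kcomm_kmul[of i j k] by (simp add: kcomm_commute[of k])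

lemma kcomm_one [simp]: "kcomm 1 i = 1" "kcomm i 1 = 1"
  by (auto simp: kcomm_def)

lemma kcomm_sum: "(\<Sum>i\<in>UNIV. kcomm i j) = (if j = 1 then 4 else 0)"
proof -
  have "\<forall>j. (\<Sum>i\<in>UNIV. kcomm i j) = (if j = 1 then 4 else 0)"
    by (simp add: forall_4 kcomm_def sum_4)
  then show ?thesis by blast
qed

lemma ksign_kmul: "ksign (kmul i j) k = ksign i k * ksign j k" "ksign k (kmul i j) = ksign k i * ksign k j"
proof -
  have "\<forall>i j k. ksign (kmul i j) k = ksign i k * ksign j k \<and> ksign k (kmul i j) = ksign k i * ksign k j"
    by (simp add: forall_4 kmul_def ksign_def)
  then show "ksign (kmul i j) k = ksign i k * ksign j k" "ksign k (kmul i j) = ksign k i * ksign k j" by blast+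
qed

lemma ksign_swap: "ksign i j * ksign j i = kcomm i j"
proof -
  have "\<forall>i j. ksign i j * ksign j i = kcomm i j"
    by (simp add: forall_4 ksign_def kcomm_def)
  then show ?thesis by blast
qed

lemma ksign_one [simp]: "ksign 1 i = 1" "ksign i 1 = 1"
  by (auto simp: ksign_def)

lemma ksign_self: "i \<noteq> 1 \<Longrightarrow> ksign i i = - 1"
proof -
  have "\<forall>i. i \<noteq> 1 \<longrightarrow> ksign i i = - 1"
    by (simp add: forall_4 ksign_def)
  then show "i \<noteq> 1 \<Longrightarrow> ksign i i = - 1" by blast
qed

text \<open>
  Since \<open>kcomm\<close> is nondegenerate, the characters \<open>ksign i\<close> and \<open>\<lambda>j. ksign j i\<close> have the form \<open>kcomm k\<close>.
\<close>

definition klchar :: "4 \<Rightarrow> 4" where "klchar i = (if i = 1 then 1 else if i = 2 then 3 else if i = 3 then 4 else 2)"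
definition krchar :: "4 \<Rightarrow> 4" where "krchar i = (if i = 1 then 1 else if i = 2 then 4 else if i = 3 then 2 else 3)"

lemma klchar: "kcomm (klchar i) j = ksign i j" and krchar: "kcomm (krchar i) j = ksign j i"
  and klchar_kmul: "klchar (kmul i j) = kmul (klchar i) (klchar j)"
  and krchar_kmul: "krchar (kmul i j) = kmul (krchar i) (krchar j)"
proof -
  have "\<forall>i j. kcomm (klchar i) j = ksign i j \<and> kcomm (krchar i) j = ksign j i \<and>
    klchar (kmul i j) = kmul (klchar i) (klchar j) \<and> krchar (kmul i j) = kmul (krchar i) (krchar j)"
    by (simp add: forall_4 ksign_def kcomm_def klchar_def krchar_def kmul_def)
  then show "kcomm (klchar i) j = ksign i j" "kcomm (krchar i) j = ksign j i"
     "klchar (kmul i j) = kmul (klchar i) (klchar j)" "krchar (kmul i j) = kmul (krchar i) (krchar j)" by blast+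
qed

text \<open>Any two distinct nontrivial elements generate the Klein four-group; this splits sums
  over all indices into four terms.\<close>

lemma UNIV_kmul: "p \<noteq> 1 \<Longrightarrow> q \<noteq> 1 \<Longrightarrow> p \<noteq> q \<Longrightarrow> UNIV = {1, p, q, kmul p q}"
proof -
  have "\<forall>p q. p \<noteq> 1 \<longrightarrow> q \<noteq> 1 \<longrightarrow> p \<noteq> q \<longrightarrow> (\<forall>x. x = 1 \<or> x = p \<or> x = q \<or> x = kmul p q)"
    by (simp add: forall_4 kmul_def)
  then show "p \<noteq> 1 \<Longrightarrow> q \<noteq> 1 \<Longrightarrow> p \<noteq> q \<Longrightarrow> UNIV = {1, p, q, kmul p q}" by blast
qed

lemma pauli_mult: "pauli i ** pauli j = ksign i j *\<^sub>R pauli (kmul i j)"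
proof -
  have "\<forall>i j. pauli i ** pauli j = ksign i j *\<^sub>R pauli (kmul i j)"
    by (simp add: forall_4 pauli_def ksign_def kmul_def matrix_matrix_mult_def sum_2 vec_eq_iff forall_2)
  then show ?thesis by blast
qed

text \<open>
  The arguments of the second factor of \<open>gsign\<close> are reversed because the second index acts by
  multiplication from the right.
\<close>

definition gmul :: "4 \<times> 4 \<Rightarrow> 4 \<times> 4 \<Rightarrow> 4 \<times> 4" where
  "gmul g h = (kmul (fst g) (fst h), kmul (snd g) (snd h))"
definition gcomm :: "4 \<times> 4 \<Rightarrow> 4 \<times> 4 \<Rightarrow> real" where
  "gcomm g h = kcomm (fst g) (fst h) * kcomm (snd g) (snd h)"
definition gsign :: "4 \<times> 4 \<Rightarrow> 4 \<times> 4 \<Rightarrow> real" where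
  "gsign g h = ksign (fst g) (fst h) * ksign (snd h) (snd g)"
definition gchar :: "4 \<times> 4 \<Rightarrow> 4 \<times> 4" where
  "gchar g = (klchar (fst g), krchar (snd g))"

lemma gmul_assoc: "gmul (gmul g h) k = gmul g (gmul h k)"
  by (simp add: gmul_def kmul_assoc)

lemma gmul_commute: "gmul g h = gmul h g"
  by (simp add: gmul_def kmul_commute)

lemma gmul_self [simp]: "gmul g g = (1, 1)" and gmul_one [simp]: "gmul (1, 1) g = g" "gmul g (1, 1) = g"
  by (simp_all add: gmul_def)

lemma gmul_cancel [simp]: "gmul g (gmul g h) = h"
  by (simp flip: gmul_assoc)

lemma gmul_eq_one [simp]: "gmul g h = (1, 1) \<longleftrightarrow> g = h"
  by (metis gmul_cancel gmul_one(2) gmul_self)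

lemma bij_gmul: "bij (gmul g)"
  by (rule o_bij[of "gmul g"]) auto

lemma sum_gmul: "(\<Sum>h\<in>UNIV. f (gmul g h)) = (\<Sum>h\<in>UNIV. f h)"
  by (rule sum.reindex_bij_betw[OF bij_gmul])

lemma gcomm_gmul: "gcomm (gmul g h) k = gcomm g k * gcomm h k" "gcomm k (gmul g h) = gcomm k g * gcomm k h"
  and gcomm_commute: "gcomm g h = gcomm h g"
proof -
  show "gcomm g h = gcomm h g" for g h
    using kcomm_commute[of "fst g" "fst h"] kcomm_commute[of "snd g" "snd h"] by (simp add: gcomm_def)
  show 1: "gcomm (gmul g h) k = gcomm g k * gcomm h k" for g h k by (simp add: gcomm_def gmul_def kcomm_kmul)
  show "gcomm k (gmul g h) = gcomm k g * gcomm k h"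
    using 1[of g h k] \<open>\<And>g h. gcomm g h = gcomm h g\<close>[of _ k] by simp
qed

lemma gcomm_one [simp]: "gcomm (1, 1) g = 1" "gcomm g (1, 1) = 1"
  by (simp_all add: gcomm_def)

lemma gcomm_cases: "gcomm g h = 1 \<or> gcomm g h = - 1"
  by (auto simp: gcomm_def kcomm_def)

lemma gcomm_sq [simp]: "gcomm g h * gcomm g h = 1"
  using gcomm_cases[of g h] by auto

text \<open>Orthogonality of the characters of a group of order 16.\<close>

lemma gcomm_sum: "(\<Sum>g\<in>UNIV. gcomm g h) = (if h = (1, 1) then 16 else 0)"
proof -
  have "(\<Sum>g\<in>UNIV. gcomm g h) = (\<Sum>g\<in>UNIV \<times> UNIV. kcomm (fst g) (fst h) * kcomm (snd g) (snd h))"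
    by (simp add: gcomm_def)
  also have "\<dots> = (\<Sum>i\<in>UNIV. kcomm i (fst h)) * (\<Sum>j\<in>UNIV. kcomm j (snd h))"
    by (simp add: sum_product sum.cartesian_product case_prod_beta)
  finally show ?thesis by (auto simp: kcomm_sum prod_eq_iff)
qed

lemma gsign_gmul: "gsign (gmul g h) k = gsign g k * gsign h k" "gsign k (gmul g h) = gsign k g * gsign k h"
  by (simp_all add: gsign_def gmul_def ksign_kmul)

lemma gsign_swap: "gsign g h * gsign h g = gcomm g h"
proof -
  have "gsign g h * gsign h g = (ksign (fst g) (fst h) * ksign (fst h) (fst g)) * (ksign (snd g) (snd h) * ksign (snd h) (snd g))"
    by (simp add: gsign_def)
  then show ?thesis by (simp add: ksign_swap gcomm_def)
qed

lemma gsign_one [simp]: "gsign (1, 1) g = 1" "gsign g (1, 1) = 1"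
  by (simp_all add: gsign_def)

lemma gsign_cases: "gsign g h = 1 \<or> gsign g h = - 1"
  by (auto simp: gsign_def ksign_def)

lemma gsign_sq [simp]: "gsign g h * gsign g h = 1"
  using gsign_cases[of g h] by auto

text \<open>The value -1 occurs where exactly one of the two indices is trivial. These are the
  places where the Fourier coefficients of a magic unitary vanish and where the Pauli operators are
  anti-self-adjoint.\<close>

lemma gsign_self: "gsign g g = (if (fst g = 1) = (snd g = 1) then 1 else - 1)"
  by (auto simp: gsign_def ksign_self)

text \<open>Hence translation by \<open>gchar g\<close> multiplies the Fourier coefficient at h by
  \<open>gsign g h\<close>.\<close>

lemma gcomm_gchar: "gcomm (gchar g) h = gsign g h"
  by (simp add: gcomm_def gchar_def gsign_def klchar krchar)

lemma gchar_gmul: "gchar (gmul g h) = gmul (gchar g) (gchar h)"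
  by (simp add: gchar_def gmul_def klchar_kmul krchar_kmul)

lemma gchar_one [simp]: "gchar (1, 1) = (1, 1)"
  by (simp add: gchar_def klchar_def krchar_def)

section \<open>Fourier coefficients of a magic unitary\<close>

definition gentry :: "(4 \<Rightarrow> 4 \<Rightarrow> 'a) \<Rightarrow> 4 \<times> 4 \<Rightarrow> 'a" where
  "gentry u h = u (fst h) (snd h)"

text \<open>The factor 1/4 is the square root of 1/16. It makes the transform its own inverse and
  the coefficient of a magic unitary at (1, 1) equal to 1.\<close>

definition fourier :: "(4 \<Rightarrow> 4 \<Rightarrow> 'a) \<Rightarrow> 4 \<times> 4 \<Rightarrow> 'a::cstar_algebra" where
  "fourier u g = (1/4) *\<^sub>R (\<Sum>h\<in>UNIV. gcomm g h *\<^sub>R gentry u h)"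

lemma fourier_inverse: "gentry u h = (1/4) *\<^sub>R (\<Sum>g\<in>UNIV. gcomm g h *\<^sub>R fourier u g)"
proof -
  have "(\<Sum>g\<in>UNIV. gcomm g h *\<^sub>R fourier u g) =
      (1/4) *\<^sub>R (\<Sum>g\<in>UNIV. \<Sum>k\<in>UNIV. (gcomm g h * gcomm g k) *\<^sub>R gentry u k)"
    by (simp add: fourier_def scaleR_sum_right mult.commute mult.left_commute)
  also have "(\<Sum>g\<in>UNIV. \<Sum>k\<in>UNIV. (gcomm g h * gcomm g k) *\<^sub>R gentry u k) =
      (\<Sum>k\<in>UNIV. (\<Sum>g\<in>UNIV. gcomm g (gmul h k)) *\<^sub>R gentry u k)"
    unfolding gcomm_gmul scaleR_sum_left by (rule sum.swap)
  also have "\<dots> = (\<Sum>k\<in>UNIV. if h = k then 16 *\<^sub>R gentry u k else 0)"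
    by (rule sum.cong) (simp_all add: gcomm_sum)
  finally show ?thesis by simp
qed

text \<open>Character orthogonality in g leaves only the products of two entries whose positions
  differ by d. For d = (1, 1) these are squares of entries; for d = (i, 1) with i different from 1
  they are products within a column, so the two kinds of relations of a magic unitary can be
  inserted.\<close>

lemma fourier_product_sum:
  "(\<Sum>g\<in>UNIV. gcomm d (gmul g m) *\<^sub>R (fourier u g * fourier u (gmul g m))) =
   (\<Sum>h\<in>UNIV. gcomm m h *\<^sub>R (gentry u h * gentry u (gmul h d)))"
proof -
  have "gcomm d (gmul g m) *\<^sub>R (fourier u g * fourier u (gmul g m)) =
     (1/16) *\<^sub>R (\<Sum>(h, k)\<in>UNIV. (gcomm d m * gcomm m k * gcomm g (gmul (gmul d h) k)) *\<^sub>R (gentry u h * gentry u k))" for g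
    by (simp add: fourier_def sum_product scaleR_sum_right sum.cartesian_product case_prod_beta gcomm_gmul
       gcomm_commute[of d g] mult_ac)
  then have "(\<Sum>g\<in>UNIV. gcomm d (gmul g m) *\<^sub>R (fourier u g * fourier u (gmul g m))) =
     (1/16) *\<^sub>R (\<Sum>g\<in>UNIV. \<Sum>(h, k)\<in>UNIV. (gcomm d m * gcomm m k * gcomm g (gmul (gmul d h) k)) *\<^sub>R (gentry u h * gentry u k))"
    by (simp only: scaleR_sum_right)
  also have "\<dots> = (1/16) *\<^sub>R (\<Sum>(h, k)\<in>UNIV. (gcomm d m * gcomm m k * (\<Sum>g\<in>UNIV. gcomm g (gmul (gmul d h) k))) *\<^sub>R (gentry u h * gentry u k))"
    by (subst sum.swap) (simp add: case_prod_beta scaleR_sum_left sum_distrib_left)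
  also have "\<dots> = (1/16) *\<^sub>R (\<Sum>h\<in>UNIV. \<Sum>k\<in>UNIV. (gcomm d m * gcomm m k * (\<Sum>g\<in>UNIV. gcomm g (gmul (gmul d h) k))) *\<^sub>R (gentry u h * gentry u k))"
    by (simp add: sum.cartesian_product)
  also have "\<dots> = (1/16) *\<^sub>R (\<Sum>h\<in>UNIV. \<Sum>k\<in>UNIV. if gmul d h = k then 16 *\<^sub>R gcomm m h *\<^sub>R (gentry u h * gentry u k) else 0)"
  proof (intro arg_cong[of _ _ "scaleR _"] sum.cong refl)
    fix h k
    have "(\<Sum>g\<in>UNIV. gcomm g (gmul (gmul d h) k)) = (if gmul d h = k then 16 else 0)"
      by (simp only: gcomm_sum gmul_eq_one)
    moreover have "gcomm d m * gcomm m (gmul d h) = gcomm m h"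
      by (simp add: gcomm_gmul(2) gcomm_commute[of d m] flip: mult.assoc)
    ultimately show "(gcomm d m * gcomm m k * (\<Sum>g\<in>UNIV. gcomm g (gmul (gmul d h) k))) *\<^sub>R (gentry u h * gentry u k) =
        (if gmul d h = k then 16 *\<^sub>R gcomm m h *\<^sub>R (gentry u h * gentry u k) else 0)"
      by auto
  qed
  also have "\<dots> = (\<Sum>h\<in>UNIV. gcomm m h *\<^sub>R (gentry u h * gentry u (gmul h d)))"
    by (simp add: scaleR_sum_right gmul_commute)
  finally show ?thesis .
qed

lemma magic_unitary_transpose: "magic_unitary u \<Longrightarrow> magic_unitary (\<lambda>i j. u j i)"
  by (simp add: magic_unitary_def)

lemma fourier_transpose: "fourier (\<lambda>i j. u j i) (k, l) = fourier u (l, k)"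
proof -
  have "(\<Sum>h\<in>UNIV. gcomm (k, l) h *\<^sub>R gentry (\<lambda>i j. u j i) h) = (\<Sum>h\<in>UNIV. gcomm (l, k) h *\<^sub>R gentry u h)"
    by (rule sum.reindex_bij_witness[of _ prod.swap prod.swap]) (auto simp: gcomm_def gentry_def)
  then show ?thesis by (simp add: fourier_def)
qed

lemma fourier_rows: "fourier u (k, l) = (1/4) *\<^sub>R (\<Sum>i\<in>UNIV. kcomm k i *\<^sub>R (\<Sum>j\<in>UNIV. kcomm l j *\<^sub>R u i j))"
proof -
  have "(\<Sum>h\<in>UNIV. gcomm (k, l) h *\<^sub>R gentry u h) = (\<Sum>h\<in>UNIV \<times> UNIV. gcomm (k, l) h *\<^sub>R gentry u h)" by simp
  also have "\<dots> = (\<Sum>i\<in>UNIV. kcomm k i *\<^sub>R (\<Sum>j\<in>UNIV. kcomm l j *\<^sub>R u i j))"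
    by (simp add: sum.cartesian_product[symmetric] case_prod_beta gcomm_def gentry_def scaleR_sum_right
       del: UNIV_Times_UNIV)
      (simp add: sum.cartesian_product case_prod_beta)
  finally show ?thesis by (simp add: fourier_def)
qed

section \<open>Relations between the Fourier coefficients of a magic unitary\<close>

context
  fixes u :: "4 \<Rightarrow> 4 \<Rightarrow> 'a::cstar_algebra"
  assumes u: "magic_unitary u"
begin

text \<open>With the trivial character on the first index, the column sums appear; they are all
  1.\<close>

lemma fourier_one_left: "fourier u (1, l) = (if l = 1 then 1 else 0)"
proof -
  have "(\<Sum>i\<in>UNIV. kcomm 1 i *\<^sub>R (\<Sum>j\<in>UNIV. kcomm l j *\<^sub>R u i j)) = (\<Sum>j\<in>UNIV. kcomm l j *\<^sub>R (\<Sum>i\<in>UNIV. u i j))"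
    by (simp add: scaleR_sum_right) (rule sum.swap)
  also have "\<dots> = (\<Sum>j\<in>UNIV. kcomm j l) *\<^sub>R 1"
    using u by (simp add: magic_unitary_def kcomm_commute[of l] scaleR_sum_left)
  finally show ?thesis by (simp add: fourier_rows kcomm_sum)
qed

text \<open>The transform in the second index alone is multiplicative on each row, because a row
  consists of orthogonal projections. Transforming this pointwise product in the first index gives a
  convolution.\<close>

lemma fourier_column_product:
  "(\<Sum>i\<in>UNIV. fourier u (i, j) * fourier u (kmul i m, k)) = fourier u (m, kmul j k)"
proof -
  define f where "f p j = (\<Sum>q\<in>UNIV. kcomm j q *\<^sub>R u p q)" for p j
  have ff: "f p j * f p k = f p (kmul j k)" for p
  proof -
    have "f p j * f p k = (\<Sum>q\<in>UNIV. \<Sum>r\<in>UNIV. (kcomm j q * kcomm k r) *\<^sub>R (u p q * u p r))"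
      by (simp add: f_def sum_product mult.commute)
    also have "\<dots> = (\<Sum>q\<in>UNIV. \<Sum>r\<in>UNIV. if q = r then (kcomm j q * kcomm k r) *\<^sub>R u p q else 0)"
      using u by (intro sum.cong) (auto simp: magic_unitary_def is_projection_def)
    finally show ?thesis by (simp add: f_def kcomm_kmul)
  qed
  have a: "fourier u (i, j) = (1/4) *\<^sub>R (\<Sum>p\<in>UNIV. kcomm i p *\<^sub>R f p j)" for i j
    by (simp add: fourier_rows f_def)
  \<comment> \<open>Written this way, the dependence on i is a single character, and its sum over i
    forces p = r.\<close>
  let ?F = "\<lambda>i p r. (kcomm i (kmul p r) * kcomm m r) *\<^sub>R (f p j * f r k)"
  have "(kcomm i p *\<^sub>R f p j) * (kcomm (kmul i m) r *\<^sub>R f r k) = ?F i p r" for i p r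
    by (simp add: kcomm_kmul kcomm_kmul_right)
  then have "fourier u (i, j) * fourier u (kmul i m, k) = (1/16) *\<^sub>R (\<Sum>p\<in>UNIV. \<Sum>r\<in>UNIV. ?F i p r)" for i
    unfolding a by (simp only: mult_scaleR_left mult_scaleR_right scaleR_scaleR sum_product) simp
  then have "(\<Sum>i\<in>UNIV. fourier u (i, j) * fourier u (kmul i m, k)) =
     (1/16) *\<^sub>R (\<Sum>i\<in>UNIV. \<Sum>p\<in>UNIV. \<Sum>r\<in>UNIV. ?F i p r)"
    by (simp only: scaleR_sum_right)
  also have "(\<Sum>i\<in>UNIV. \<Sum>p\<in>UNIV. \<Sum>r\<in>UNIV. ?F i p r) = (\<Sum>p\<in>UNIV. \<Sum>i\<in>UNIV. \<Sum>r\<in>UNIV. ?F i p r)"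
    by (rule sum.swap)
  also have "\<dots> = (\<Sum>p\<in>UNIV. \<Sum>r\<in>UNIV. \<Sum>i\<in>UNIV. ?F i p r)"
    by (rule sum.cong[OF refl], rule sum.swap)
  also have "\<dots> = (\<Sum>p\<in>UNIV. \<Sum>r\<in>UNIV. ((\<Sum>i\<in>UNIV. kcomm i (kmul p r)) * kcomm m r) *\<^sub>R (f p j * f r k))"
    by (simp only: scaleR_sum_left sum_distrib_right)
  also have "\<dots> = (\<Sum>p\<in>UNIV. \<Sum>r\<in>UNIV. if p = r then (4 * kcomm m p) *\<^sub>R (f p j * f p k) else 0)"
  proof (intro sum.cong refl)
    fix p r
    have "kmul p r = 1 \<longleftrightarrow> p = r" by (auto simp: kmul_def)
    then show "((\<Sum>i\<in>UNIV. kcomm i (kmul p r)) * kcomm m r) *\<^sub>R (f p j * f r k) =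
      (if p = r then (4 * kcomm m p) *\<^sub>R (f p j * f p k) else 0)" by (simp add: kcomm_sum)
  qed
  finally show ?thesis by (simp add: a ff scaleR_sum_right)
qed

end

context
  fixes u :: "4 \<Rightarrow> 4 \<Rightarrow> 'a::cstar_algebra"
  assumes u: "magic_unitary u"
begin

text \<open>The facts for columns, applied to the transposed matrix, give those for rows.\<close>

lemma fourier_one_right: "fourier u (k, 1) = (if k = 1 then 1 else 0)"
  using fourier_one_left[OF magic_unitary_transpose[OF u], of k] by (simp add: fourier_transpose[of u])

lemma fourier_row_product:
  "(\<Sum>j\<in>UNIV. fourier u (i, j) * fourier u (k, kmul j m)) = fourier u (kmul i k, m)"
  using fourier_column_product[OF magic_unitary_transpose[OF u], of i m k] by (simp add: fourier_transpose[of u])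

lemma fourier_trivial:
  assumes "(fst g = 1) \<noteq> (snd g = 1)"
  shows "fourier u g = 0"
  using assms fourier_one_left[OF u, of "snd g"] fourier_one_right[of "fst g"] by (cases g) auto

lemma fourier_one [simp]: "fourier u (1, 1) = 1"
  by (simp add: fourier_one_left[OF u])

text \<open>Of the four terms in \<open>fourier_column_product\<close>, those at 1 and at
  \<open>kmul p q\<close> contain a coefficient with exactly one trivial index and vanish.\<close>

lemma fourier_column_pair:
  assumes "p \<noteq> 1" "q \<noteq> 1" "p \<noteq> q" "j \<noteq> 1" "k \<noteq> 1"
  shows "fourier u (p, j) * fourier u (q, k) + fourier u (q, j) * fourier u (p, k) = fourier u (kmul p q, kmul j k)"
proof -
  have "1 \<noteq> kmul p q" "p \<noteq> kmul p q" "q \<noteq> kmul p q" using assms(1-3) by (auto simp: kmul_def)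
  moreover have "kmul p (kmul p q) = q" "kmul q (kmul p q) = p"
    by (metis kmul_assoc kmul_commute kmul_one(1) kmul_self)+
  ultimately show ?thesis
    using fourier_column_product[OF u, of j "kmul p q" k] assms
    by (simp add: UNIV_kmul[OF assms(1-3)] fourier_trivial)
qed

lemma fourier_row_pair:
  assumes "p \<noteq> 1" "q \<noteq> 1" "p \<noteq> q" "j \<noteq> 1" "k \<noteq> 1"
  shows "fourier u (j, p) * fourier u (k, q) + fourier u (j, q) * fourier u (k, p) = fourier u (kmul j k, kmul p q)"
proof -
  have "1 \<noteq> kmul p q" "p \<noteq> kmul p q" "q \<noteq> kmul p q" using assms(1-3) by (auto simp: kmul_def)
  moreover have "kmul p (kmul p q) = q" "kmul q (kmul p q) = p"
    by (metis kmul_assoc kmul_commute kmul_one(1) kmul_self)+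
  ultimately show ?thesis
    using fourier_row_product[of j k "kmul p q"] assms
    by (simp add: UNIV_kmul[OF assms(1-3)] fourier_trivial)
qed

text \<open>If exactly one index agrees, the right side of the pair relation vanishes and the
  coefficients anticommute. If both differ, the two column relations and the row relation have the
  same right side, and comparing them shows that the coefficients commute.\<close>

lemma fourier_commute: "fourier u g * fourier u h = gcomm g h *\<^sub>R (fourier u h * fourier u g)"
proof -
  obtain p j where g: "g = (p, j)" by (cases g)
  obtain q k where h: "h = (q, k)" by (cases h)
  show ?thesis
  proof (cases "p = 1 \<or> q = 1 \<or> j = 1 \<or> k = 1")
    case True
    then have "g = (1, 1) \<or> h = (1, 1) \<or> fourier u g = 0 \<or> fourier u h = 0"
      using fourier_trivial[of g] fourier_trivial[of h] by (auto simp: g h)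
    then show ?thesis by auto
  next
    case False
    then have n: "p \<noteq> 1" "q \<noteq> 1" "j \<noteq> 1" "k \<noteq> 1" by auto
    consider "p = q" "j = k" | "p \<noteq> q" "j = k" | "p = q" "j \<noteq> k" | "p \<noteq> q" "j \<noteq> k" by blast
    then show ?thesis
    proof cases
      case 1
      then show ?thesis by (simp add: g h gcomm_def kcomm_def)
    next
      case 2
      then have "fourier u (kmul p q, kmul j j) = 0" using n by (intro fourier_trivial) (auto simp: kmul_def)
      then have "fourier u (p, j) * fourier u (q, j) = - (fourier u (q, j) * fourier u (p, j))"
        using fourier_column_pair[of p q j j] n 2 by (simp add: add_eq_0_iff2)
      then show ?thesis using n 2 by (simp add: g h gcomm_def kcomm_def)
    next
      case 3
      then have "fourier u (kmul p p, kmul j k) = 0" using n by (intro fourier_trivial) (auto simp: kmul_def)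
      then have "fourier u (p, j) * fourier u (p, k) = - (fourier u (p, k) * fourier u (p, j))"
        using fourier_row_pair[of j k p p] n 3 by (simp add: add_eq_0_iff2)
      then show ?thesis using n 3 by (simp add: g h gcomm_def kcomm_def)
    next
      case 4
      let ?A = "fourier u (p, j) * fourier u (q, k)" and ?B = "fourier u (q, j) * fourier u (p, k)"
      let ?C = "fourier u (p, k) * fourier u (q, j)" and ?D = "fourier u (q, k) * fourier u (p, j)"
      have "?A + ?B = fourier u (kmul p q, kmul j k)" "?C + ?D = fourier u (kmul p q, kmul j k)"
        using fourier_column_pair[of p q j k] fourier_column_pair[of p q k j] n 4 by (auto simp: kmul_commute[of k j])
      moreover have "?A + ?C = fourier u (kmul p q, kmul j k)"
        using fourier_row_pair[of j k p q] n 4 by auto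
      ultimately have "?B = ?C" by (metis add_left_cancel)
      then have "?A = ?D" using \<open>?A + ?B = _\<close> \<open>?C + ?D = _\<close> by (metis add_left_cancel add.commute)
      then show ?thesis using n 4 by (simp add: g h gcomm_def kcomm_def)
    qed
  qed
qed

lemma star_fourier: "star (fourier u g) = fourier u g"
  using u by (simp add: fourier_def star_scaleR star_sum gentry_def magic_unitary_def is_projection_def)

lemma fourier_square_sum:
  "(\<Sum>g\<in>UNIV. fourier u g * fourier u (gmul g m)) = 4 *\<^sub>R fourier u m"
proof -
  have "(\<Sum>h\<in>UNIV. gcomm m h *\<^sub>R (gentry u h * gentry u h)) = (\<Sum>h\<in>UNIV. gcomm m h *\<^sub>R gentry u h)"
    using u by (simp add: magic_unitary_def is_projection_def gentry_def)
  then show ?thesis using fourier_product_sum[of "(1, 1)" m u] by (simp add: fourier_def)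
qed

lemma fourier_orthogonal_sum:
  assumes "i \<noteq> 1"
  shows "(\<Sum>g\<in>UNIV. gcomm (i, 1) (gmul g m) *\<^sub>R (fourier u g * fourier u (gmul g m))) = 0"
proof -
  have "gentry u h * gentry u (gmul h (i, 1)) = 0" for h
  proof -
    have "fst h \<noteq> kmul (fst h) i" using assms by (auto simp: kmul_def)
    then show ?thesis using u by (simp add: gentry_def gmul_def magic_unitary_def)
  qed
  then show ?thesis by (simp add: fourier_product_sum)
qed

end

section \<open>Translations and twisted multiplication operators\<close>

lemma star_hom_bounded_linear:
  assumes "star_hom \<phi>"
  shows "bounded_linear \<phi>"
proof (rule bounded_linear_intro[of _ 1])
  show "\<phi> (x + y) = \<phi> x + \<phi> y" for x y by (rule star_hom_add[OF assms])
  show "\<phi> (r *\<^sub>R x) = r *\<^sub>R \<phi> x" for r x using assms by (simp add: star_hom_def scaleR_scaleC)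
  show "norm (\<phi> x) \<le> norm x * 1" for x using star_hom_contractive[OF assms] by simp
qed

lemma star_hom_compose: "star_hom \<phi> \<Longrightarrow> star_hom \<psi> \<Longrightarrow> star_hom (\<lambda>x. \<phi> (\<psi> x))"
  by (simp add: star_hom_def)

lemma magic_unitary_image:
  assumes \<phi>: "star_hom \<phi>" and u: "magic_unitary u"
  shows "magic_unitary (\<lambda>i j. \<phi> (u i j))"
proof -
  have s: "star (\<phi> x) = \<phi> (star x)" and m: "\<phi> x * \<phi> y = \<phi> (x * y)" and o: "\<phi> 1 = 1" for x y
    using \<phi> by (auto simp: star_hom_def)
  show ?thesis
    using u by (simp add: magic_unitary_def is_projection_def s m star_hom_zero[OF \<phi>] o flip: star_hom_sum[OF \<phi>])
qed

lemma A_s_hom: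
  assumes "magic_unitary v"
  shows star_hom_A_s_hom: "star_hom (A_s_hom v)" and A_s_hom_generator: "A_s_hom v (universal_magic i j) = v i j"
  using theI'[OF A_s_universal[OF assms]] unfolding A_s_hom_def by auto

lemma star_hom_A_s_eqI:
  fixes \<phi> \<psi> :: "'n::finite A_s \<Rightarrow> 'a::cstar_algebra"
  assumes "star_hom \<phi>" "star_hom \<psi>" "\<And>i j. \<phi> (universal_magic i j) = \<psi> (universal_magic i j)"
  shows "\<phi> = \<psi>"
  using A_s_universal[OF magic_unitary_image[OF assms(1) magic_unitary_universal]] assms by auto

text \<open>Density of the polynomials in the generators; it is needed for maps that are not
  homomorphisms.\<close>

lemma bounded_linear_A_s_eqI:
  fixes f g :: "'n::finite A_s \<Rightarrow> 'a::real_normed_vector"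
  assumes "bounded_linear f" "bounded_linear g" "\<And>a. f (free_embed a) = g (free_embed a)"
  shows "f y = g y"
proof -
  obtain X where X: "y = abs_A_s X" "unorm_Cauchy X" by (rule A_s_cases)
  have "(\<lambda>n. free_embed (X n)) \<longlonglongrightarrow> y" using free_embed_tendsto[OF X(2)] X(1) by simp
  from bounded_linear.tendsto[OF assms(1) this] bounded_linear.tendsto[OF assms(2) this]
  show ?thesis by (simp add: assms(3) LIMSEQ_unique)
qed

section \<open>The translation automorphisms of \<open>4 A_s\<close>\<close>

lemma bij_kmul: "bij (kmul p)"
  by (rule o_bij[of "kmul p"]) (auto simp flip: kmul_assoc)

lemma magic_unitary_translate:
  fixes u :: "4 \<Rightarrow> 4 \<Rightarrow> 'a::cstar_algebra"
  assumes u: "magic_unitary u"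
  shows "magic_unitary (\<lambda>i j. u (kmul p i) (kmul q j))"
proof -
  have inj: "kmul p i = kmul p j \<longleftrightarrow> i = j" for p i j
    using bij_kmul[of p] by (auto simp: bij_def inj_def)
  have "(\<Sum>j\<in>UNIV. u k (kmul q j)) = (\<Sum>j\<in>UNIV. u k j)" for k
    by (rule sum.reindex_bij_betw[OF bij_kmul])
  moreover have "(\<Sum>i\<in>UNIV. u (kmul p i) k) = (\<Sum>i\<in>UNIV. u i k)" for k
    by (rule sum.reindex_bij_betw[OF bij_kmul])
  ultimately show ?thesis using u by (simp add: magic_unitary_def inj)
qed

definition translate :: "4 \<times> 4 \<Rightarrow> 4 A_s \<Rightarrow> 4 A_s" where
  "translate h = A_s_hom (\<lambda>i j. universal_magic (kmul (fst h) i) (kmul (snd h) j))"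

abbreviation agen :: "4 \<times> 4 \<Rightarrow> 4 A_s" where "agen \<equiv> fourier universal_magic"

lemma star_hom_translate: "star_hom (translate h)"
  unfolding translate_def by (intro star_hom_A_s_hom magic_unitary_translate magic_unitary_universal)

lemma translate_gen: "translate h (gentry universal_magic k) = gentry universal_magic (gmul h k)"
  unfolding translate_def gentry_def
  by (subst A_s_hom_generator) (simp_all add: magic_unitary_translate magic_unitary_universal gmul_def)

lemmas translate_hom = star_hom_translate[unfolded star_hom_def]

lemma translate_mult: "translate h (x * y) = translate h x * translate h y"
  and translate_star: "translate h (star x) = star (translate h x)"
  using translate_hom by blast+

lemma bounded_linear_translate: "bounded_linear (translate h)"
  by (rule star_hom_bounded_linear[OF star_hom_translate])

lemmas translate_linear = linear_simps[OF bounded_linear_translate]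

lemma translate_translate: "translate g (translate h y) = translate (gmul g h) y"
proof -
  have "(\<lambda>y. translate g (translate h y)) = translate (gmul g h)"
  proof (rule star_hom_A_s_eqI)
    fix i j
    show "translate g (translate h (universal_magic i j)) = translate (gmul g h) (universal_magic i j)"
      using translate_gen[of h "(i, j)"] translate_gen[of g "gmul h (i, j)"] translate_gen[of "gmul g h" "(i, j)"]
      by (simp add: gentry_def gmul_assoc)
  qed (rule star_hom_compose[OF star_hom_translate star_hom_translate], rule star_hom_translate)
  then show ?thesis by metis
qed

lemma translate_one [simp]: "translate (1, 1) y = y"
proof -
  have "translate (1, 1) = (\<lambda>y. y)"
  proof (rule star_hom_A_s_eqI)
    show "translate (1, 1) (universal_magic i j) = universal_magic i j" for i j
      using translate_gen[of "(1, 1)" "(i, j)"] by (simp add: gentry_def)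
  qed (rule star_hom_translate, simp add: star_hom_def)
  then show ?thesis by metis
qed

lemma norm_translate [simp]: "norm (translate h y) = norm y"
  by (rule antisym) (use star_hom_contractive[OF star_hom_translate, of h y]
      star_hom_contractive[OF star_hom_translate, of h "translate h y"] in \<open>simp_all add: translate_translate\<close>)

lemma translate_agen: "translate h (agen g) = gcomm h g *\<^sub>R agen g"
proof -
  have "translate h (agen g) = (1/4) *\<^sub>R (\<Sum>k\<in>UNIV. gcomm g k *\<^sub>R gentry universal_magic (gmul h k))"
    by (simp add: fourier_def translate_linear star_hom_sum[OF star_hom_translate] translate_gen)
  also have "\<dots> = (1/4) *\<^sub>R (\<Sum>k\<in>UNIV. gcomm h g *\<^sub>R gcomm g (gmul h k) *\<^sub>R gentry universal_magic (gmul h k))"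
    by (simp add: gcomm_gmul gcomm_commute[of h g] flip: mult.assoc)
  also have "\<dots> = gcomm h g *\<^sub>R agen g"
    by (subst sum_gmul[of "\<lambda>k. gcomm h g *\<^sub>R gcomm g k *\<^sub>R gentry universal_magic k"])
      (simp add: fourier_def scaleR_sum_right mult.commute)
  finally show ?thesis .
qed

text \<open>When y is a generator \<open>agen k\<close>, this is \<open>fourier_commute\<close> with
  its sign read as the effect of the translation. Both sides propagate through products, so the rule
  extends to the matrix entries, to words, and by density to all of \<open>4 A_s\<close>.\<close>

lemma agen_mult: "agen g * y = translate g y * agen g"
proof (rule bounded_linear_A_s_eqI[of "\<lambda>y. agen g * y" "\<lambda>y. translate g y * agen g"])
  show "bounded_linear ((*) (agen g))" by (rule bounded_linear_mult_right)
  show "bounded_linear (\<lambda>y. translate g y * agen g)"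
    by (rule bounded_linear_compose[OF bounded_linear_mult_left bounded_linear_translate])
  have gen: "agen g * gentry universal_magic h = translate g (gentry universal_magic h) * agen g" for h
  proof -
    have "agen g * agen k = translate g (agen k) * agen g" for k
      using fourier_commute[OF magic_unitary_universal, of g k] by (simp add: translate_agen)
    then show ?thesis
      by (simp add: fourier_inverse[of universal_magic h] translate_linear star_hom_sum[OF star_hom_translate]
          sum_distrib_left sum_distrib_right)
  qed
  have word: "agen g * free_embed (Poly_Mapping.single (Free_Monoid w) c) =
      translate g (free_embed (Poly_Mapping.single (Free_Monoid w) c)) * agen g" for w c
  proof (induction w)
    case Nil
    show ?case
      using translate_hom[of g]
      by (simp add: free_single_Nil free_embed_scale free_embed_one mult_scaleC_left mult_scaleC_right)
  next
    case (Cons p w)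
    obtain i j where p: "p = (i, j)" by (cases p)
    have "agen g * universal_magic i j = translate g (universal_magic i j) * agen g"
      using gen[of "(i, j)"] by (simp add: gentry_def)
    then have "agen g * (universal_magic i j * e) = translate g (universal_magic i j * e) * agen g"
      if "agen g * e = translate g e * agen g" for e
    proof -
      have "agen g * (universal_magic i j * e) = translate g (universal_magic i j) * (agen g * e)"
        by (simp add: \<open>agen g * universal_magic i j = _\<close> flip: mult.assoc)
      then show ?thesis by (simp add: that translate_mult mult.assoc)
    qed
    from this[OF Cons] show ?case unfolding p free_single_Cons free_embed_mult free_embed_gen .
  qed
  show "agen g * free_embed a = translate g (free_embed a) * agen g" for a
  proof (induction a rule: free_algebra_induct)
    case (single w c)
    then show ?case using word[of "letters w" c] by simp
  qed (simp_all add: free_embed_zero free_embed_add translate_linear distrib_left distrib_right)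
qed

text \<open>
  As \<open>gsign g h * gcomm g h = gsign h g\<close>, the twist cancels the commutation signs of the generators.
\<close>

definition twisted :: "4 \<times> 4 \<Rightarrow> 4 A_s \<Rightarrow> 4 A_s" where
  "twisted g v = agen g * translate (gchar g) v"

lemma bounded_linear_twisted: "bounded_linear (twisted g)"
  unfolding twisted_def by (rule bounded_linear_compose[OF bounded_linear_mult_right bounded_linear_translate])

lemma twisted_twisted:
  "twisted g (twisted h v) = gsign g h *\<^sub>R (agen g * agen h * translate (gchar (gmul g h)) v)"
  by (simp add: twisted_def translate_mult translate_agen gcomm_gchar translate_translate gchar_gmul mult.assoc)

lemma twisted_commute: "twisted g (twisted h v) = twisted h (twisted g v)"
proof -
  have "gsign g h * gcomm g h = gsign h g" by (simp flip: gsign_swap mult.assoc)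
  then show ?thesis
    using fourier_commute[OF magic_unitary_universal, of g h]
    by (simp add: twisted_twisted gmul_commute[of h g])
qed

lemma agen_eq_zero: "gsign g g = - 1 \<Longrightarrow> agen g = 0"
  by (rule fourier_trivial[OF magic_unitary_universal]) (auto simp: gsign_self split: if_splits)

text \<open>The translation cancels because \<open>gmul g g\<close> is the unit. Where the remaining
  sign \<open>gsign g g\<close> is -1, the generator itself is zero.\<close>

lemma twisted_square: "twisted g (twisted g v) = agen g * agen g * v"
  using agen_eq_zero[of g] gsign_cases[of g g] by (auto simp: twisted_twisted)

lemma fixed_commute:
  assumes "\<And>h. translate h z = z"
  shows "z * agen g = agen g * z" "z * twisted g v = twisted g (z * v)"
proof -
  show 1: "z * agen g = agen g * z" by (simp add: agen_mult[of g z] assms)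
  show "z * twisted g v = twisted g (z * v)"
    by (simp add: twisted_def translate_mult assms 1 flip: mult.assoc)
qed

lemma agen_square_fixed: "translate h (agen g * agen g) = agen g * agen g"
  by (simp add: translate_mult translate_agen)

text \<open>
  The sign makes the generators act on the shifts of a joint eigenvector of the twisted operators with
  the same cocycle \<open>gsign\<close> as the Pauli operators.
\<close>

definition shifted :: "4 \<times> 4 \<Rightarrow> 4 A_s \<Rightarrow> 4 A_s" where
  "shifted h w = gsign h h *\<^sub>R translate (gchar h) w"

lemma bounded_linear_shifted: "bounded_linear (shifted h)"
  unfolding shifted_def by (rule bounded_linear_compose[OF bounded_linear_scaleR_right bounded_linear_translate])

lemma shifted_one [simp]: "shifted (1, 1) w = w"
  by (simp add: shifted_def)

lemma norm_shifted [simp]: "norm (shifted h w) = norm w"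
  using gsign_cases[of h h] by (auto simp: shifted_def)

text \<open>On a joint eigenvector w, the generator \<open>agen g\<close> thus permutes the vectors
  \<open>shifted h w\<close> as \<mu> g times a Pauli operator permutes the Pauli operators; compare
  \<open>pauli_operator_mult\<close>.\<close>

lemma agen_shifted: "agen g * shifted h w = gsign g h *\<^sub>R shifted (gmul g h) (twisted g w)"
proof -
  have "gmul (gmul g h) g = h" by (metis gmul_cancel gmul_commute)
  then have "shifted (gmul g h) (twisted g w) =
      (gsign (gmul g h) (gmul g h) * gsign (gmul g h) g) *\<^sub>R (agen g * translate (gchar h) w)"
    by (simp add: shifted_def twisted_def translate_mult translate_agen gcomm_gchar translate_translate
        flip: gchar_gmul)
  moreover have "gsign g h * (gsign (gmul g h) (gmul g h) * gsign (gmul g h) g) = gsign h h"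
    using gsign_cases[of g g] gsign_cases[of h h] gsign_cases[of g h] gsign_cases[of h g]
    unfolding gsign_gmul by (elim disjE) simp_all
  ultimately show ?thesis by (simp add: shifted_def mult.assoc)
qed

text \<open>There are two passes. The generators are self-adjoint but do not commute, so the first
  pass retains only eigenvalues of their squares, which are translation-invariant and therefore
  commute with every generator. The second pass uses that the twisted operators commute and have
  these squares.\<close>

lemma joint_approx_eigenvalues:
  assumes z: "star z = z" "norm z = 1" "\<And>h. translate h z = z"
  shows "\<exists>w r \<mu>. (\<forall>n::nat. norm (w n) = 1) \<and> \<bar>r\<bar> \<ge> 1 / 2 \<and> (\<lambda>n. z * w n - r *\<^sub>R w n) \<longlonglongrightarrow> 0 \<and>
     (\<forall>g. (\<lambda>n. twisted g (w n) - \<mu> g *\<^sub>R w n) \<longlonglongrightarrow> 0)"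
proof -
  obtain r where r: "\<bar>r\<bar> \<ge> 1 / 2"
    and w0: "\<exists>w. (\<forall>n::nat. norm (w n) = 1) \<and> (\<lambda>n. z * w n - r *\<^sub>R w n) \<longlonglongrightarrow> 0"
    using approx_eigenvalue_initial[OF z(1,2)] by blast
  define P where "P S w \<rho> \<longleftrightarrow> (\<forall>n::nat. norm (w n) = 1) \<and> (\<lambda>n. z * w n - r *\<^sub>R w n) \<longlonglongrightarrow> 0 \<and>
      (\<forall>g\<in>S. (\<lambda>n. agen g * agen g * w n - (\<rho> g * \<rho> g) *\<^sub>R w n) \<longlonglongrightarrow> 0)" for S w \<rho>
  have "\<exists>w \<rho>. P S w \<rho>" if "finite S" for S
    using that
  proof (induction S rule: finite_induct)
    case empty
    then show ?case using w0 by (simp add: P_def)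
  next
    case (insert g S)
    then obtain w \<rho> where w: "P S w \<rho>" by blast
    define F where "F = insert (z, r) ((\<lambda>k. (agen k * agen k, \<rho> k * \<rho> k)) ` S)"
    have "\<exists>w' s. (\<forall>n::nat. norm (w' n) = 1) \<and> (\<forall>(c, \<gamma>)\<in>insert (agen g, s) F. (\<lambda>n. c * w' n - \<gamma> *\<^sub>R w' n) \<longlonglongrightarrow> 0)"
    proof (rule approx_eigenvalue_selfadjoint)
      show "star (agen g) = agen g" by (rule star_fourier[OF magic_unitary_universal])
      show "finite F" using insert by (simp add: F_def)
      show "norm (w n) = 1" for n using w by (simp add: P_def)
      fix c \<gamma> assume c: "(c, \<gamma>) \<in> F"
      show "c * agen g = agen g * c"
        using c z(3) agen_square_fixed by (intro fixed_commute) (auto simp: F_def)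
      show "(\<lambda>n. c * w n - \<gamma> *\<^sub>R w n) \<longlonglongrightarrow> 0"
        using c w by (auto simp: F_def P_def)
    qed
    then obtain w' s where "\<forall>n. norm (w' n) = 1"
        "\<forall>(c, \<gamma>)\<in>insert (agen g, s) F. (\<lambda>n. c * w' n - \<gamma> *\<^sub>R w' n) \<longlonglongrightarrow> 0" by blast
    then have w': "\<And>n. norm (w' n) = 1" "(\<lambda>n. agen g * w' n - s *\<^sub>R w' n) \<longlonglongrightarrow> 0"
       "\<And>c \<gamma>. (c, \<gamma>) \<in> F \<Longrightarrow> (\<lambda>n. c * w' n - \<gamma> *\<^sub>R w' n) \<longlonglongrightarrow> 0" by auto
    \<comment> \<open>Only the square of \<open>agen g\<close> is carried along, since the next
      localisation need not respect \<open>agen g\<close> itself. Its eigenvalue is the square of a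
      real number, so the roots taken in the second pass are real.\<close>
    have "(\<lambda>n. agen g * (agen g * w' n - s *\<^sub>R w' n) + s *\<^sub>R (agen g * w' n - s *\<^sub>R w' n)) \<longlonglongrightarrow> agen g * 0 + s *\<^sub>R 0"
      by (intro tendsto_add tendsto_mult tendsto_scaleR tendsto_const w')
    then have "(\<lambda>n. agen g * agen g * w' n - (s * s) *\<^sub>R w' n) \<longlonglongrightarrow> 0"
      by (simp add: algebra_simps)
    then have "P (insert g S) w' (\<rho>(g := s))"
      using w' insert by (auto simp: P_def F_def)
    then show ?case by blast
  qed
  then obtain w1 \<rho> where w1: "P UNIV w1 \<rho>" by (metis finite_code)
  \<comment> \<open>The second pass keeps the eigenvalues found in the first and extracts a root for
    one twisted operator at a time.\<close>
  define Q where "Q S w \<mu> \<longleftrightarrow> P UNIV w \<rho> \<and> (\<forall>g\<in>S. (\<lambda>n. twisted g (w n) - \<mu> g *\<^sub>R w n) \<longlonglongrightarrow> 0)" for S w \<mu>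
  have "\<exists>w \<mu>. Q S w \<mu>" if "finite S" for S
    using that
  proof (induction S rule: finite_induct)
    case empty
    then show ?case using w1 by (auto simp: Q_def)
  next
    case (insert g S)
    then obtain w \<mu> where w: "Q S w \<mu>" by blast
    define F where "F = insert ((*) z, r) (range (\<lambda>k. ((*) (agen k * agen k), \<rho> k * \<rho> k)) \<union>
      (\<lambda>k. (twisted k, \<mu> k)) ` S)"
    have "\<exists>w' l. (\<forall>n::nat. norm (w' n) = 1) \<and> (\<forall>(f, \<gamma>)\<in>insert (twisted g, l) F. (\<lambda>n. f (w' n) - \<gamma> *\<^sub>R w' n) \<longlonglongrightarrow> 0)"
    proof (rule approx_eigenvalue_root)
      show "bounded_linear (twisted g)" by (rule bounded_linear_twisted)
      show "norm (w n) = 1" for n using w by (simp add: P_def Q_def)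
      show "(\<lambda>n. twisted g (twisted g (w n)) - (\<rho> g * \<rho> g) *\<^sub>R w n) \<longlonglongrightarrow> 0"
        using w by (simp add: twisted_square P_def Q_def del: split_paired_All)
      fix f \<gamma> assume f: "(f, \<gamma>) \<in> F"
      then show "bounded_linear f"
        by (auto simp: F_def bounded_linear_twisted intro: bounded_linear_mult_right)
      show "f (twisted g v) = twisted g (f v)" for v
        using f by (auto simp: F_def twisted_commute[of _ g] fixed_commute z(3) agen_square_fixed)
      show "(\<lambda>n. f (w n) - \<gamma> *\<^sub>R w n) \<longlonglongrightarrow> 0"
        using f w by (auto simp: F_def P_def Q_def)
    qed
    then obtain w' l where "\<forall>n. norm (w' n) = 1"
        "\<forall>(f, \<gamma>)\<in>insert (twisted g, l) F. (\<lambda>n. f (w' n) - \<gamma> *\<^sub>R w' n) \<longlonglongrightarrow> 0" by blast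
    then have w': "\<And>n. norm (w' n) = 1" "(\<lambda>n. twisted g (w' n) - l *\<^sub>R w' n) \<longlonglongrightarrow> 0"
       "\<And>f \<gamma>. (f, \<gamma>) \<in> F \<Longrightarrow> (\<lambda>n. f (w' n) - \<gamma> *\<^sub>R w' n) \<longlonglongrightarrow> 0" by auto
    have "(\<lambda>n. z * w' n - r *\<^sub>R w' n) \<longlonglongrightarrow> 0" by (rule w'(3)) (simp add: F_def)
    moreover have "(\<lambda>n. agen k * agen k * w' n - (\<rho> k * \<rho> k) *\<^sub>R w' n) \<longlonglongrightarrow> 0" for k
      by (rule w'(3)) (auto simp: F_def)
    moreover have "(\<lambda>n. twisted k (w' n) - \<mu> k *\<^sub>R w' n) \<longlonglongrightarrow> 0" if "k \<in> S" for k
      by (rule w'(3)) (use that in \<open>auto simp: F_def\<close>)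
    ultimately have "Q (insert g S) w' (\<mu>(g := l))"
      using w' insert by (auto simp: P_def Q_def)
    then show ?case by blast
  qed
  then obtain w \<mu> where "Q UNIV w \<mu>" by (metis finite_code)
  then show ?thesis using r by (auto simp: P_def Q_def)
qed

section \<open>Pauli operators\<close>

definition pauli_operator :: "(complex^2^2 \<Rightarrow> complex^4) \<Rightarrow> 4 \<times> 4 \<Rightarrow> 4 cmat" where
  "pauli_operator U g = transported_matrix U (\<lambda>\<eta>. pauli (fst g) ** \<eta> ** pauli (snd g))"

abbreviation line_projection :: "(complex^2^2 \<Rightarrow> complex^4) \<Rightarrow> complex^2^2 \<Rightarrow> 4 cmat" where
  "line_projection U \<xi> \<equiv> transported_matrix U (rank_one_projection \<xi>)"

section \<open>Matrix preliminaries\<close>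

lemma norm_one_cmat [simp]: "norm (1 :: 'n::finite cmat) = 1"
proof -
  have "(1 :: 'n cmat) \<noteq> 0"
    unfolding cmat_entries_inject[symmetric] one_cmat.rep_eq zero_cmat.rep_eq
    by (auto simp: vec_eq_iff mat_def)
  then have "norm (1 :: 'n cmat) \<noteq> 0" by simp
  moreover have "norm (1 :: 'n cmat) * norm (1 :: 'n cmat) = norm (1 :: 'n cmat)"
    using cstar_identity[of "1 :: 'n cmat"] by (simp add: power2_eq_square)
  ultimately show ?thesis by simp
qed

lemma matrix_scale_mult: "matrix_scale c A ** B = matrix_scale c (A ** B)" "A ** matrix_scale c B = matrix_scale c (A ** B)"
  by (simp_all add: matrix_scale_def matrix_matrix_mult_def vec_eq_iff sum_distrib_left mult_ac)

lemma scaleR_matrix_scale: "r *\<^sub>R (A :: complex^'n^'m) = matrix_scale (complex_of_real r) A"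
  by (simp add: vec_eq_iff matrix_scale_def scaleR_conv_of_real[where 'a = complex])

lemma matrix_add_mult: "(A + B) ** C = A ** C + B ** (C :: 'a::semiring_1^'n^'m)" "A ** (D + E) = A ** D + A ** (E :: 'a::semiring_1^'n^'m)"
  by (simp_all add: matrix_matrix_mult_def vec_eq_iff sum.distrib distrib_left distrib_right)

lemma matrix_diff_mult: "(A - B) ** C = A ** C - B ** (C :: 'a::ring_1^'n^'m)" "A ** (D - E) = A ** D - A ** (E :: 'a::ring_1^'n^'m)"
  by (simp_all add: matrix_matrix_mult_def vec_eq_iff sum_subtractf left_diff_distrib right_diff_distrib)

lemma cmat_entries_mult: "cmat_entries (A * B) $ i $ j = (\<Sum>k\<in>UNIV. cmat_entries A $ i $ k * cmat_entries B $ k $ j)"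
  by (simp add: times_cmat.rep_eq matrix_matrix_mult_def)

lemma cmat_entries_star: "cmat_entries (star A) $ i $ j = cnj (cmat_entries A $ j $ i)"
  by (simp add: star_cmat.rep_eq conj_transpose_def)

text \<open>The trace of Q equals that of Q Q*, which is the sum of the squared absolute values of
  the entries.\<close>

lemma hermitian_idempotent_trace_zero:
  fixes Q :: "complex^'n^'n"
  assumes "conj_transpose Q = Q" "Q ** Q = Q" "trace Q = 0"
  shows "Q = 0"
proof -
  have "(\<Sum>i\<in>UNIV. \<Sum>j\<in>UNIV. (cmod (Q $ i $ j))\<^sup>2) = 0"
  proof -
    have "Q $ i $ i = (\<Sum>j\<in>UNIV. complex_of_real ((cmod (Q $ i $ j))\<^sup>2))" for i
    proof -
      have "Q $ i $ i = (Q ** conj_transpose Q) $ i $ i" using assms by simp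
      also have "\<dots> = (\<Sum>j\<in>UNIV. Q $ i $ j * cnj (Q $ i $ j))"
        by (simp add: matrix_matrix_mult_def conj_transpose_def)
      finally show ?thesis by (simp only: complex_norm_square)
    qed
    then have "trace Q = complex_of_real (\<Sum>i\<in>UNIV. \<Sum>j\<in>UNIV. (cmod (Q $ i $ j))\<^sup>2)"
      by (simp add: trace_def)
    then show ?thesis using assms(3) by (metis of_real_eq_0_iff)
  qed
  then have "Q $ i $ j = 0" for i j
    by (simp add: sum_nonneg_eq_0_iff sum_nonneg)
  then show ?thesis by (simp add: vec_eq_iff)
qed

text \<open>A normalised nonzero column of P spans a line in the range of P. Subtracting the
  projection V onto this line leaves a Hermitian idempotent of trace zero.\<close>

lemma hermitian_idempotent_trace_one:
  fixes P :: "complex^'n^'n"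
  assumes P: "conj_transpose P = P" "P ** P = P" and tr: "trace P = 1"
  obtains v where "\<And>i j. P $ i $ j = v $ i * cnj (v $ j)"
proof -
  have "(\<Sum>m\<in>UNIV. P $ m $ m) \<noteq> 0" using tr by (simp add: trace_def)
  then obtain m where m: "P $ m $ m \<noteq> 0" by (meson sum.neutral)
  have herm: "cnj (P $ i $ j) = P $ j $ i" for i j
    using arg_cong[OF P(1), of "\<lambda>A. A $ j $ i"] by (simp add: conj_transpose_def)
  have idem: "(\<Sum>k\<in>UNIV. P $ i $ k * P $ k $ j) = P $ i $ j" for i j
    using arg_cong[OF P(2), of "\<lambda>A. A $ i $ j"] by (simp add: matrix_matrix_mult_def)
  have pos: "P $ m $ m = complex_of_real (\<Sum>j\<in>UNIV. (cmod (P $ m $ j))\<^sup>2)"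
  proof -
    have "P $ m $ m = (\<Sum>j\<in>UNIV. P $ m $ j * cnj (P $ m $ j))" using idem[of m m] by (simp add: herm)
    then show ?thesis by (simp only: complex_norm_square of_real_sum)
  qed
  define t where "t = (\<Sum>j\<in>UNIV. (cmod (P $ m $ j))\<^sup>2)"
  have Pt: "P $ m $ m = complex_of_real t" unfolding t_def by (rule pos)
  have "t \<ge> 0" unfolding t_def by (rule sum_nonneg) simp
  then have Pm: "P $ m $ m = complex_of_real (sqrt t) * complex_of_real (sqrt t)"
    using Pt by (simp flip: of_real_mult)
  \<comment> \<open>The squared norm t of row m, and by symmetry of column m, is the diagonal entry
    \<open>P $ m $ m\<close>, so v is a unit vector.\<close>
  define v :: "complex^'n" where "v = (\<chi> i. P $ i $ m / complex_of_real (sqrt t))"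
  define V :: "complex^'n^'n" where "V = (\<chi> i j. v $ i * cnj (v $ j))"
  have V: "V $ i $ j = P $ i $ m * P $ m $ j / P $ m $ m" for i j
    by (simp add: V_def v_def herm Pm)
  have PV: "P ** V = V"
  proof -
    have "(P ** V) $ i $ j = (\<Sum>k\<in>UNIV. P $ i $ k * P $ k $ m) * (P $ m $ j / P $ m $ m)" for i j
      by (simp add: matrix_matrix_mult_def V sum_distrib_right sum_divide_distrib mult.assoc)
    then show ?thesis by (simp add: idem V vec_eq_iff)
  qed
  have sV: "conj_transpose V = V" by (simp add: V_def conj_transpose_def vec_eq_iff mult.commute)
  have VP: "V ** P = V" using arg_cong[OF PV, of conj_transpose] by (simp add: conj_transpose_mult sV P)
  have VV: "V ** V = V"
  proof -
    have "(V ** V) $ i $ j = (P $ i $ m / P $ m $ m) * (\<Sum>k\<in>UNIV. P $ m $ k * P $ k $ m) * (P $ m $ j / P $ m $ m)" for i j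
      by (simp add: matrix_matrix_mult_def V sum_distrib_right sum_distrib_left mult_ac)
    then show ?thesis using m by (simp add: idem V vec_eq_iff)
  qed
  have trV: "trace V = 1"
  proof -
    have "trace V = (\<Sum>k\<in>UNIV. P $ m $ k * P $ k $ m) / P $ m $ m"
      by (simp add: trace_def V sum_divide_distrib mult.commute)
    then show ?thesis using m by (simp add: idem)
  qed
  have "P - V = 0"
  proof (rule hermitian_idempotent_trace_zero)
    show "conj_transpose (P - V) = P - V" using P(1) sV by (simp add: conj_transpose_def vec_eq_iff)
    show "(P - V) ** (P - V) = P - V"
      by (simp add: matrix_diff_mult P PV VP VV)
    show "trace (P - V) = 0" using tr trV by (simp add: trace_sub)
  qed
  then show thesis using that[of v] by (simp add: V_def)
qed

section \<open>The algebra generated by the Pauli operators\<close>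

context
  fixes U :: "complex^2^2 \<Rightarrow> complex^4"
  assumes U: "hilbert_iso U"
begin

lemma hilbert_iso_facts: "U (a + b) = U a + U b" "U (matrix_scale c a) = c *s U a" "U (inv U v) = v" "inv U (U a) = a"
   "(\<Sum>k\<in>UNIV. U a $ k * cnj (U b $ k)) = tr_inner a b"
  using U by (auto simp: hilbert_iso_def bij_is_surj surj_f_inv_f bij_is_inj)

lemma inv_hilbert_iso: "inv U (v + w) = inv U v + inv U w" "inv U (c *s v) = matrix_scale c (inv U v)"
  by (metis hilbert_iso_facts(1,3,4)) (metis hilbert_iso_facts(2,3,4))

lemma pauli_operator_apply: "cmat_entries (pauli_operator U g) *v U \<eta> = U (pauli (fst g) ** \<eta> ** pauli (snd g))"
proof -
  let ?f = "U \<circ> (\<lambda>\<eta>. pauli (fst g) ** \<eta> ** pauli (snd g)) \<circ> inv U"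
  have "Vector_Spaces.linear (*s) (*s) ?f"
    unfolding Vector_Spaces.linear_iff
    by (simp add: vec.vector_space_axioms inv_hilbert_iso hilbert_iso_facts matrix_add_mult matrix_scale_mult)
  then have "matrix ?f *v U \<eta> = ?f (U \<eta>)" by (rule matrix_works)
  then show ?thesis by (simp add: pauli_operator_def transported_matrix_def Cmat_inverse hilbert_iso_facts)
qed

lemma cmat_eqI: "(\<And>\<eta>. cmat_entries A *v U \<eta> = cmat_entries B *v U \<eta>) \<Longrightarrow> A = B"
  by (metis cmat_entries_inject hilbert_iso_facts(3) matrix_eq)

lemma pauli_operator_mult: "pauli_operator U g * pauli_operator U h = gsign g h *\<^sub>R pauli_operator U (gmul g h)"
proof (rule cmat_eqI)
  fix \<eta>
  have "pauli (fst g) ** (pauli (fst h) ** \<eta> ** pauli (snd h)) ** pauli (snd g) =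
     (pauli (fst g) ** pauli (fst h)) ** \<eta> ** (pauli (snd h) ** pauli (snd g))"
    by (simp only: matrix_mul_assoc)
  also have "\<dots> = matrix_scale (complex_of_real (gsign g h)) (pauli (fst (gmul g h)) ** \<eta> ** pauli (snd (gmul g h)))"
    by (simp add: pauli_mult scaleR_matrix_scale matrix_scale_mult gmul_def gsign_def kmul_commute[of "snd h"])
      (simp add: matrix_scale_def vec_eq_iff)
  finally show "cmat_entries (pauli_operator U g * pauli_operator U h) *v U \<eta> =
      cmat_entries (gsign g h *\<^sub>R pauli_operator U (gmul g h)) *v U \<eta>"
    by (simp add: times_cmat.rep_eq scaleR_cmat.rep_eq pauli_operator_apply hilbert_iso_facts
        flip: matrix_vector_mul_assoc)
      (simp add: scaleR_matrix_scale pauli_operator_apply[symmetric] matrix_vector_mult_def matrix_scale_def vec_eq_iff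
         sum_distrib_left mult.assoc)
qed

lemma pauli_operator_one: "pauli_operator U (1, 1) = 1"
proof (rule cmat_eqI)
  have "pauli 1 = mat 1" by (simp add: pauli_def mat_def vec_eq_iff forall_2)
  then show "cmat_entries (pauli_operator U (1, 1)) *v U \<eta> = cmat_entries 1 *v U \<eta>" for \<eta>
    by (simp add: pauli_operator_apply one_cmat.rep_eq)
qed

lemma pauli_operator_unitary: "star (pauli_operator U g) * pauli_operator U g = 1"
proof -
  let ?W = "cmat_entries (pauli_operator U g)"
  have "(conj_transpose ?W ** ?W) $ i $ j = (mat 1 :: complex^4^4) $ i $ j" for i j
  proof -
    define a where "a k = inv U (axis k (1::complex))" for k
    have col: "?W $ k $ l = U (pauli (fst g) ** a l ** pauli (snd g)) $ k" for k l
    proof -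
      have "?W *v axis l 1 = U (pauli (fst g) ** a l ** pauli (snd g))"
        using pauli_operator_apply[of g "a l"] by (simp add: a_def hilbert_iso_facts)
      moreover have "(?W *v axis l 1) $ k = ?W $ k $ l"
      proof -
        have "(?W *v axis l 1) $ k = (\<Sum>m\<in>UNIV. if m = l then ?W $ k $ m else 0)"
          unfolding matrix_vector_mult_def axis_def vec_lambda_beta by (rule sum.cong) auto
        then show ?thesis by simp
      qed
      ultimately show ?thesis by simp
    qed
    have "(conj_transpose ?W ** ?W) $ i $ j = (\<Sum>k\<in>UNIV. U (pauli (fst g) ** a j ** pauli (snd g)) $ k * cnj (U (pauli (fst g) ** a i ** pauli (snd g)) $ k))"
      by (simp add: matrix_matrix_mult_def conj_transpose_def col mult.commute)
    also have "\<dots> = (\<Sum>k\<in>UNIV. U (a j) $ k * cnj (U (a i) $ k))"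
      by (simp add: hilbert_iso_facts tr_inner_unitary_left tr_inner_unitary_right pauli_unitary)
    also have "\<dots> = (\<Sum>k\<in>UNIV. if k = i then (if k = j then 1 else 0) else 0)"
      by (rule sum.cong) (auto simp: a_def hilbert_iso_facts axis_def)
    finally show ?thesis by (simp add: mat_def)
  qed
  then show ?thesis
    unfolding cmat_entries_inject[symmetric] vec_eq_iff
    by (simp add: times_cmat.rep_eq star_cmat.rep_eq one_cmat.rep_eq)
qed

lemma star_pauli_operator: "star (pauli_operator U g) = gsign g g *\<^sub>R pauli_operator U g"
proof -
  have "pauli_operator U g * (gsign g g *\<^sub>R pauli_operator U g) = 1"
    by (simp add: pauli_operator_mult pauli_operator_one)
  then have "star (pauli_operator U g) =
      (star (pauli_operator U g) * pauli_operator U g) * (gsign g g *\<^sub>R pauli_operator U g)"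
    by (simp only: mult.assoc mult_1_right)
  then show ?thesis by (simp only: pauli_operator_unitary mult_1_left)
qed

lemma pauli_operator_conj:
  "pauli_operator U k * pauli_operator U h * star (pauli_operator U k) = gcomm k h *\<^sub>R pauli_operator U h"
proof -
  have "gmul (gmul k h) k = h" by (metis gmul_cancel gmul_commute)
  moreover have "gsign k k * (gsign k h * gsign (gmul k h) k) = gcomm k h"
    unfolding gsign_gmul gsign_swap[symmetric] using gsign_cases[of k k] by auto
  ultimately show ?thesis
    by (simp add: star_pauli_operator pauli_operator_mult mult.assoc)
qed

lemma norm_pauli_operator: "norm (pauli_operator U g) = 1"
  using cstar_identity[of "pauli_operator U g"] norm_isometry_le_one[OF pauli_operator_unitary[of g]]
  by (simp add: pauli_operator_unitary power2_eq_1_iff) (smt (verit) norm_ge_zero)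

lemma norm_pauli_conj_le: "norm (pauli_operator U k * M * star (pauli_operator U k)) \<le> norm M"
proof -
  have "norm (pauli_operator U k * M * star (pauli_operator U k)) \<le> norm (pauli_operator U k) * norm M * norm (star (pauli_operator U k))"
    by (meson mult_right_mono norm_ge_zero norm_mult_ineq order_trans)
  then show ?thesis by (simp add: norm_pauli_operator)
qed

lemma pauli_conj_sum:
  "pauli_operator U k * (\<Sum>h\<in>UNIV. c h *\<^sub>C pauli_operator U h) * star (pauli_operator U k) =
    (\<Sum>h\<in>UNIV. (complex_of_real (gcomm k h) * c h) *\<^sub>C pauli_operator U h)"
proof -
  have "pauli_operator U k * (c h *\<^sub>C pauli_operator U h) * star (pauli_operator U k) =
      (complex_of_real (gcomm k h) * c h) *\<^sub>C pauli_operator U h" for h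
    using pauli_operator_conj[of k h]
    by (simp add: mult_scaleC_left mult_scaleC_right scaleR_scaleC scaleC_scaleC mult.commute)
  then show ?thesis by (simp add: sum_distrib_left sum_distrib_right)
qed

text \<open>Conjugation by the Pauli operators acts on each of them by a character, so averaging
  against the character of g isolates the coefficient at g.\<close>

lemma pauli_average:
  "(\<Sum>k\<in>UNIV. gcomm k g *\<^sub>R (pauli_operator U k * (\<Sum>h\<in>UNIV. c h *\<^sub>C pauli_operator U h) * star (pauli_operator U k))) =
    (16 * c g) *\<^sub>C pauli_operator U g"
proof -
  have "(\<Sum>k\<in>UNIV. gcomm k g *\<^sub>R (\<Sum>h\<in>UNIV. (complex_of_real (gcomm k h) * c h) *\<^sub>C pauli_operator U h)) =
      (\<Sum>k\<in>UNIV. \<Sum>h\<in>UNIV. gcomm k (gmul g h) *\<^sub>R c h *\<^sub>C pauli_operator U h)"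
    by (simp add: scaleC_sum_right gcomm_gmul scaleR_scaleC scaleC_scaleC mult.assoc)
  also have "\<dots> = (\<Sum>h\<in>UNIV. \<Sum>k\<in>UNIV. gcomm k (gmul g h) *\<^sub>R c h *\<^sub>C pauli_operator U h)"
    by (rule sum.swap)
  also have "\<dots> = (\<Sum>h\<in>UNIV. if g = h then 16 *\<^sub>R c h *\<^sub>C pauli_operator U h else 0)"
    by (rule sum.cong) (simp_all add: gcomm_sum flip: scaleR_sum_left)
  finally show ?thesis by (simp add: pauli_conj_sum scaleR_scaleC scaleC_scaleC)
qed

text \<open>In \<open>pauli_average\<close>, each of the 16 conjugates has norm at most that of the
  whole sum, and the result has norm \<open>16 * cmod (c g)\<close>.\<close>

lemma pauli_coefficient_le: "cmod (c g) \<le> norm (\<Sum>h\<in>UNIV. c h *\<^sub>C pauli_operator U h)"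
proof -
  let ?M = "\<Sum>h\<in>UNIV. c h *\<^sub>C pauli_operator U h"
  have "16 * cmod (c g) = norm (\<Sum>k\<in>UNIV. gcomm k g *\<^sub>R (pauli_operator U k * ?M * star (pauli_operator U k)))"
    unfolding pauli_average by (simp add: norm_scaleC norm_pauli_operator norm_mult)
  also have "\<dots> \<le> (\<Sum>k\<in>(UNIV :: (4 \<times> 4) set). norm ?M)"
  proof (rule sum_norm_le)
    fix k
    have "\<bar>gcomm k g\<bar> = 1" using gcomm_cases[of k g] by auto
    then show "norm (gcomm k g *\<^sub>R (pauli_operator U k * ?M * star (pauli_operator U k))) \<le> norm ?M"
      by (simp add: norm_pauli_conj_le)
  qed
  finally show ?thesis by simp
qed

lemma line_projection_conj:
  assumes "tr_inner \<xi> \<xi> = 1"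
  shows "pauli_operator U g * line_projection U \<xi> * star (pauli_operator U g) =
    line_projection U (pauli (fst g) ** \<xi> ** pauli (snd g))"
proof -
  let ?W = "cmat_entries (pauli_operator U g)" and ?\<eta> = "pauli (fst g) ** \<xi> ** pauli (snd g)"
  have n: "tr_inner ?\<eta> ?\<eta> = 1"
    using assms by (simp add: tr_inner_unitary_left tr_inner_unitary_right pauli_unitary)
  have W: "(\<Sum>l\<in>UNIV. ?W $ k $ l * U \<xi> $ l) = U ?\<eta> $ k" for k
    using arg_cong[OF pauli_operator_apply[of g \<xi>], of "\<lambda>v. v $ k"] by (simp add: matrix_vector_mult_def)
  have WA: "cmat_entries (pauli_operator U g * line_projection U \<xi>) $ i $ k = U ?\<eta> $ i * cnj (U \<xi> $ k)" for i k
  proof -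
    have "cmat_entries (pauli_operator U g * line_projection U \<xi>) $ i $ k =
        (\<Sum>l\<in>UNIV. ?W $ i $ l * U \<xi> $ l) * cnj (U \<xi> $ k)"
      by (simp add: cmat_entries_mult transported_projection_entry[OF U assms] sum_distrib_right mult.assoc)
    then show ?thesis by (simp only: W)
  qed
  have "cmat_entries (pauli_operator U g * line_projection U \<xi> * star (pauli_operator U g)) $ i $ j =
      (\<Sum>k\<in>UNIV. U ?\<eta> $ i * cnj (U \<xi> $ k) * cnj (?W $ j $ k))" for i j
    by (simp only: cmat_entries_mult[of "_ * _"] cmat_entries_star WA)
  also have "\<dots> i j = U ?\<eta> $ i * cnj (U ?\<eta> $ j)" for i j
    unfolding W[symmetric, of j] by (simp add: sum_distrib_left mult_ac)
  finally show ?thesis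
    unfolding cmat_entries_inject[symmetric] vec_eq_iff
    by (simp add: transported_projection_entry[OF U n])
qed

end

section \<open>Faithfulness\<close>

text \<open>The hypothesis says that \<xi>\<xi>* has zero trace against each nontrivial Pauli
  matrix, so it is scalar, and the normalisation makes it 1. The proof carries this out in the
  entries a, b, c, d.\<close>

lemma unitary_of_pauli_orthogonal:
  assumes n: "tr_inner \<xi> \<xi> = 1" and o: "\<And>i. i \<noteq> 1 \<Longrightarrow> tr_inner (pauli i ** \<xi>) \<xi> = 0"
  shows "conj_transpose \<xi> ** \<xi> = mat 1"
proof -
  define a b c d where "a = \<xi> $ 1 $ 1" "b = \<xi> $ 1 $ 2" "c = \<xi> $ 2 $ 1" "d = \<xi> $ 2 $ 2"
  note D = tr_inner_def trace_def conj_transpose_def matrix_matrix_mult_def sum_2 pauli_def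
  have 1: "cnj a * a + cnj c * c + (cnj b * b + cnj d * d) = 2"
    using n by (simp add: D a_b_c_d_def field_simps)
  have 2: "\<i> * (cnj a * a + cnj b * b - cnj c * c - cnj d * d) = 0"
    using o[of 2] by (simp add: D a_b_c_d_def algebra_simps)
  have 3: "cnj a * c + cnj b * d - cnj c * a - cnj d * b = 0"
    using o[of 3] by (simp add: D a_b_c_d_def algebra_simps)
  have 4: "\<i> * (cnj a * c + cnj b * d + cnj c * a + cnj d * b) = 0"
    using o[of 4] by (simp add: D a_b_c_d_def algebra_simps)
  have e2: "cnj a * a + cnj b * b - cnj c * c - cnj d * d = 0"
    and e4: "cnj a * c + cnj b * d + cnj c * a + cnj d * b = 0" using 2 4 by simp_all
  have half: "x = 1" if "2 * x = 2" for x :: complex using that by simp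
  have "2 * (a * cnj a + b * cnj b) = cnj a * a + cnj c * c + (cnj b * b + cnj d * d) +
      (cnj a * a + cnj b * b - cnj c * c - cnj d * d)" by (simp add: algebra_simps)
  moreover have "2 * (c * cnj c + d * cnj d) = cnj a * a + cnj c * c + (cnj b * b + cnj d * d) -
      (cnj a * a + cnj b * b - cnj c * c - cnj d * d)" by (simp add: algebra_simps)
  ultimately have "a * cnj a + b * cnj b = 1" "c * cnj c + d * cnj d = 1" 
    unfolding 1 e2 add_0_right diff_0_right using half by blast+
  moreover have "c * cnj a + d * cnj b = 0" "a * cnj c + b * cnj d = 0"
    using 3 e4 by algebra+
  ultimately have "\<xi> ** conj_transpose \<xi> = mat 1"
    by (simp add: vec_eq_iff forall_2 matrix_matrix_mult_def conj_transpose_def sum_2 mat_def a_b_c_d_def)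
  then show ?thesis using matrix_left_right_inverse by blast
qed

text \<open>Substituting \<open>gmul g m\<close> for h collects the terms at S m. The new
  coefficients do not depend on S, which allows the same computation for the Pauli operators and for
  the shifted vectors.\<close>

lemma sum_regroup:
  fixes S :: "4 \<times> 4 \<Rightarrow> 'a::cstar_algebra"
  shows "(\<Sum>h\<in>UNIV. c h *\<^sub>C ((1/4) *\<^sub>R (\<Sum>g\<in>UNIV. r g h *\<^sub>R S (gmul g h)))) =
    (\<Sum>m\<in>UNIV. ((1/4) * (\<Sum>g\<in>UNIV. complex_of_real (r g (gmul g m)) * c (gmul g m))) *\<^sub>C S m)"
proof -
  have scaleC_sum_left: "(\<Sum>x\<in>A. f x) *\<^sub>C s = (\<Sum>x\<in>A. f x *\<^sub>C s)" for f :: "4 \<times> 4 \<Rightarrow> complex" and A and s :: 'a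
    by (induction A rule: infinite_finite_induct) (simp_all add: scaleC_add_left)
  have "(\<Sum>h\<in>UNIV. c h *\<^sub>C ((1/4) *\<^sub>R (\<Sum>g\<in>UNIV. r g h *\<^sub>R S (gmul g h)))) =
     (\<Sum>g\<in>UNIV. \<Sum>h\<in>UNIV. ((1/4) * (complex_of_real (r g h) * c h)) *\<^sub>C S (gmul g h))"
    by (subst sum.swap) (simp add: scaleC_sum_right scaleR_scaleC scaleC_scaleC scaleR_sum_right mult_ac)
  also have "\<dots> = (\<Sum>g\<in>UNIV. \<Sum>m\<in>UNIV. ((1/4) * (complex_of_real (r g (gmul g m)) * c (gmul g m))) *\<^sub>C S m)"
  proof (rule sum.cong[OF refl])
    fix g
    show "(\<Sum>h\<in>UNIV. ((1/4) * (complex_of_real (r g h) * c h)) *\<^sub>C S (gmul g h)) =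
      (\<Sum>m\<in>UNIV. ((1/4) * (complex_of_real (r g (gmul g m)) * c (gmul g m))) *\<^sub>C S m)"
      using sum_gmul[of "\<lambda>h. ((1/4) * (complex_of_real (r g h) * c h)) *\<^sub>C S (gmul g h)" g] by simp
  qed
  also have "\<dots> = (\<Sum>m\<in>UNIV. \<Sum>g\<in>UNIV. ((1/4) * (complex_of_real (r g (gmul g m)) * c (gmul g m))) *\<^sub>C S m)"
    by (rule sum.swap)
  finally show ?thesis by (simp only: scaleC_sum_left sum_distrib_left)
qed

lemma sum_delta_scaleC:
  fixes S :: "'i::finite \<Rightarrow> 'a::cstar_algebra"
  shows "(\<Sum>h\<in>UNIV. (if h = k then d else 0) *\<^sub>C S h) = d *\<^sub>C S k"
proof -
  have "(\<Sum>h\<in>UNIV. (if h = k then d else 0) *\<^sub>C S h) = (\<Sum>h\<in>UNIV. if h = k then d *\<^sub>C S h else 0)"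
    by (rule sum.cong) auto
  then show ?thesis by simp
qed

lemma unit_sequence_scale:
  fixes w :: "nat \<Rightarrow> 'a::real_normed_vector"
  assumes "\<And>n. norm (w n) = 1" "(\<lambda>n. r *\<^sub>R w n) \<longlonglongrightarrow> 0"
  shows "r = 0"
  using tendsto_norm[OF assms(2)] by (simp add: assms(1) LIMSEQ_const_iff)

text \<open>Each relation between the generators is applied to the vectors \<open>w n\<close>, on
  which the twisted operators act as scalars up to a vanishing error. Unit vectors then force the
  corresponding relation between the scalars.\<close>

lemma eigenvalue_relations:
  assumes w: "\<And>n::nat. norm (w n) = 1" "\<And>g. (\<lambda>n. twisted g (w n) - \<mu> g *\<^sub>R w n) \<longlonglongrightarrow> 0"
  shows "\<mu> (1, 1) = 1" "\<And>g. gsign g g = - 1 \<Longrightarrow> \<mu> g = 0"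
    "\<And>m. (\<Sum>g\<in>UNIV. gsign g (gmul g m) * (\<mu> g * \<mu> (gmul g m))) = 4 * \<mu> m"
    "\<And>i m. i \<noteq> 1 \<Longrightarrow> (\<Sum>g\<in>UNIV. gcomm (i, 1) (gmul g m) * (gsign g (gmul g m) * (\<mu> g * \<mu> (gmul g m)))) = 0"
proof -
  note U = magic_unitary_universal[where 'a = 4]
  have "(\<lambda>n. (1 - \<mu> (1, 1)) *\<^sub>R w n) \<longlonglongrightarrow> 0"
    using w(2)[of "(1, 1)"] by (simp add: twisted_def fourier_one[OF U] scaleR_left_diff_distrib)
  from unit_sequence_scale[OF w(1) this] show "\<mu> (1, 1) = 1" by simp
  show "\<mu> g = 0" if g: "gsign g g = - 1" for g
  proof -
    have "(\<lambda>n. (- \<mu> g) *\<^sub>R w n) \<longlonglongrightarrow> 0"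
      using w(2)[of g] by (simp add: twisted_def agen_eq_zero[OF g])
    from unit_sequence_scale[OF w(1) this] show ?thesis by simp
  qed
  have prod: "(\<lambda>n. twisted g (twisted h (w n)) - (\<mu> g * \<mu> h) *\<^sub>R w n) \<longlonglongrightarrow> 0" for g h
  proof -
    have "(\<lambda>n. twisted g (twisted h (w n) - \<mu> h *\<^sub>R w n) + \<mu> h *\<^sub>R (twisted g (w n) - \<mu> g *\<^sub>R w n)) \<longlonglongrightarrow>
        twisted g 0 + \<mu> h *\<^sub>R 0"
      by (intro tendsto_add tendsto_scaleR tendsto_const w bounded_linear.tendsto[OF bounded_linear_twisted])
    then show ?thesis
      by (simp add: linear_simps[OF bounded_linear_twisted] scaleR_diff_right mult.commute)
  qed
  \<comment> \<open>Since g times \<open>gmul g m\<close> is m, every product of two twisted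
    operators in the sum ends in the same translation by \<open>gchar m\<close>; the sum of
    generator products can be taken out in front of it. The weights e are 1 or a character.\<close>
  have key: "(\<lambda>n. (\<Sum>g\<in>UNIV. e g *\<^sub>R (agen g * agen (gmul g m))) * translate (gchar m) (w n) -
     (\<Sum>g\<in>UNIV. e g * (gsign g (gmul g m) * (\<mu> g * \<mu> (gmul g m)))) *\<^sub>R w n) \<longlonglongrightarrow> 0" for e m
  proof -
    have "(\<lambda>n. \<Sum>g\<in>UNIV. (e g * gsign g (gmul g m)) *\<^sub>R
        (twisted g (twisted (gmul g m) (w n)) - (\<mu> g * \<mu> (gmul g m)) *\<^sub>R w n)) \<longlonglongrightarrow> (\<Sum>g\<in>(UNIV :: (4 \<times> 4) set). (e g * gsign g (gmul g m)) *\<^sub>R 0)"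
      by (intro tendsto_sum tendsto_scaleR tendsto_const prod)
    moreover have "(e g * gsign g (gmul g m)) *\<^sub>R
        (twisted g (twisted (gmul g m) v) - (\<mu> g * \<mu> (gmul g m)) *\<^sub>R v) =
        e g *\<^sub>R (agen g * agen (gmul g m)) * translate (gchar m) v -
        (e g * (gsign g (gmul g m) * (\<mu> g * \<mu> (gmul g m)))) *\<^sub>R v" for g v
      by (simp add: twisted_twisted scaleR_diff_right mult.assoc)
    ultimately show ?thesis
      by (simp add: sum_subtractf sum_distrib_right scaleR_sum_left)
  qed
  show "(\<Sum>g\<in>UNIV. gsign g (gmul g m) * (\<mu> g * \<mu> (gmul g m))) = 4 * \<mu> m" for m
  proof -
    define s where "s = (\<Sum>g\<in>UNIV. gsign g (gmul g m) * (\<mu> g * \<mu> (gmul g m)))"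
    have 1: "(\<lambda>n. 4 *\<^sub>R twisted m (w n) - s *\<^sub>R w n) \<longlonglongrightarrow> 0"
      using key[of "\<lambda>_. 1" m] by (simp add: fourier_square_sum[OF U] twisted_def s_def)
    have 2: "(\<lambda>n. 4 *\<^sub>R (twisted m (w n) - \<mu> m *\<^sub>R w n)) \<longlonglongrightarrow> 4 *\<^sub>R 0"
      by (intro tendsto_scaleR tendsto_const w)
    have "(\<lambda>n. (s - 4 * \<mu> m) *\<^sub>R w n) \<longlonglongrightarrow> 0"
      using tendsto_diff[OF 2 1] by (simp add: scaleR_diff_right scaleR_left_diff_distrib)
    from unit_sequence_scale[OF w(1) this] show ?thesis by (simp add: s_def)
  qed
  show "(\<Sum>g\<in>UNIV. gcomm (i, 1) (gmul g m) * (gsign g (gmul g m) * (\<mu> g * \<mu> (gmul g m)))) = 0"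
    if i: "i \<noteq> 1" for i m
  proof -
    define s where "s = (\<Sum>g\<in>UNIV. gcomm (i, 1) (gmul g m) * (gsign g (gmul g m) * (\<mu> g * \<mu> (gmul g m))))"
    have "(\<lambda>n. (- s) *\<^sub>R w n) \<longlonglongrightarrow> 0"
      using key[of "\<lambda>g. gcomm (i, 1) (gmul g m)" m] by (simp add: fourier_orthogonal_sum[OF U i] s_def)
    from unit_sequence_scale[OF w(1) this] show ?thesis by (simp add: s_def)
  qed
qed

section \<open>Values of the Pauli representation at points of \<open>SU2\<close>\<close>

context
  fixes U :: "complex^2^2 \<Rightarrow> complex^4"
  assumes U: "hilbert_iso U"
begin

abbreviation "W \<equiv> pauli_operator U"

lemma pauli_eval_hom: "star_hom (\<lambda>y. apply_bcontfun (pauli_representation U y) x)"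
  using pauli_representation_hom[OF U]
  by (simp add: star_hom_def times_bcontfun.rep_eq star_bcontfun.rep_eq one_bcontfun.rep_eq scaleC_bcontfun.rep_eq)

lemma pauli_operator_unitary': "W g * star (W g) = 1"
  by (simp add: star_pauli_operator[OF U] pauli_operator_mult[OF U] pauli_operator_one[OF U])

lemma pauli_magic_conj:
  "apply_bcontfun (pauli_magic U i j) x = W (i, j) * line_projection U (SU2_matrix x) * star (W (i, j))"
proof -
  have "tr_inner (SU2_matrix x) (SU2_matrix x) = 1"
    using SU2_unitary[of x] by (simp add: tr_inner_def trace_def mat_def)
  then show ?thesis by (simp add: pauli_magic_apply[OF U] line_projection_conj[OF U])
qed

text \<open>Both sides are *-homomorphisms in y, so the generators suffice. There
  \<open>W h * W (i, j)\<close> is a Pauli operator up to a sign, which cancels in the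
  conjugation.\<close>

lemma pauli_eval_translate:
  "apply_bcontfun (pauli_representation U (translate h y)) x =
    W h * apply_bcontfun (pauli_representation U y) x * star (W h)"
proof -
  have W1: "star (W h) * (W h * M) = M" for M
    using pauli_operator_unitary[OF U, of h] by (simp flip: mult.assoc)
  have "(\<lambda>y. apply_bcontfun (pauli_representation U (translate h y)) x) =
    (\<lambda>y. W h * apply_bcontfun (pauli_representation U y) x * star (W h))"
  proof (rule star_hom_A_s_eqI)
    show "star_hom (\<lambda>y. apply_bcontfun (pauli_representation U (translate h y)) x)"
      by (rule star_hom_compose[OF pauli_eval_hom star_hom_translate])
    show "star_hom (\<lambda>y. W h * apply_bcontfun (pauli_representation U y) x * star (W h))"
      using pauli_eval_hom[of x] unfolding star_hom_def
      by (simp add: distrib_left distrib_right mult_scaleC_left mult_scaleC_right pauli_operator_unitary'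
          star_mult star_star mult.assoc W1)
    fix i j
    have "W h * W (i, j) * M * star (W (i, j)) * star (W h) = W (gmul h (i, j)) * M * star (W (gmul h (i, j)))" for M
    proof -
      have s: "star (W (i, j)) * star (W h) = gsign h (i, j) *\<^sub>R star (W (gmul h (i, j)))"
        by (simp add: pauli_operator_mult[OF U] star_scaleR flip: star_mult)
      have "W h * W (i, j) * M * star (W (i, j)) * star (W h) = (W h * W (i, j)) * M * (star (W (i, j)) * star (W h))"
        by (simp only: mult.assoc)
      then show ?thesis unfolding s pauli_operator_mult[OF U] by simp
    qed
    then show "apply_bcontfun (pauli_representation U (translate h (universal_magic i j))) x =
      W h * apply_bcontfun (pauli_representation U (universal_magic i j)) x * star (W h)"
      using translate_gen[of h "(i, j)"]
      by (simp add: gentry_def pauli_representation_generator[OF U] pauli_magic_conj gmul_def mult.assoc)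
  qed
  then show ?thesis by metis
qed

text \<open>The element P with coefficients \<mu> is self-adjoint by \<open>zero\<close>, idempotent
  by \<open>idem\<close> and of trace 1 by \<open>one\<close>, hence the projection onto a line. By
  \<open>orth\<close> this line is orthogonal to its multiples by nontrivial Pauli matrices, so its
  unit vectors are unitary matrices, and one of them has determinant 1.\<close>

lemma realize_eigenvalues:
  fixes \<mu> :: "4 \<times> 4 \<Rightarrow> real"
  assumes one: "\<mu> (1, 1) = 1" and zero: "\<And>g. gsign g g = - 1 \<Longrightarrow> \<mu> g = 0"
    and idem: "\<And>m. (\<Sum>g\<in>UNIV. gsign g (gmul g m) * (\<mu> g * \<mu> (gmul g m))) = 4 * \<mu> m"
    and orth: "\<And>i m. i \<noteq> 1 \<Longrightarrow>
      (\<Sum>g\<in>UNIV. gcomm (i, 1) (gmul g m) * (gsign g (gmul g m) * (\<mu> g * \<mu> (gmul g m)))) = 0"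
  shows "\<exists>x. \<forall>k. apply_bcontfun (gentry (pauli_magic U) k) x = (1/4) *\<^sub>R (\<Sum>g\<in>UNIV. (gcomm g k * \<mu> g) *\<^sub>R W g)"
proof -
  define D where "D k = (1/4) *\<^sub>R (\<Sum>g\<in>UNIV. (gcomm g k * \<mu> g) *\<^sub>R W g)" for k
  define P where "P = D (1, 1)"
  have P_sum: "P = (1/4) *\<^sub>R (\<Sum>g\<in>UNIV. \<mu> g *\<^sub>R W g)" by (simp add: P_def D_def)
  have D: "D k = W k * P * star (W k)" for k
    by (simp add: P_sum D_def sum_distrib_left sum_distrib_right pauli_operator_conj[OF U] gcomm_commute[of _ k] mult.commute)
  have PD: "P * D k = (1/16) *\<^sub>R (\<Sum>m\<in>UNIV. (\<Sum>g\<in>UNIV. gcomm k (gmul g m) * (gsign g (gmul g m) * (\<mu> g * \<mu> (gmul g m)))) *\<^sub>R W m)" for k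
  proof -
    let ?r = "\<lambda>g h. gcomm k h * (gsign g h * (\<mu> g * \<mu> h))"
    have "P * D k = (1/16) *\<^sub>R (\<Sum>g\<in>UNIV. \<Sum>h\<in>UNIV. ?r g h *\<^sub>R W (gmul g h))"
      by (simp add: P_sum D_def sum_product pauli_operator_mult[OF U] gcomm_commute[of _ k] mult_ac)
    also have "(\<Sum>g\<in>UNIV. \<Sum>h\<in>UNIV. ?r g h *\<^sub>R W (gmul g h)) = (\<Sum>g\<in>UNIV. \<Sum>m\<in>UNIV. ?r g (gmul g m) *\<^sub>R W m)"
    proof (rule sum.cong[OF refl])
      fix g
      show "(\<Sum>h\<in>UNIV. ?r g h *\<^sub>R W (gmul g h)) = (\<Sum>m\<in>UNIV. ?r g (gmul g m) *\<^sub>R W m)"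
        using sum_gmul[of "\<lambda>h. ?r g h *\<^sub>R W (gmul g h)" g] by simp
    qed
    also have "\<dots> = (\<Sum>m\<in>UNIV. \<Sum>g\<in>UNIV. ?r g (gmul g m) *\<^sub>R W m)" by (rule sum.swap)
    finally show ?thesis by (simp only: scaleR_sum_left)
  qed
  have PP: "P * P = P"
    using PD[of "(1, 1)"] idem by (simp add: P_sum[symmetric] flip: P_def) (simp add: P_sum scaleR_sum_right)
  have sP: "star P = P"
  proof -
    have "\<mu> g * gsign g g = \<mu> g" for g using zero[of g] gsign_cases[of g g] by auto
    moreover have "star P = (1/4) *\<^sub>R (\<Sum>g\<in>UNIV. (\<mu> g * gsign g g) *\<^sub>R W g)"
      by (simp add: P_sum star_scaleR star_sum star_pauli_operator[OF U])
    ultimately show ?thesis by (simp only: P_sum)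
  qed
  \<comment> \<open>The 16 conjugates D k of P have the same trace, and by character orthogonality
    they add up to 4 times the identity, whose trace is 16.\<close>
  have "trace (cmat_entries P) = 1"
  proof -
    have "trace (cmat_entries (D k)) = trace (cmat_entries P)" for k
    proof -
      have "trace (cmat_entries (W k * P * star (W k))) = trace (cmat_entries (star (W k) * (W k * P)))"
        unfolding times_cmat.rep_eq by (rule trace_mul_sym)
      also have "star (W k) * (W k * P) = P" using pauli_operator_unitary[OF U, of k] by (simp flip: mult.assoc)
      finally show ?thesis by (simp only: D)
    qed
    then have "trace (cmat_entries (\<Sum>k\<in>UNIV. D k)) = 16 * trace (cmat_entries P)"
      unfolding trace_def cmat_entries_sum[OF U] by (simp add: sum.swap[of _ UNIV UNIV])
    moreover have "(\<Sum>k\<in>UNIV. D k) = 4 *\<^sub>R 1"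
    proof -
      have "(\<Sum>k\<in>UNIV. D k) = (1/4) *\<^sub>R (\<Sum>k\<in>UNIV. \<Sum>g\<in>UNIV. (gcomm k g * \<mu> g) *\<^sub>R W g)"
        by (simp add: D_def gcomm_commute scaleR_sum_right)
      also have "(\<Sum>k\<in>UNIV. \<Sum>g\<in>UNIV. (gcomm k g * \<mu> g) *\<^sub>R W g) = (\<Sum>g\<in>UNIV. \<Sum>k\<in>UNIV. (gcomm k g * \<mu> g) *\<^sub>R W g)"
        by (rule sum.swap)
      also have "\<dots> = (\<Sum>g\<in>UNIV. ((\<Sum>k\<in>UNIV. gcomm k g) * \<mu> g) *\<^sub>R W g)"
        by (simp only: scaleR_sum_left sum_distrib_right)
      also have "\<dots> = (\<Sum>g\<in>UNIV. if g = (1, 1) then (16 * \<mu> g) *\<^sub>R W g else 0)"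
        by (rule sum.cong) (simp_all add: gcomm_sum)
      finally show ?thesis by (simp add: one pauli_operator_one[OF U])
    qed
    moreover have "trace (cmat_entries (4 *\<^sub>R (1 :: 4 cmat))) = 16"
      by (simp add: scaleR_cmat.rep_eq one_cmat.rep_eq trace_def mat_def scaleR_conv_of_real[where 'a = complex])
    ultimately show ?thesis by simp
  qed
  moreover have "cmat_entries P ** cmat_entries P = cmat_entries P" "conj_transpose (cmat_entries P) = cmat_entries P"
    using PP sP by (metis times_cmat.rep_eq, metis star_cmat.rep_eq)
  ultimately obtain v where v: "\<And>i j. cmat_entries P $ i $ j = v $ i * cnj (v $ j)"
    using hermitian_idempotent_trace_one by metis
  define \<xi> where "\<xi> = inv U v"
  have U\<xi>: "U \<xi> = v" by (simp add: \<xi>_def hilbert_iso_facts[OF U])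
  have n: "tr_inner \<xi> \<xi> = 1"
    using \<open>trace (cmat_entries P) = 1\<close> by (simp add: trace_def v U\<xi> flip: hilbert_iso_facts(5)[OF U])
  have P: "P = line_projection U \<xi>"
    unfolding cmat_entries_inject[symmetric] vec_eq_iff
    by (simp add: v transported_projection_entry[OF U n] U\<xi>)
  have Dp: "D k = line_projection U (pauli (fst k) ** \<xi> ** pauli (snd k))" for k
    by (simp add: D P line_projection_conj[OF U n])
  have nz: "\<exists>k. U a $ k \<noteq> 0" if "tr_inner a a = 1" for a
  proof (rule ccontr)
    assume "\<not> (\<exists>k. U a $ k \<noteq> 0)"
    then have "tr_inner a a = 0" by (simp flip: hilbert_iso_facts(5)[OF U])
    then show False using that by simp
  qed
  have "conj_transpose \<xi> ** \<xi> = mat 1"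
  proof (rule unitary_of_pauli_orthogonal[OF n])
    fix i :: 4 assume i: "i \<noteq> 1"
    have "pauli 1 = mat 1" by (simp add: pauli_def mat_def vec_eq_iff forall_2)
    then have "D (i, 1) = line_projection U (pauli i ** \<xi>)" by (simp add: Dp)
    moreover have "P * D (i, 1) = 0" by (simp add: PD orth[OF i])
    ultimately have 0: "line_projection U \<xi> * line_projection U (pauli i ** \<xi>) = 0" by (simp add: P)
    have n': "tr_inner (pauli i ** \<xi>) (pauli i ** \<xi>) = 1"
      by (simp add: tr_inner_unitary_left pauli_unitary n)
    have "U \<xi> $ k * tr_inner (pauli i ** \<xi>) \<xi> * cnj (U (pauli i ** \<xi>) $ l) = 0" for k l
      using transported_projection_mult[OF U n n', of k l] by (simp add: 0 zero_cmat.rep_eq)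
    then show "tr_inner (pauli i ** \<xi>) \<xi> = 0" using nz[OF n] nz[OF n'] by auto
  qed
  note uni = this
  have "cnj (det \<xi>) * det \<xi> = det (conj_transpose \<xi> ** \<xi>)"
    by (simp add: det_mul) (simp add: det_2 conj_transpose_def mult.commute)
  then have det: "cnj (det \<xi>) * det \<xi> = 1" by (simp add: uni)
  \<comment> \<open>The phase \<zeta> is a root of the inverse of the determinant, so that
    \<zeta>\<xi> has determinant 1; a phase does not change the line.\<close>
  define \<zeta> where "\<zeta> = csqrt (cnj (det \<xi>))"
  have \<zeta>: "\<zeta> * \<zeta> * det \<xi> = 1" using det by (simp add: \<zeta>_def flip: power2_eq_square)
  have "cmod (det \<xi>) = 1"
    using arg_cong[OF det, of cmod] by (simp add: norm_mult) (metis abs_norm_cancel abs_square_eq_1 power2_eq_square)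
  then have "cmod \<zeta> = 1" by (simp add: \<zeta>_def norm_csqrt)
  then have \<zeta>1: "cnj \<zeta> * \<zeta> = 1" by (metis complex_norm_square mult.commute of_real_1 power_one)
  define X where "X = matrix_scale \<zeta> \<xi>"
  have cX: "conj_transpose X = matrix_scale (cnj \<zeta>) (conj_transpose \<xi>)"
    by (simp add: X_def conj_transpose_def matrix_scale_def vec_eq_iff)
  have "conj_transpose X ** X = matrix_scale (cnj \<zeta> * \<zeta>) (conj_transpose \<xi> ** \<xi>)"
    unfolding cX by (simp add: X_def matrix_scale_mult) (simp add: matrix_scale_def mult.left_commute mult.assoc)
  then have "conj_transpose X ** X = mat 1"
    unfolding \<zeta>1 uni by (simp add: matrix_scale_def vec_eq_iff)
  moreover have "det X = 1" using \<zeta> by (simp add: X_def det_2 matrix_scale_def algebra_simps)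
  ultimately have X: "SU2_matrix (Abs_SU2 X) = X" by (simp add: Abs_SU2_inverse)
  have "line_projection U X = line_projection U \<xi>"
  proof -
    have nX: "tr_inner X X = 1"
      using \<open>conj_transpose X ** X = mat 1\<close> by (simp add: tr_inner_def trace_def mat_def)
    have "\<zeta> * a * (cnj \<zeta> * b) = a * b" for a b
      using \<zeta>1 by (metis mult.assoc mult.commute mult.left_commute mult_1_left)
    then show ?thesis unfolding cmat_entries_inject[symmetric] vec_eq_iff
      by (simp add: transported_projection_entry[OF U nX] transported_projection_entry[OF U n])
        (simp add: X_def hilbert_iso_facts[OF U])
  qed
  then have "apply_bcontfun (gentry (pauli_magic U) k) (Abs_SU2 X) = D k" for k
    by (simp add: gentry_def pauli_magic_conj X D P)
  then show ?thesis unfolding D_def by blast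
qed

text \<open>The same coefficients c work for both claims because the generators act on the shifted
  vectors by the cocycle with which the Pauli operators multiply, and with the same scalars \<mu>.
  The induction runs over words, adding one letter on the left.\<close>

lemma approx_symbol:
  assumes w: "\<And>g. (\<lambda>n. twisted g (w n) - \<mu> g *\<^sub>R w n) \<longlonglongrightarrow> 0"
    and x: "\<And>k. apply_bcontfun (gentry (pauli_magic U) k) x = (1/4) *\<^sub>R (\<Sum>g\<in>UNIV. (gcomm g k * \<mu> g) *\<^sub>R W g)"
  shows "\<exists>c. apply_bcontfun (pauli_representation U (free_embed q)) x = (\<Sum>h\<in>UNIV. c h *\<^sub>C W h) \<and>
     (\<lambda>n::nat. free_embed q * w n - (\<Sum>h\<in>UNIV. c h *\<^sub>C shifted h (w n))) \<longlonglongrightarrow> 0"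
proof -
  define \<pi> where "\<pi> y = apply_bcontfun (pauli_representation U y) x" for y
  have hom: "star_hom \<pi>" unfolding \<pi>_def by (rule pauli_eval_hom)
  define G where "G q \<longleftrightarrow> (\<exists>c. \<pi> (free_embed q) = (\<Sum>h\<in>UNIV. c h *\<^sub>C W h) \<and>
     (\<lambda>n. free_embed q * w n - (\<Sum>h\<in>UNIV. c h *\<^sub>C shifted h (w n))) \<longlonglongrightarrow> 0)" for q
  have gen: "(\<lambda>n. gentry universal_magic k * shifted h (w n) -
      (1/4) *\<^sub>R (\<Sum>g\<in>UNIV. (gcomm g k * \<mu> g * gsign g h) *\<^sub>R shifted (gmul g h) (w n))) \<longlonglongrightarrow> 0" for k h
  proof -
    have "(\<lambda>n. (1/4) *\<^sub>R (\<Sum>g\<in>UNIV. (gcomm g k * gsign g h) *\<^sub>R shifted (gmul g h) (twisted g (w n) - \<mu> g *\<^sub>R w n)))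
       \<longlonglongrightarrow> (1/4) *\<^sub>R (\<Sum>g\<in>(UNIV :: (4 \<times> 4) set). (gcomm g k * gsign g h) *\<^sub>R shifted (gmul g h) 0)"
      by (intro tendsto_scaleR tendsto_sum tendsto_const w bounded_linear.tendsto[OF bounded_linear_shifted])
    moreover have "gentry universal_magic k * shifted h v - (1/4) *\<^sub>R (\<Sum>g\<in>UNIV. (gcomm g k * \<mu> g * gsign g h) *\<^sub>R shifted (gmul g h) v)
       = (1/4) *\<^sub>R (\<Sum>g\<in>UNIV. (gcomm g k * gsign g h) *\<^sub>R shifted (gmul g h) (twisted g v - \<mu> g *\<^sub>R v))" for v
      by (simp add: fourier_inverse[of universal_magic k] sum_distrib_right agen_shifted
          linear_simps[OF bounded_linear_shifted] scaleR_diff_right sum_subtractf mult_ac)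
    ultimately show ?thesis by (simp add: linear_simps[OF bounded_linear_shifted])
  qed
  have step: "G (free_gen i j * q)" if q: "G q" for i j q
  proof -
    obtain c where c: "\<pi> (free_embed q) = (\<Sum>h\<in>UNIV. c h *\<^sub>C W h)"
     "(\<lambda>n. free_embed q * w n - (\<Sum>h\<in>UNIV. c h *\<^sub>C shifted h (w n))) \<longlonglongrightarrow> 0" using q unfolding G_def by blast
    let ?k = "(i, j)"
    let ?r = "\<lambda>g h. gcomm g ?k * \<mu> g * gsign g h"
    \<comment> \<open>These are the coefficients that \<open>sum_regroup\<close> produces for the
      left multiplication by one matrix entry.\<close>
    define c' where "c' m = (1/4) * (\<Sum>g\<in>UNIV. complex_of_real (?r g (gmul g m)) * c (gmul g m))" for m
    have "\<pi> (free_embed (free_gen i j * q)) = \<pi> (universal_magic i j) * (\<Sum>h\<in>UNIV. c h *\<^sub>C W h)"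
      using hom c(1) by (simp add: free_embed_mult free_embed_gen star_hom_def)
    also have "\<pi> (universal_magic i j) = (1/4) *\<^sub>R (\<Sum>g\<in>UNIV. (gcomm g ?k * \<mu> g) *\<^sub>R W g)"
      using x[of ?k] by (simp add: \<pi>_def pauli_representation_generator[OF U] gentry_def)
    also have "\<dots> * (\<Sum>h\<in>UNIV. c h *\<^sub>C W h) = (\<Sum>h\<in>UNIV. c h *\<^sub>C ((1/4) *\<^sub>R (\<Sum>g\<in>UNIV. (gcomm g ?k * \<mu> g) *\<^sub>R W g) * W h))"
      by (simp only: sum_distrib_left mult_scaleC_right)
    also have "\<dots> = (\<Sum>h\<in>UNIV. c h *\<^sub>C ((1/4) *\<^sub>R (\<Sum>g\<in>UNIV. ?r g h *\<^sub>R W (gmul g h))))"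
      by (simp add: sum_distrib_right pauli_operator_mult[OF U])
    finally have 1: "\<pi> (free_embed (free_gen i j * q)) = (\<Sum>h\<in>UNIV. c' h *\<^sub>C W h)"
      by (simp only: sum_regroup[of c ?r W] c'_def)
    have "(\<lambda>n. universal_magic i j * (free_embed q * w n - (\<Sum>h\<in>UNIV. c h *\<^sub>C shifted h (w n))) +
        (\<Sum>h\<in>UNIV. c h *\<^sub>C (gentry universal_magic ?k * shifted h (w n) -
           (1/4) *\<^sub>R (\<Sum>g\<in>UNIV. ?r g h *\<^sub>R shifted (gmul g h) (w n))))) \<longlonglongrightarrow>
        universal_magic i j * 0 + (\<Sum>h\<in>(UNIV :: (4 \<times> 4) set). c h *\<^sub>C 0)"
      by (intro tendsto_add tendsto_mult tendsto_const c tendsto_sum gen bounded_linear.tendsto[OF bounded_linear_scaleC])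
    moreover have "universal_magic i j * (free_embed q * v - (\<Sum>h\<in>UNIV. c h *\<^sub>C shifted h v)) +
        (\<Sum>h\<in>UNIV. c h *\<^sub>C (gentry universal_magic ?k * shifted h v -
           (1/4) *\<^sub>R (\<Sum>g\<in>UNIV. ?r g h *\<^sub>R shifted (gmul g h) v))) =
        free_embed (free_gen i j * q) * v - (\<Sum>h\<in>UNIV. c' h *\<^sub>C shifted h v)" for v
    proof -
      have "(\<Sum>h\<in>UNIV. c' h *\<^sub>C shifted h v) =
          (\<Sum>h\<in>UNIV. c h *\<^sub>C ((1/4) *\<^sub>R (\<Sum>g\<in>UNIV. ?r g h *\<^sub>R shifted (gmul g h) v)))"
        by (simp only: sum_regroup[of c ?r "\<lambda>h. shifted h v"] c'_def)
      then show ?thesis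
        by (simp add: free_embed_mult free_embed_gen right_diff_distrib sum_distrib_left mult_scaleC_right
            scaleC_diff_right sum_subtractf gentry_def mult.assoc)
    qed
    ultimately have "(\<lambda>n. free_embed (free_gen i j * q) * w n - (\<Sum>h\<in>UNIV. c' h *\<^sub>C shifted h (w n))) \<longlonglongrightarrow> 0"
      by simp
    with 1 show ?thesis by (auto simp: G_def)
  qed
  have word: "G (Poly_Mapping.single (Free_Monoid l) d)" for l d
  proof (induction l)
    case Nil
    have 1: "free_embed (Poly_Mapping.single (Free_Monoid []) d) = (d *\<^sub>C 1 :: 4 A_s)"
      by (simp add: free_single_Nil free_embed_scale free_embed_one)
    have "\<pi> (d *\<^sub>C 1) = d *\<^sub>C 1" using hom by (simp add: star_hom_def)
    then show ?case unfolding G_def 1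
      by (intro exI[of _ "\<lambda>h. if h = (1, 1) then d else 0"])
        (simp add: sum_delta_scaleC pauli_operator_one[OF U] mult_scaleC_left del: prod.inject)
  next
    case (Cons p l)
    then show ?case using step[of _ "fst p" "snd p"] by (cases p) (simp add: free_single_Cons)
  qed
  have "G q"
  proof (induction q rule: free_algebra_induct)
    case zero
    show ?case unfolding G_def
      by (intro exI[of _ "\<lambda>_. 0"]) (simp add: free_embed_zero star_hom_zero[OF hom])
  next
    case (single l d)
    show ?case using word[of "letters l" d] by simp
  next
    case (add a b)
    then obtain c d where c: "\<pi> (free_embed a) = (\<Sum>h\<in>UNIV. c h *\<^sub>C W h)"
       "(\<lambda>n. free_embed a * w n - (\<Sum>h\<in>UNIV. c h *\<^sub>C shifted h (w n))) \<longlonglongrightarrow> 0"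
       and d: "\<pi> (free_embed b) = (\<Sum>h\<in>UNIV. d h *\<^sub>C W h)"
       "(\<lambda>n. free_embed b * w n - (\<Sum>h\<in>UNIV. d h *\<^sub>C shifted h (w n))) \<longlonglongrightarrow> 0"
      unfolding G_def by blast
    show ?case unfolding G_def
    proof (intro exI[of _ "\<lambda>h. c h + d h"] conjI)
      show "\<pi> (free_embed (a + b)) = (\<Sum>h\<in>UNIV. (c h + d h) *\<^sub>C W h)"
        using c d by (simp add: free_embed_add star_hom_add[OF hom] scaleC_add_left sum.distrib)
      show "(\<lambda>n. free_embed (a + b) * w n - (\<Sum>h\<in>UNIV. (c h + d h) *\<^sub>C shifted h (w n))) \<longlonglongrightarrow> 0"
        using tendsto_add[OF c(2) d(2)]
        by (simp add: free_embed_add scaleC_add_left sum.distrib distrib_right add_diff_add)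
    qed
  qed
  then show ?thesis by (simp add: G_def \<pi>_def)
qed

lemma pauli_representation_fixed_kernel:
  assumes z: "star z = z" "\<And>h. translate h z = z" and ker: "\<And>x. apply_bcontfun (pauli_representation U z) x = 0"
  shows "z = 0"
proof (rule ccontr)
  assume "z \<noteq> 0"
  define y where "y = inverse (norm z) *\<^sub>R z"
  have "star y = y" "norm y = 1" "translate h y = y" for h
    using z \<open>z \<noteq> 0\<close> by (simp_all add: y_def star_scaleR translate_linear)
  from joint_approx_eigenvalues[OF this] obtain w r \<mu> where w: "\<And>n::nat. norm (w n) = 1" "(\<lambda>n. y * w n - r *\<^sub>R w n) \<longlonglongrightarrow> 0"
      "\<And>g. (\<lambda>n. twisted g (w n) - \<mu> g *\<^sub>R w n) \<longlonglongrightarrow> 0" and r: "\<bar>r\<bar> \<ge> 1 / 2"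
    by blast
  obtain x where x: "\<And>k. apply_bcontfun (gentry (pauli_magic U) k) x = (1/4) *\<^sub>R (\<Sum>g\<in>UNIV. (gcomm g k * \<mu> g) *\<^sub>R W g)"
    using realize_eigenvalues[OF eigenvalue_relations[OF w(1,3)]] by blast
  define \<pi> where "\<pi> y = apply_bcontfun (pauli_representation U y) x" for y
  have hom: "star_hom \<pi>" unfolding \<pi>_def by (rule pauli_eval_hom)
  have y0: "\<pi> y = 0"
    using ker[of x] by (simp add: y_def linear_simps(5)[OF star_hom_bounded_linear[OF hom]]) (simp add: \<pi>_def)
  obtain q where q: "norm (y - free_embed q) < 1 / 100"
    using A_s_dense[of "1 / 100" y] by (auto simp: free_embed_def)
  obtain c where c: "\<pi> (free_embed q) = (\<Sum>h\<in>UNIV. c h *\<^sub>C W h)"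
     "(\<lambda>n. free_embed q * w n - (\<Sum>h\<in>UNIV. c h *\<^sub>C shifted h (w n))) \<longlonglongrightarrow> 0"
    using approx_symbol[OF w(3) x] unfolding \<pi>_def by blast
  \<comment> \<open>As y is killed at x, the value of q there is as small as its distance to y, and
    with it every Pauli coefficient.\<close>
  have "norm (\<pi> (free_embed q)) = norm (\<pi> (y - free_embed q))"
    by (simp add: star_hom_minus[OF hom] y0)
  also have "\<dots> \<le> 1 / 100" using star_hom_contractive[OF hom, of "y - free_embed q"] q by linarith
  finally have cb: "cmod (c h) \<le> 1 / 100" for h
    using pauli_coefficient_le[OF U, of c h] c(1) by simp
  \<comment> \<open>Here e n collects the errors that vanish in the limit. Of the remaining 17 /
    100, one hundredth comes from replacing y by q and sixteen from the coefficients c, one for each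
    h.\<close>
  define e where "e n = norm (y * w n - r *\<^sub>R w n) + norm (free_embed q * w n - (\<Sum>h\<in>UNIV. c h *\<^sub>C shifted h (w n)))" for n
  have "1 / 2 \<le> e n + 17 / 100" for n
  proof -
    let ?s = "\<Sum>h\<in>UNIV. c h *\<^sub>C shifted h (w n)"
    have "norm ?s \<le> (\<Sum>h\<in>(UNIV :: (4 \<times> 4) set). 1 / 100)"
      by (intro sum_norm_le) (simp only: norm_scaleC norm_shifted w(1) mult_1_right cb)
    then have s: "norm ?s \<le> 16 / 100" by simp
    have t: "norm ((y - free_embed q) * w n) \<le> 1 / 100"
      using norm_mult_ineq[of "y - free_embed q" "w n"] q by (simp add: w(1))
    have tri: "norm (a + (b + (c + d))) \<le> norm a + (norm b + (norm c + norm d))" for a b c d :: "4 A_s"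
      by (intro norm_triangle_mono order_refl)
    have eq: "r *\<^sub>R w n = - (y * w n - r *\<^sub>R w n) + ((y - free_embed q) * w n + ((free_embed q * w n - ?s) + ?s))"
      by (simp add: left_diff_distrib)
    have "norm (r *\<^sub>R w n) \<le> norm (- (y * w n - r *\<^sub>R w n)) + (norm ((y - free_embed q) * w n) +
        (norm (free_embed q * w n - ?s) + norm ?s))"
      by (rule ord_eq_le_trans[OF arg_cong[OF eq, of norm] tri])
    then have "norm (r *\<^sub>R w n) \<le> norm (y * w n - r *\<^sub>R w n) + (norm ((y - free_embed q) * w n) +
        (norm (free_embed q * w n - ?s) + norm ?s))"
      by (simp only: norm_minus_cancel)
    then show ?thesis using r s t by (simp add: w(1) e_def)
  qed
  moreover have "e \<longlonglongrightarrow> 0 + 0"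
    unfolding e_def[abs_def] by (intro tendsto_add tendsto_norm_zero w c)
  then have "(\<lambda>n. e n + 17 / 100) \<longlonglongrightarrow> 0 + 0 + 17 / 100" by (intro tendsto_add tendsto_const)
  ultimately have "1 / 2 \<le> (0 + 0 + 17 / 100 :: real)" by (intro LIMSEQ_le_const) auto
  then show False by simp
qed

lemma pauli_representation_kernel:
  assumes "pauli_representation U y = 0"
  shows "y = 0"
proof -
  \<comment> \<open>Up to the factor 16, \<theta> g is the component of y on which the translations
    act by the character of g. The signs cancel in \<open>star (\<theta> g) * \<theta> g\<close>,
    which is therefore fixed by all translations.\<close>
  define \<theta> where "\<theta> g = (\<Sum>h\<in>UNIV. gcomm h g *\<^sub>R translate h y)" for g
  have tr: "translate k (\<theta> g) = gcomm k g *\<^sub>R \<theta> g" for k g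
  proof -
    have "translate k (\<theta> g) = (\<Sum>h\<in>UNIV. gcomm h g *\<^sub>R translate (gmul k h) y)"
      by (simp add: \<theta>_def star_hom_sum[OF star_hom_translate] translate_linear translate_translate)
    also have "\<dots> = (\<Sum>h\<in>UNIV. (gcomm k g * gcomm (gmul k h) g) *\<^sub>R translate (gmul k h) y)"
      by (simp add: gcomm_gmul flip: mult.assoc)
    also have "\<dots> = (\<Sum>h\<in>UNIV. (gcomm k g * gcomm h g) *\<^sub>R translate h y)"
      by (rule sum_gmul[of "\<lambda>h. (gcomm k g * gcomm h g) *\<^sub>R translate h y"])
    finally show ?thesis by (simp add: \<theta>_def scaleR_sum_right)
  qed
  have "\<theta> g = 0" for g
  proof -
    have "star (\<theta> g) * \<theta> g = 0"
    proof (rule pauli_representation_fixed_kernel)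
      show "star (star (\<theta> g) * \<theta> g) = star (\<theta> g) * \<theta> g" by (simp add: star_mult star_star)
      show "translate h (star (\<theta> g) * \<theta> g) = star (\<theta> g) * \<theta> g" for h
        by (simp add: translate_mult translate_star tr star_scaleR)
      fix x
      define \<pi> where "\<pi> y = apply_bcontfun (pauli_representation U y) x" for y
      have hom: "star_hom \<pi>" unfolding \<pi>_def by (rule pauli_eval_hom)
      have "\<pi> (translate h y) = 0" for h
        unfolding \<pi>_def pauli_eval_translate by (simp add: assms)
      then have "\<pi> (\<theta> g) = 0"
        by (simp add: \<theta>_def star_hom_sum[OF hom] linear_simps(5)[OF star_hom_bounded_linear[OF hom]])
      then have "\<pi> (star (\<theta> g) * \<theta> g) = 0" using hom by (simp add: star_hom_def)
      then show "apply_bcontfun (pauli_representation U (star (\<theta> g) * \<theta> g)) x = 0" by (simp add: \<pi>_def)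
    qed
    then show ?thesis using cstar_identity[of "\<theta> g"] by simp
  qed
  moreover have "(\<Sum>g\<in>UNIV. \<theta> g) = 16 *\<^sub>R y"
  proof -
    have "(\<Sum>g\<in>UNIV. \<theta> g) = (\<Sum>h\<in>UNIV. \<Sum>g\<in>UNIV. gcomm h g *\<^sub>R translate h y)"
      unfolding \<theta>_def by (rule sum.swap)
    also have "\<dots> = (\<Sum>h\<in>UNIV. (\<Sum>g\<in>UNIV. gcomm g h) *\<^sub>R translate h y)"
      by (simp add: scaleR_sum_left gcomm_commute)
    also have "\<dots> = (\<Sum>h\<in>UNIV. if h = (1, 1) then 16 *\<^sub>R translate h y else 0)"
      by (rule sum.cong) (simp_all add: gcomm_sum)
    finally show ?thesis by simp
  qed
  ultimately show ?thesis by simp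
qed

end

theorem theorem4p1:
  fixes U :: "complex^2^2 \<Rightarrow> complex^4"
  assumes "hilbert_iso U"
  shows "inj (pauli_representation U)"
proof (rule injI)
  fix x y assume "pauli_representation U x = pauli_representation U y"
  then have "pauli_representation U (x - y) = 0"
    by (simp add: star_hom_minus[OF pauli_representation_hom[OF assms]])
  from pauli_representation_kernel[OF assms this] show "x = y" by simp
qed

end
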